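(* Let $d\ge 1$ and let $U_1,U_2,\dots$ be independent random variables, each uniformly distributed on $\Omega=\mathbb{S}^d/\pm$. (i) For every Borel set $A\subset\mathbb{S}^d$ and every integer $n\ge 1$, $$\mathbb{E}\bigl[m(S_{U_1\dots U_n}A\bigtriangleup A^* )\bigr]\le 2^d\, n^{-1}.$$ (ii) The power law $n^{-1}$ is optimal: there are no constants $p>1$ and $C<\infty$ such that $\mathbb{E}[m(S_{U_1\dots U_n}A\bigtriangleup A^* )]\le C n^{-p}$ for all Borel sets $A\subset\mathbb{S}^d$ and all integers $n\ge 1$. (iii) The sharp constant is at least $d$: if $C$ is a constant such that $\mathbb{E}[m(S_{U_1\dots U_n}A\bigtriangleup A^* )]\le C n^{-1}$ for all Borel sets $A\subset\mathbb{S}^d$ and all integers $n\ge 1$, then $C\ge d$.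
   Context: $\mathbb{S}^d$ is the unit sphere in $\mathbb{R}^{d+1}$, $m$ is the uniform (rotation-invariant) Borel probability measure on $\mathbb{S}^d$, $\delta(x,y)$ is the geodesic distance on $\mathbb{S}^d$ (the angle between $x$ and $y$), and $O\in\mathbb{S}^d$ is a fixed point (the north pole). $\bigtriangleup$ denotes symmetric difference of sets. For $u\in\mathbb{S}^d$ let $\sigma_u(x)=x-2(u\cdot x)u$ be the reflection of $\mathbb{S}^d$ in direction $u$; since $\sigma_u=\sigma_{-u}$, it depends only on the class of $u$ in $\Omega=\mathbb{S}^d/\pm$. For $u$ with $u\cdot O\neq 0$, the polarization $S_uA$ of a set $A\subset\mathbb{S}^d$ is defined, with $\bar x=\sigma_u(x)$, by: if $\delta(x,O)\le\delta(\bar x,O)$, then $x\in S_uA$ if and only if $x\in A$ or $\bar x\in A$; if $\delta(x,O)\ge\delta(\bar x,O)$, then $x\in S_uA$ if and only if $x\in A$ and $\bar x\in A$. (When both conditions hold one has $x=\bar x$, so the definition is consistent. Directions with $u\cdot O=0$ form a null set in $\Omega$ and may be ignored.) The uniform distribution on $\Omega$ is the image of $m$ under the quotient map $\mathbb{S}^d\to\Omega$. For $u_1,\dots,u_n\in\Omega$, $S_{u_1\dots u_n}=S_{u_n}\circ\cdots\circ S_{u_1}$. For a Borel set $A\subset\mathbb{S}^d$, $A^*$ denotes the polar cap, i.e. the geodesic ball centered at $O$, with $m(A^* )=m(A)$. *)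

theory Defs
  imports "HOL-Probability.Probability"
begin

section \<open>The uniform measure on the sphere\<close>

text \<open>
  The sphere S^d is the library's \<open>sphere 0 1\<close> in a Euclidean space of dimension d + 1.
  Its uniform distribution is obtained by projecting the normalised Lebesgue measure of the
  unit ball radially. The map \<open>sgn x = x /\<^sub>R norm x\<close> sends only the origin, a null set,
  outside the sphere. Lemmas \<open>prob_space_sphere_measure\<close> and
  \<open>sphere_measure_orthogonal_invariant\<close> below confirm that this is the rotation-invariant
  Borel probability measure.
\<close>

definition sphere_measure :: "'a::euclidean_space measure" where
  "sphere_measure =
     restrict_space (distr (uniform_measure lborel (ball 0 1)) borel sgn) (sphere 0 1)"

lemma space_sphere_measure [simp]: "space sphere_measure = sphere 0 1"
  by (simp add: sphere_measure_def space_restrict_space)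

lemma sets_sphere_measure: "sets sphere_measure = sets (restrict_space borel (sphere 0 1))"
  unfolding sphere_measure_def by (rule sets_restrict_space_cong) simp

lemma sets_sphere_measure_iff:
  fixes A :: "'a::euclidean_space set"
  shows "A \<in> sets sphere_measure \<longleftrightarrow> A \<in> sets borel \<and> A \<subseteq> sphere 0 1"
  unfolding sets_sphere_measure by (subst sets_restrict_space_iff) auto

lemma sgn_measurable_euclidean [measurable]:
  "(sgn :: 'a::euclidean_space \<Rightarrow> 'a) \<in> borel_measurable borel"
  unfolding sgn_div_norm[abs_def] by measurable

lemma emeasure_sphere_measure:
  fixes A :: "'a::euclidean_space set"
  assumes "A \<in> sets sphere_measure"
  shows "emeasure sphere_measure A =
    emeasure lborel (ball 0 1 \<inter> sgn -` A) / emeasure lborel (ball 0 1 :: 'a set)"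
proof -
  have A: "A \<in> sets borel" "A \<subseteq> sphere 0 1"
    using assms by (auto simp: sets_sphere_measure_iff)
  have "sgn -` A \<in> sets (borel :: 'a measure)"
    using measurable_sets[OF sgn_measurable_euclidean A(1)] by simp
  with A show ?thesis
    by (simp add: sphere_measure_def emeasure_restrict_space emeasure_distr
        emeasure_uniform_measure)
qed

lemma prob_space_sphere_measure: "prob_space (sphere_measure :: 'a::euclidean_space measure)"
proof
  have pos: "emeasure lborel (ball (0::'a) 1) \<noteq> 0"
    using content_ball_pos[of 1 "0::'a"] by (auto simp: measure_def)
  have fin: "emeasure lborel (ball (0::'a) 1) \<noteq> \<infinity>"
    using emeasure_bounded_finite[of "ball (0::'a) 1"] by simp
  have S: "sphere (0::'a) 1 \<in> sets sphere_measure"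
    by (simp add: sets_sphere_measure_iff)
  have "ball (0::'a) 1 \<inter> sgn -` sphere 0 1 = ball 0 1 - {0}"
    by (auto simp: norm_sgn split: if_splits)
  moreover have "emeasure lborel (ball (0::'a) 1 - {0}) = emeasure lborel (ball (0::'a) 1)"
    by (rule emeasure_Diff_null_set) auto
  ultimately show "emeasure sphere_measure (space (sphere_measure :: 'a measure)) = 1"
    using pos fin by (simp add: emeasure_sphere_measure[OF S] ennreal_divide_self less_top)
qed

lemma emeasure_lborel_orthogonal_vimage:
  fixes f :: "'a::euclidean_space \<Rightarrow> 'a"
  assumes f: "orthogonal_transformation f" and B [measurable]: "B \<in> sets borel"
  shows "emeasure lborel (f -` B) = emeasure lborel B"
proof -
  have lin: "linear f"
    using f by (rule orthogonal_transformation_linear)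
  have fm [measurable]: "f \<in> borel_measurable borel"
    using lin by (intro borel_measurable_continuous_onI linear_continuous_on)
      (simp add: linear_conv_bounded_linear)
  define E :: "'a set" where "E = ball 0 1"
  have E [measurable]: "E \<in> sets borel"
    by (simp add: E_def)
  define c where "c = emeasure lborel E"
  have c: "c \<noteq> 0" "c \<noteq> \<infinity>"
    using content_ball_pos[of 1 "0::'a"] emeasure_bounded_finite[of "ball (0::'a) 1"]
    by (auto simp: c_def E_def measure_def)
  have transl: "(\<integral>\<^sup>+ x. g (t + x) \<partial>lborel) = (\<integral>\<^sup>+ x. g x \<partial>lborel)"
    if [measurable]: "g \<in> borel_measurable borel" for g :: "'a \<Rightarrow> ennreal" and t :: 'a
  proof -
    have "(\<integral>\<^sup>+ x. g x \<partial>lborel) = (\<integral>\<^sup>+ x. g x \<partial>distr lborel borel ((+) t))"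
      using lborel_affine[of 1 t] by (simp add: density_1)
    then show ?thesis
      by (simp add: nn_integral_distr)
  qed
  have "emeasure lborel (f -` B) * c =
      (\<integral>\<^sup>+ y. (\<integral>\<^sup>+ x. indicator B (f x + y) * indicator E y \<partial>lborel) \<partial>lborel)"
  proof -
    have "(\<integral>\<^sup>+ x. indicator B (f x + y) * indicator E y \<partial>lborel) =
        emeasure lborel (f -` B) * indicator E y" for y
    proof -
      obtain z where z: "f z = y"
        using orthogonal_transformation_surj[OF f] by (metis surjD)
      have "(\<integral>\<^sup>+ x. indicator B (f x + y) \<partial>lborel) =
          (\<integral>\<^sup>+ x. indicator B (f (z + x)) \<partial>lborel)"
        by (simp add: linear_add[OF lin] z add.commute)
      also have "\<dots> = (\<integral>\<^sup>+ x. indicator B (f x) \<partial>lborel)"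
        by (rule transl[where g = "\<lambda>x. indicator B (f x)"]) measurable
      also have "\<dots> = (\<integral>\<^sup>+ x. indicator (f -` B) x \<partial>lborel)"
        by (simp add: indicator_def)
      also have "\<dots> = emeasure lborel (f -` B)"
        using measurable_sets[OF fm B] by simp
      finally show ?thesis
        by (simp add: nn_integral_multc)
    qed
    then show ?thesis
      by (simp add: nn_integral_cmult c_def)
  qed
  also have "\<dots> = (\<integral>\<^sup>+ x. (\<integral>\<^sup>+ y. indicator B (f x + y) * indicator E y \<partial>lborel) \<partial>lborel)"
    by (rule lborel_pair.Fubini') measurable
  also have "\<dots> = (\<integral>\<^sup>+ x. (\<integral>\<^sup>+ y. indicator B y * indicator E (y - f x) \<partial>lborel) \<partial>lborel)"
  proof -
    have "(\<integral>\<^sup>+ y. indicator B (f x + y) * indicator E y \<partial>lborel) =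
        (\<integral>\<^sup>+ y. indicator B y * indicator E (y - f x) \<partial>lborel)" for x
      using transl[of "\<lambda>y. indicator B y * indicator E (y - f x)" "f x"] by simp
    then show ?thesis by simp
  qed
  also have "\<dots> = (\<integral>\<^sup>+ y. (\<integral>\<^sup>+ x. indicator B y * indicator E (y - f x) \<partial>lborel) \<partial>lborel)"
    by (rule lborel_pair.Fubini') measurable
  also have "\<dots> = (\<integral>\<^sup>+ y. c * indicator B y \<partial>lborel)"
  proof -
    have "(\<integral>\<^sup>+ x. indicator B y * indicator E (y - f x) \<partial>lborel) = c * indicator B y" for y
    proof -
      obtain z where z: "f z = y"
        using orthogonal_transformation_surj[OF f] by (metis surjD)
      have "indicator E (y - f x) = (indicator E (- z + x) :: ennreal)" for x
      proof -
        have "norm (y - f x) = norm (f (- z + x))"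
          by (simp add: linear_diff[OF lin] z norm_minus_commute)
        also have "\<dots> = norm (- z + x)"
          using f by (rule orthogonal_transformation_norm)
        finally show ?thesis by (simp add: E_def indicator_def)
      qed
      then have "(\<integral>\<^sup>+ x. indicator E (y - f x) \<partial>lborel) = c"
        using transl[of "indicator E" "- z"] by (simp add: c_def)
      then show ?thesis
        by (simp add: nn_integral_cmult mult.commute)
    qed
    then show ?thesis by simp
  qed
  also have "\<dots> = emeasure lborel B * c"
    by (simp add: nn_integral_cmult mult.commute)
  finally show ?thesis
    using c by (metis ennreal_mult_cancel_left mult.commute infinity_ennreal_def)
qed

lemma sphere_measure_orthogonal_invariant:
  fixes f :: "'a::euclidean_space \<Rightarrow> 'a"
  assumes f: "orthogonal_transformation f"
  shows "distr sphere_measure sphere_measure f = sphere_measure"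
proof (rule measure_eqI)
  have lin: "linear f" and nrm: "norm (f x) = norm x" for x
    using f by (auto simp: orthogonal_transformation_linear orthogonal_transformation_norm)
  have fm: "f \<in> borel_measurable borel"
    using lin by (intro borel_measurable_continuous_onI linear_continuous_on)
      (simp add: linear_conv_bounded_linear)
  have fS: "f \<in> sphere_measure \<rightarrow>\<^sub>M sphere_measure"
    unfolding measurable_cong_sets[OF sets_sphere_measure sets_sphere_measure]
    by (rule measurable_restrict_space3[OF fm]) (simp add: nrm)
  fix A :: "'a set" assume "A \<in> sets (distr sphere_measure sphere_measure f)"
  then have A: "A \<in> sets sphere_measure" by simp
  then have A': "A \<in> sets borel" "A \<subseteq> sphere 0 1"
    by (auto simp: sets_sphere_measure_iff)
  have sgnA: "sgn -` A \<in> sets (borel :: 'a measure)"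
    using measurable_sets[OF sgn_measurable_euclidean A'(1)] by simp
  have pre: "f -` A \<inter> sphere 0 1 \<in> sets sphere_measure"
    using measurable_sets[OF fS A] by simp
  have sgn: "sgn (f x) = f (sgn x)" for x
    by (simp add: sgn_div_norm nrm linear_scale[OF lin])
  have "ball 0 1 \<inter> sgn -` (f -` A \<inter> sphere 0 1) = f -` (ball 0 1 \<inter> sgn -` A)"
    using A'(2) by (auto simp: nrm sgn)
  then show "emeasure (distr sphere_measure sphere_measure f) A = emeasure sphere_measure A"
    using sgnA emeasure_lborel_orthogonal_vimage[OF f, of "ball 0 1 \<inter> sgn -` A"]
    by (simp add: emeasure_distr[OF fS A] emeasure_sphere_measure[OF A]
        emeasure_sphere_measure[OF pre])
qed simp


section \<open>Geodesic distance and polar caps\<close>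

definition geodesic_dist :: "'a::euclidean_space \<Rightarrow> 'a \<Rightarrow> real" where
  "geodesic_dist x y = arccos (x \<bullet> y)"

definition geodesic_ball :: "'a::euclidean_space \<Rightarrow> real \<Rightarrow> 'a set" where
  "geodesic_ball z r = {x \<in> sphere 0 1. geodesic_dist x z \<le> r}"

text \<open>
  The polar cap about \<open>z\<close> with the measure of \<open>A\<close>. Its radius in \<open>{0..pi}\<close> is determined by
  the measure of \<open>A\<close>; taking the closed rather than the open ball only affects a null set.
\<close>

definition polar_cap :: "'a::euclidean_space \<Rightarrow> 'a set \<Rightarrow> 'a set" where
  "polar_cap z A = geodesic_ball z
     (SOME r. r \<in> {0..pi} \<and>
        measure sphere_measure (geodesic_ball z r) = measure sphere_measure A)"


section \<open>Polarization\<close>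

definition reflection :: "'a::euclidean_space \<Rightarrow> 'a \<Rightarrow> 'a" where
  "reflection u x = x - (2 * (u \<bullet> x)) *\<^sub>R u"

text \<open>
  Directions \<open>u\<close> orthogonal to the pole \<open>z\<close> form a null set. There the two clauses defining
  the polarization conflict, and we let it act as the identity.
\<close>

definition polarization_dir :: "'a::euclidean_space \<Rightarrow> 'a \<Rightarrow> 'a set \<Rightarrow> 'a set" where
  "polarization_dir z u A =
     (if u \<bullet> z = 0 then A
      else {x \<in> sphere 0 1.
             if geodesic_dist x z \<le> geodesic_dist (reflection u x) z
             then x \<in> A \<or> reflection u x \<in> A
             else x \<in> A \<and> reflection u x \<in> A})"

lemma reflection_minus: "reflection (- u) = reflection u"
  by (auto simp: reflection_def fun_eq_iff)

lemma polarization_dir_minus: "polarization_dir z (- u) = polarization_dir z u"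
  by (auto simp: polarization_dir_def reflection_minus fun_eq_iff)

lemma polarization_dir_upper:
  assumes "u \<bullet> z \<noteq> 0" "x \<in> sphere 0 1"
    and "geodesic_dist x z \<le> geodesic_dist (reflection u x) z"
  shows "x \<in> polarization_dir z u A \<longleftrightarrow> x \<in> A \<or> reflection u x \<in> A"
  using assms by (simp add: polarization_dir_def)

lemma polarization_dir_lower:
  assumes u: "norm u = 1" "u \<bullet> z \<noteq> 0" and x: "x \<in> sphere 0 1" and z: "norm z = 1"
    and le: "geodesic_dist x z \<ge> geodesic_dist (reflection u x) z"
  shows "x \<in> polarization_dir z u A \<longleftrightarrow> x \<in> A \<and> reflection u x \<in> A"
proof (cases "geodesic_dist x z = geodesic_dist (reflection u x) z")
  case True
  have uu: "u \<bullet> u = 1"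
    using u by (simp add: norm_eq_1)
  have "reflection u x \<bullet> reflection u x = 1"
    using x uu by (simp add: reflection_def inner_diff inner_commute norm_eq_1 algebra_simps)
  then have "norm (reflection u x) = 1"
    by (simp add: norm_eq_1)
  then have "\<bar>x \<bullet> z\<bar> \<le> 1" "\<bar>reflection u x \<bullet> z\<bar> \<le> 1"
    using Cauchy_Schwarz_ineq2[of x z] Cauchy_Schwarz_ineq2[of "reflection u x" z] x z by auto
  with True have "x \<bullet> z = reflection u x \<bullet> z"
    by (simp add: geodesic_dist_def arccos_eq_iff)
  then have "reflection u x = x"
    using u by (simp add: reflection_def inner_diff_left)
  then show ?thesis
    using u x by (simp add: polarization_dir_def)
next
  case False
  with le u x show ?thesis by (simp add: polarization_dir_def)
qed


section \<open>The projective space of directions\<close>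

text \<open>Points of \<open>\<Omega> = S^d / \<plusminus>\<close> are the classes \<open>{u, - u}\<close>; \<open>\<Omega>\<close> carries the quotient
  sigma-algebra and the image of the uniform measure.\<close>

definition dir_class :: "'a::euclidean_space \<Rightarrow> 'a set" where
  "dir_class u = {u, - u}"

definition directions :: "'a::euclidean_space set set" where
  "directions = dir_class ` sphere 0 1"

definition directions_algebra :: "'a::euclidean_space set measure" where
  "directions_algebra = sigma directions
     {B. B \<subseteq> directions \<and> dir_class -` B \<inter> sphere 0 1 \<in> sets sphere_measure}"

definition uniform_directions :: "'a::euclidean_space set measure" where
  "uniform_directions = distr sphere_measure directions_algebra dir_class"

lemma sets_directions_algebra:
  "sets directions_algebra =
     {B. B \<subseteq> directions \<and>
         dir_class -` B \<inter> sphere 0 1 \<in> sets (sphere_measure :: 'a::euclidean_space measure)}"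
  (is "_ = ?Q")
proof -
  have "sigma_algebra (directions :: 'a set set) ?Q"
  proof (unfold sigma_algebra_iff2, intro conjI ballI allI impI)
    show "?Q \<subseteq> Pow directions" by auto
    show "{} \<in> ?Q" by simp
  next
    fix B assume B: "B \<in> ?Q"
    have "dir_class -` (directions - B) \<inter> sphere 0 1 =
        space (sphere_measure :: 'a measure) - (dir_class -` B \<inter> sphere 0 1)"
      by (auto simp: directions_def)
    moreover have "space (sphere_measure :: 'a measure) - (dir_class -` B \<inter> sphere 0 1)
        \<in> sets sphere_measure"
      using B by (intro sets.compl_sets) simp
    ultimately show "directions - B \<in> ?Q" by auto
  next
    fix B :: "nat \<Rightarrow> 'a set set" assume B: "range B \<subseteq> ?Q"
    have "dir_class -` (\<Union>i. B i) \<inter> sphere 0 1 = (\<Union>i. dir_class -` B i \<inter> sphere 0 1)"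
      by auto
    also have "\<dots> \<in> sets (sphere_measure :: 'a measure)"
      using B by (intro sets.countable_UN) auto
    finally show "(\<Union>i. B i) \<in> ?Q" using B by blast
  qed
  then show ?thesis
    by (simp add: directions_algebra_def sigma_algebra.sets_measure_of_eq)
qed

lemma dir_class_measurable: "dir_class \<in> sphere_measure \<rightarrow>\<^sub>M directions_algebra"
proof (rule measurableI)
  fix u :: 'a assume "u \<in> space sphere_measure"
  then show "dir_class u \<in> space directions_algebra"
    by (simp add: directions_algebra_def directions_def space_measure_of_conv)
next
  fix B :: "'a set set" assume "B \<in> sets directions_algebra"
  then show "dir_class -` B \<inter> space sphere_measure \<in> sets sphere_measure"
    by (simp add: sets_directions_algebra)
qed

definition polarization :: "'a::euclidean_space \<Rightarrow> 'a set \<Rightarrow> 'a set \<Rightarrow> 'a set" where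
  "polarization z w = polarization_dir z (SOME u. u \<in> w)"

lemma polarization_dir_class: "polarization z (dir_class u) = polarization_dir z u"
proof -
  have "(SOME v. v \<in> dir_class u) \<in> dir_class u"
    by (rule someI[of _ u]) (simp add: dir_class_def)
  then show ?thesis
    by (auto simp: polarization_def dir_class_def polarization_dir_minus)
qed

text \<open>\<open>polarizations z [u1, \<dots>, un] = polarization z un \<circ> \<dots> \<circ> polarization z u1\<close>\<close>

definition polarizations :: "'a::euclidean_space \<Rightarrow> 'a set list \<Rightarrow> 'a set \<Rightarrow> 'a set" where
  "polarizations z ws = fold (polarization z) ws"

text \<open>\<open>E[m(S_{U_1 \<dots> U_n} A \<triangle> A*)]\<close> for random directions \<open>U 1, U 2, \<dots>\<close> on the probability
  space \<open>P\<close>\<close>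

definition expected_distance ::
  "'w measure \<Rightarrow> (nat \<Rightarrow> 'w \<Rightarrow> 'a set) \<Rightarrow> 'a::euclidean_space \<Rightarrow> 'a set \<Rightarrow> nat \<Rightarrow> real" where
  "expected_distance P U z A n = prob_space.expectation P (\<lambda>\<omega>.
     measure sphere_measure
       (sym_diff (polarizations z (map (\<lambda>i. U i \<omega>) [1..<Suc n]) A) (polar_cap z A)))"

end

theory Submission
  imports Defs
begin

text \<open>
  Upper bound: a polarization \<open>S\<^sub>u\<close> lowers \<open>m(A \<triangle> A*)\<close> by twice the measure of those
  \<open>x \<in> A* - A\<close> whose mirror image lies in \<open>A - A*\<close>. For fixed \<open>x\<close> and uniform \<open>u\<close> the mirror
  image has density \<open>|x - y|\<^sup>1\<^sup>-\<^sup>d \<ge> 2\<^sup>1\<^sup>-\<^sup>d\<close>, so the expected distance \<open>a\<^sub>n\<close> satisfies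
  \<open>a\<^sub>n\<^sub>+\<^sub>1 \<le> a\<^sub>n - a\<^sub>n\<^sup>2 / 2\<^sup>d\<close> by Jensen.

  Lower bounds: polarizing a hemisphere with normal \<open>v\<close> gives a hemisphere, and its distance from
  \<open>A*\<close> is \<open>\<theta> / \<pi>\<close>, \<open>\<theta>\<close> being the angle between \<open>v\<close> and the pole. One step lowers the
  expectation of \<open>ln \<theta>\<close>, or rather of \<open>ln (1 - cos \<theta>) / 2\<close>, by at most \<open>(\<theta> / \<pi>) / d\<close>.
  Hence \<open>a\<^sub>n \<ge> K exp (- (a\<^sub>0 + \<dots> + a\<^sub>n\<^sub>-\<^sub>1) / d)\<close>, which excludes \<open>a\<^sub>n \<le> c / n\<close> for large \<open>n\<close>
  whenever \<open>c < d\<close>.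
\<close>

text \<open>The lower bound closes up because the mean drop of the logarithm is at most a multiple
  of the distance itself: summing the drops produces only the averages \<open>a\<^sub>k\<close>, and
  concavity of the logarithm leads back from the mean of a logarithm to the logarithm of the mean.
  The slope 1/d is the mean of 1 - s, where s is the length of the component of u orthogonal to a
  plane through v and the pole z. The function ln (1 - cos \<theta>) / 2 differs from ln \<theta> by
  a bounded amount, and 1 - cos \<theta> = \<open>1 - v \<bullet> z\<close> changes under a
  reflection by twice the product of \<open>u \<bullet> v\<close> and \<open>u \<bullet> z\<close>,
  which is easily averaged over the rotations of that plane. A positive \<delta> in the argument of
  the logarithm keeps it finite at \<theta> = 0. The obstacle in the upper bound is the change of
  variables on the sphere from u to the mirror image of x. Since the uniform measure is the radial
  image of Lebesgue measure on the ball, it can be carried out there, one line at a time, with a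
  one-dimensional Jacobian.\<close>

lemma linear_borel_measurable:
  fixes f :: "'a::euclidean_space \<Rightarrow> 'b::euclidean_space"
  assumes "linear f" shows "f \<in> borel_measurable borel"
  using assms by (intro borel_measurable_continuous_onI linear_continuous_on)
      (simp add: linear_conv_bounded_linear)

lemma orthogonal_transformation_measurable_sphere:
  fixes f :: "'a::euclidean_space \<Rightarrow> 'a"
  assumes f: "orthogonal_transformation f"
  shows "f \<in> sphere_measure \<rightarrow>\<^sub>M sphere_measure"
  unfolding measurable_cong_sets[OF sets_sphere_measure sets_sphere_measure]
  by (rule measurable_restrict_space3[OF linear_borel_measurable])
     (auto simp: orthogonal_transformation_linear orthogonal_transformation_norm f)

lemma nn_integral_sphere_orthogonal:
  fixes f :: "'a::euclidean_space \<Rightarrow> 'a"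
  assumes f: "orthogonal_transformation f" and h: "h \<in> borel_measurable sphere_measure"
  shows "(\<integral>\<^sup>+u. h (f u) \<partial>sphere_measure) = (\<integral>\<^sup>+u. h u \<partial>sphere_measure)"
  using nn_integral_distr[OF orthogonal_transformation_measurable_sphere[OF f], of h] h
  by (simp add: sphere_measure_orthogonal_invariant[OF f])

lemma integral_sphere_orthogonal:
  fixes f :: "'a::euclidean_space \<Rightarrow> 'a" and h :: "'a \<Rightarrow> real"
  assumes f: "orthogonal_transformation f" and h: "h \<in> borel_measurable sphere_measure"
  shows "(\<integral>u. h (f u) \<partial>sphere_measure) = (\<integral>u. h u \<partial>sphere_measure)"
  using integral_distr[OF orthogonal_transformation_measurable_sphere[OF f], of h] h
  by (simp add: sphere_measure_orthogonal_invariant[OF f])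

lemma borel_measurable_sphere:
  "h \<in> borel \<rightarrow>\<^sub>M N \<Longrightarrow> h \<in> sphere_measure \<rightarrow>\<^sub>M N"
  unfolding measurable_cong_sets[OF sets_sphere_measure refl]
  by (rule measurable_restrict_space1)

lemma orthogonal_transformation_reflection:
  fixes u :: "'a::euclidean_space"
  assumes "norm u = 1"
  shows "orthogonal_transformation (reflection u)"
proof -
  have uu: "u \<bullet> u = 1" using assms by (simp add: norm_eq_1)
  have "linear (reflection u)"
    by (rule linearI) (auto simp: reflection_def algebra_simps inner_add_right)
  then show ?thesis
    by (simp add: orthogonal_transformation_def reflection_def inner_diff_left inner_diff_right inner_commute uu algebra_simps)
qed

section \<open>Integration along parallel lines and a measure-preserving map of the real
  line\<close>

lemma nn_integral_lborel_translate:
  fixes G :: "'a::euclidean_space \<Rightarrow> ennreal"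
  assumes [measurable]: "G \<in> borel_measurable borel"
  shows "(\<integral>\<^sup>+x. G (t + x) \<partial>lborel) = (\<integral>\<^sup>+x. G x \<partial>lborel)"
proof -
  have "(\<integral>\<^sup>+ x. G x \<partial>lborel) = (\<integral>\<^sup>+ x. G x \<partial>distr lborel borel ((+) t))"
    using lborel_affine[of 1 t] by (simp add: density_1)
  then show ?thesis by (simp add: nn_integral_distr)
qed

text \<open>A coordinate-free Fubini theorem: the lines in direction \<open>x\<close> are weighted by their segment in the
  slab \<open>0 \<le> y \<bullet> x < 1\<close>.\<close>

lemma nn_integral_lborel_lines:
  fixes G :: "'a::euclidean_space \<Rightarrow> ennreal"
  assumes [measurable]: "G \<in> borel_measurable borel" and x: "norm x = 1"
  shows "(\<integral>\<^sup>+y. G y \<partial>lborel) =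
    (\<integral>\<^sup>+y. indicator {0..<1} (y \<bullet> x) * (\<integral>\<^sup>+t. G (y + t *\<^sub>R x) \<partial>lborel) \<partial>lborel)"
proof -
  have xx: "x \<bullet> x = 1" using x by (simp add: norm_eq_1)
  have *: "(\<integral>\<^sup>+t. indicator {0..<1} (y \<bullet> x - t) \<partial>lborel) = (1::ennreal)" for y
  proof -
    have "(\<integral>\<^sup>+t. indicator {0..<1} (y \<bullet> x - t) \<partial>lborel) = (\<integral>\<^sup>+t. indicator {y \<bullet> x - 1<..y \<bullet> x} t \<partial>(lborel::real measure))"
      by (intro nn_integral_cong) (auto simp: indicator_def)
    then show ?thesis by simp
  qed
  have "(\<integral>\<^sup>+y. G y \<partial>lborel) = (\<integral>\<^sup>+y. (\<integral>\<^sup>+t. G y * indicator {0..<1} (y \<bullet> x - t) \<partial>lborel) \<partial>lborel)"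
    by (simp add: nn_integral_cmult *)
  also have "\<dots> = (\<integral>\<^sup>+t. (\<integral>\<^sup>+y. G y * indicator {0..<1} (y \<bullet> x - t) \<partial>lborel) \<partial>lborel)"
    by (rule lborel_pair.Fubini') measurable
  also have "\<dots> = (\<integral>\<^sup>+t. (\<integral>\<^sup>+y. G (y + t *\<^sub>R x) * indicator {0..<1} (y \<bullet> x) \<partial>lborel) \<partial>lborel)"
  proof (rule nn_integral_cong)
    fix t
    show "(\<integral>\<^sup>+y. G y * indicator {0..<1} (y \<bullet> x - t) \<partial>lborel) =
      (\<integral>\<^sup>+y. G (y + t *\<^sub>R x) * indicator {0..<1} (y \<bullet> x) \<partial>lborel)"
      using nn_integral_lborel_translate[of "\<lambda>y. G y * indicator {0..<1} (y \<bullet> x - t)" "t *\<^sub>R x"]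
      by (simp add: inner_add_left xx add.commute)
  qed
  also have "\<dots> = (\<integral>\<^sup>+y. (\<integral>\<^sup>+t. G (y + t *\<^sub>R x) * indicator {0..<1} (y \<bullet> x) \<partial>lborel) \<partial>lborel)"
    by (rule lborel_pair.Fubini') measurable
  finally show ?thesis by (simp add: nn_integral_multc mult.commute)
qed

text \<open>Boole's measure-preserving map, restricted to one of its two branches.\<close>

lemma nn_integral_joukowski:
  fixes a :: real and F :: "real \<Rightarrow> ennreal"
  assumes a: "a > 0" and F[measurable]: "F \<in> borel_measurable borel"
  shows "(\<integral>\<^sup>+t. indicator {0<..} t * ennreal ((1 + a / t\<^sup>2) / 2) * F ((t - a / t) / 2) \<partial>lborel)
    = (\<integral>\<^sup>+t. F t \<partial>lborel)"
proof -
  define N :: "real measure" where "N = density lborel (\<lambda>t. indicator {0<..} t * ennreal ((1 + a / t\<^sup>2) / 2))"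
  define g where "g t = (t - a / t) / 2" for t :: real
  have [measurable]: "g \<in> borel_measurable borel" unfolding g_def by measurable
  \<comment> \<open>\<open>h s\<close> is the positive root of
    \<open>t\<^sup>2 - 2 * s * t - a = 0\<close>, that is, the inverse of \<open>g\<close> on the
    positive half-line.\<close>
  define h where "h s = s + sqrt (s\<^sup>2 + a)" for s
  have hpos: "h s > 0" for s
  proof -
    have "\<bar>s\<bar> < sqrt (s\<^sup>2 + a)" using a by (intro real_less_rsqrt) auto
    then show ?thesis unfolding h_def by linarith
  qed
  have gh: "g (h s) = s" for s
  proof -
    have "h s * h s - a = 2 * s * h s"
      using a by (simp add: h_def algebra_simps power2_eq_square add_nonneg_nonneg)
    then have "a / h s = h s - 2 * s" using hpos[of s] by (simp add: field_simps)
    then show ?thesis by (simp add: g_def)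
  qed
  have gmono: "g x < g y" if "0 < x" "x < y" for x y
    using that a by (simp add: g_def) (smt (verit, best) frac_less2)
  have g_le: "g t \<le> u \<longleftrightarrow> t \<le> h u" "u \<le> g t \<longleftrightarrow> h u \<le> t" if "t > 0" for t u
    using gmono[OF that, of "h u"] gmono[OF hpos[of u], of t] gh[of u] by (smt (verit))+
  \<comment> \<open>A Borel measure that gives every open interval its length is Lebesgue measure.
    Among positive t the preimage of \<open>{l<..<u}\<close> is the interval from \<open>h l\<close>
    to \<open>h u\<close>, and \<open>g\<close> is an antiderivative of the density of
    \<open>N\<close>.\<close>
  have "lborel = distr N borel g"
  proof (rule lborel_eqI)
    fix l u :: real assume "\<And>b. b \<in> Basis \<Longrightarrow> l \<bullet> b \<le> u \<bullet> b"
    then have lu: "l \<le> u" by simp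
    have hlu: "h l \<le> h u" using g_le(2)[OF hpos[of u], of l] gh[of u] lu by simp
    have pre: "g -` {l<..<u} \<in> sets borel"
      using measurable_sets[of g borel borel "{l<..<u}"] by simp
    have "emeasure (distr N borel g) (box l u) = emeasure (distr N borel g) {l<..<u}"
      by (simp add: box_real)
    also have "\<dots> = emeasure N (g -` {l<..<u} \<inter> space N)"
      by (rule emeasure_distr) (auto simp: N_def)
    also have "\<dots> = (\<integral>\<^sup>+t. indicator {0<..} t * ennreal ((1 + a / t\<^sup>2) / 2) * indicator (g -` {l<..<u}) t \<partial>lborel)"
      unfolding N_def using pre by (simp add: emeasure_density)
    also have "\<dots> = (\<integral>\<^sup>+t. ennreal ((1 + a / t\<^sup>2) / 2) * indicator {h l..h u} t \<partial>lborel)"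
    proof (rule nn_integral_cong_AE)
      have "AE t in lborel. t \<noteq> h l" "AE t in lborel. t \<noteq> h u"
        by (rule AE_lborel_singleton)+
      then show "AE t in lborel. indicator {0<..} t * ennreal ((1 + a / t\<^sup>2) / 2) * indicator (g -` {l<..<u}) t =
          ennreal ((1 + a / t\<^sup>2) / 2) * indicator {h l..h u} t"
      proof eventually_elim
        case (elim t)
        show ?case
        proof (cases "t > 0")
          case True
          then have "t \<in> g -` {l<..<u} \<longleftrightarrow> t \<in> {h l..h u}"
            using elim g_le[OF True] by (auto simp: not_le[symmetric]) 
          with True show ?thesis by (simp add: indicator_def)
        next
          case False
          then have "t \<notin> {h l..h u}" using hpos[of l] by auto
          with False show ?thesis by simp
        qed
      qed
    qed
    also have "\<dots> = ennreal (g (h u) - g (h l))"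
    proof (rule nn_integral_FTC_Icc)
      show "(\<lambda>t. (1 + a / t\<^sup>2) / 2) \<in> borel_measurable borel" by measurable
      show "(g has_real_derivative (1 + a / x\<^sup>2) / 2) (at x)" if "x \<in> {h l..h u}" for x
      proof -
        have "x > 0" using that hpos[of l] by auto
        then show ?thesis unfolding g_def
          by (auto intro!: derivative_eq_intros simp: power2_eq_square)
      qed
      show "0 \<le> (1 + a / x\<^sup>2) / 2" for x using a by simp
      show "h l \<le> h u" by (rule hlu)
    qed
    finally show "emeasure (distr N borel g) (box l u) = ennreal (\<Prod>b\<in>Basis. (u - l) \<bullet> b)"
      by (simp add: gh)
  qed simp
  then have "(\<integral>\<^sup>+t. F t \<partial>lborel) = (\<integral>\<^sup>+t. F t \<partial>distr N borel g)" by simp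
  also have "\<dots> = (\<integral>\<^sup>+t. F (g t) \<partial>N)"
    by (subst nn_integral_distr) (auto simp: N_def)
  also have "\<dots> = (\<integral>\<^sup>+t. indicator {0<..} t * ennreal ((1 + a / t\<^sup>2) / 2) * F (g t) \<partial>lborel)"
    unfolding N_def by (subst nn_integral_density) auto
  finally show ?thesis by (simp add: g_def)
qed

section \<open>Polar coordinates and null sets of the sphere\<close>

lemma emeasure_lborel_scale:
  fixes X :: "'a::euclidean_space set"
  assumes "c > 0" and [measurable]: "X \<in> sets borel"
  shows "emeasure lborel X = ennreal (c ^ DIM('a)) * emeasure lborel {x. c *\<^sub>R x \<in> X}"
proof -
  have X': "(\<lambda>x. c *\<^sub>R x) -` X \<in> sets (borel :: 'a measure)"
    using measurable_sets[of "\<lambda>x::'a. c *\<^sub>R x" borel borel X] by simp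
  have "emeasure lborel X = emeasure (density (distr lborel borel (\<lambda>x. 0 + c *\<^sub>R x)) (\<lambda>_. ennreal (\<bar>c\<bar>^DIM('a)))) X"
    using lborel_affine[of c "0::'a"] assms by (simp add: ennreal_power)
  also have "\<dots> = ennreal (c ^ DIM('a)) * emeasure lborel ((\<lambda>x. c *\<^sub>R x) -` X)"
    using assms(1) X' by (simp add: emeasure_density nn_integral_cmult emeasure_distr)
  finally show ?thesis by (simp add: vimage_def)
qed

lemma emeasure_unit_ball:
  "emeasure lborel (ball (0::'a::euclidean_space) 1) \<noteq> 0" "emeasure lborel (ball (0::'a) 1) < \<infinity>"
  using content_ball_pos[of 1 "0::'a"] emeasure_lborel_ball_finite[of "0::'a" 1]
  by (auto simp: measure_def)

text \<open>\<open>sgn\<close> sends only the origin off the sphere, so restricting to the sphere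
  discards a null set and integrals may be computed in the ambient space.\<close>

lemma nn_integral_sphere_restrict:
  fixes h :: "'a::euclidean_space \<Rightarrow> ennreal"
  assumes [measurable]: "h \<in> borel_measurable borel"
  shows "(\<integral>\<^sup>+u. h u \<partial>sphere_measure) = (\<integral>\<^sup>+u. h u \<partial>distr (uniform_measure lborel (ball 0 1)) borel sgn)"
proof -
  let ?S = "distr (uniform_measure lborel (ball 0 1)) borel (sgn :: 'a \<Rightarrow> 'a)"
  have "AE x in lborel. x \<noteq> (0::'a)" by (rule AE_lborel_singleton)
  then have "AE x in uniform_measure lborel (ball (0::'a) 1). sgn x \<in> sphere 0 1"
    by (intro AE_uniform_measureI) (auto simp: norm_sgn)
  then have "AE u in ?S. u \<in> sphere 0 1"
    by (subst AE_distr_iff) auto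
  then have "(\<integral>\<^sup>+u. h u \<partial>?S) = (\<integral>\<^sup>+u. h u * indicator (sphere 0 1) u \<partial>?S)"
    by (intro nn_integral_cong_AE) (auto elim!: eventually_mono)
  also have "\<dots> = (\<integral>\<^sup>+u. h u \<partial>sphere_measure)"
    unfolding sphere_measure_def by (rule nn_integral_restrict_space[symmetric]) simp
  finally show ?thesis by simp
qed

text \<open>Lebesgue measure is a product in polar coordinates because the part of a cone inside a
  ball scales like a power of the radius. The radial factor is left as the image of Lebesgue measure
  under \<open>norm\<close>, so neither a surface area nor a radial density has to be
  computed.\<close>

lemma nn_integral_polar:
  fixes G :: "'a::euclidean_space \<Rightarrow> real \<Rightarrow> ennreal"
  assumes G[measurable]: "case_prod G \<in> borel_measurable (borel \<Otimes>\<^sub>M borel)"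
  shows "(\<integral>\<^sup>+y. G (sgn y) (norm y) \<partial>lborel) =
    (\<integral>\<^sup>+u. (\<integral>\<^sup>+y. G u (norm y) \<partial>(lborel :: 'a measure)) \<partial>sphere_measure)"
proof -
  define S where "S = distr (uniform_measure lborel (ball 0 1)) borel (sgn :: 'a \<Rightarrow> 'a)"
  define R where "R = distr lborel borel (norm :: 'a \<Rightarrow> real)"
  have [measurable_cong]: "sets S = sets borel" "sets R = sets borel" by (auto simp: S_def R_def)
  have setsS: "sets S = sets borel" "sets R = sets borel" by (auto simp: S_def R_def)
  interpret S: prob_space S unfolding S_def
    by (rule prob_space.prob_space_distr, rule prob_space_uniform_measure)
       (use emeasure_unit_ball[where 'a='a] in auto)
  interpret R: sigma_finite_measure R
  proof
    show "\<exists>A. countable A \<and> A \<subseteq> sets R \<and> \<Union>A = space R \<and> (\<forall>a\<in>A. emeasure R a \<noteq> \<infinity>)"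
    proof (intro exI[of _ "range (\<lambda>n::nat. {..<real n})"] conjI ballI)
      show "\<Union> (range (\<lambda>n::nat. {..<real n})) = space R"
        using reals_Archimedean2 by (auto simp: R_def)
      fix a assume "a \<in> range (\<lambda>n::nat. {..<real n})"
      then obtain n :: nat where "a = {..<real n}" by auto
      then have "emeasure R a = emeasure lborel (ball (0::'a) n)"
        unfolding R_def by (subst emeasure_distr) (auto intro!: arg_cong[where f="emeasure lborel"])
      then show "emeasure R a \<noteq> \<infinity>" using emeasure_lborel_ball_finite[of "0::'a" n] by simp
    qed (auto simp: setsS)
  qed
  define N where "N = distr lborel (borel \<Otimes>\<^sub>M borel) (\<lambda>y::'a. (sgn y, norm y))"
  have rect: "emeasure S A * emeasure R B = emeasure lborel {y::'a. sgn y \<in> A \<and> norm y \<in> B}"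
    if A[measurable]: "A \<in> sets borel" and B[measurable]: "B \<in> sets borel" for A B
  proof -
    have A'[measurable]: "{y::'a. sgn y \<in> A} \<in> sets borel"
      using measurable_sets[OF sgn_measurable_euclidean A] by (simp add: vimage_def)
    \<comment> \<open>For fixed \<open>A\<close> both sides are measures in the radial variable,
      compared on the half-lines \<open>{x<..}\<close>. The norm is negated so that these half-lines
      correspond to balls, which have finite measure.\<close>
    define M1 where "M1 = distr (density lborel (indicator {y::'a. sgn y \<in> A})) borel (\<lambda>y. - norm y)"
    define M2 where "M2 = density (distr lborel borel (\<lambda>y::'a. - norm y)) (\<lambda>_. emeasure S A)"
    have M1: "emeasure M1 X = emeasure lborel {y::'a. sgn y \<in> A \<and> - norm y \<in> X}" if [measurable]: "X \<in> sets borel" for X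
    proof -
      have [measurable]: "{y::'a. - norm y \<in> X} \<in> sets borel"
        using measurable_sets[of "\<lambda>y::'a. - norm y" borel borel X] that by (simp add: vimage_def)
      show ?thesis unfolding M1_def
        by (simp add: emeasure_distr vimage_def emeasure_density Int_def indicator_inter_arith[symmetric] del: indicator_inter_arith)
    qed
    have M2: "emeasure M2 X = emeasure S A * emeasure lborel {y::'a. - norm y \<in> X}" if [measurable]: "X \<in> sets borel" for X
      unfolding M2_def by (simp add: emeasure_density nn_integral_cmult emeasure_distr vimage_def)
    have SA: "emeasure S A = emeasure lborel (ball 0 1 \<inter> {y::'a. sgn y \<in> A}) / emeasure lborel (ball (0::'a) 1)"
      unfolding S_def by (simp add: emeasure_distr emeasure_uniform_measure vimage_def)
    have "M1 = M2"
    proof (rule measure_eqI_lessThan)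
      fix x :: real
      have "emeasure M1 {x<..} \<le> emeasure lborel (ball (0::'a) (-x))"
        by (subst M1) (auto intro!: emeasure_mono)
      also have "\<dots> < \<infinity>" by (rule emeasure_lborel_ball_finite)
      finally show "emeasure M1 {x<..} < \<infinity>" .
      show "emeasure M1 {x<..} = emeasure M2 {x<..}"
      proof (cases "x < 0")
        case False
        then have "{y::'a. - norm y \<in> {x<..}} = {}" by auto (smt (verit) norm_ge_zero)
        then show ?thesis by (simp add: M1 M2)
      next
        case True
        have sc: "sgn ((-x) *\<^sub>R y) = sgn y" "norm ((-x) *\<^sub>R y) < -x \<longleftrightarrow> norm y < 1" for y :: 'a
          using True by (auto simp: sgn_div_norm mult_less_cancel_left_pos)
        have "emeasure M1 {x<..} = emeasure lborel {y::'a. sgn y \<in> A \<and> norm y < -x}"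
          by (subst M1) (auto intro!: arg_cong[where f="emeasure lborel"])
        also have "\<dots> = ennreal ((-x)^DIM('a)) * emeasure lborel {y::'a. sgn y \<in> A \<and> norm y < 1}"
          using sc True by (subst emeasure_lborel_scale[of "-x"]) (auto simp del: scaleR_minus_left)
        also have "{y::'a. sgn y \<in> A \<and> norm y < 1} = ball 0 1 \<inter> {y::'a. sgn y \<in> A}" by auto
        also have "emeasure lborel \<dots> = emeasure S A * emeasure lborel (ball (0::'a) 1)"
          unfolding SA using emeasure_unit_ball[where 'a='a] by (simp add: ennreal_divide_times mult_divide_eq_ennreal)
        also have "ennreal ((-x)^DIM('a)) * (emeasure S A * emeasure lborel (ball (0::'a) 1)) =
            emeasure S A * (ennreal ((-x)^DIM('a)) * emeasure lborel {y::'a. (-x) *\<^sub>R y \<in> ball 0 (-x)})"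
          using sc by (simp add: ball_def mult_ac del: scaleR_minus_left)
        also have "\<dots> = emeasure S A * emeasure lborel (ball (0::'a) (-x))"
          using True by (subst emeasure_lborel_scale[of "-x" "ball 0 (-x)"]) auto
        also have "\<dots> = emeasure M2 {x<..}"
          by (subst M2) (auto intro!: arg_cong[where f="emeasure lborel"] arg_cong2[where f="(*)"])
        finally show ?thesis .
      qed
    qed (auto simp: M1_def M2_def)
    have "emeasure S A * emeasure R B = emeasure M2 (uminus -` B)"
      using measurable_sets[of "uminus::real\<Rightarrow>real" borel borel B]
      by (subst M2) (auto simp: R_def emeasure_distr vimage_def)
    also have "\<dots> = emeasure lborel {y::'a. sgn y \<in> A \<and> norm y \<in> B}"
      using measurable_sets[of "uminus::real\<Rightarrow>real" borel borel B]
      unfolding \<open>M1 = M2\<close>[symmetric] by (subst M1) auto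
    finally show ?thesis .
  qed
  have "S \<Otimes>\<^sub>M R = N"
  proof (rule pair_measure_eqI)
    show "sets (S \<Otimes>\<^sub>M R) = sets N" by (simp add: N_def setsS cong: sets_pair_measure_cong)
    fix A B assume "A \<in> sets S" "B \<in> sets R"
    then have [measurable]: "A \<in> sets borel" "B \<in> sets borel" by (auto simp: setsS)
    show "emeasure S A * emeasure R B = emeasure N (A \<times> B)"
      unfolding N_def by (subst rect) (auto simp: emeasure_distr intro!: arg_cong[where f="emeasure lborel"])
  qed unfold_locales
  have "(\<integral>\<^sup>+y. G (sgn y) (norm y) \<partial>lborel) = (\<integral>\<^sup>+p. case_prod G p \<partial>N)"
    unfolding N_def by (subst nn_integral_distr) auto
  also have "\<dots> = (\<integral>\<^sup>+u. (\<integral>\<^sup>+r. G u r \<partial>R) \<partial>S)"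
    unfolding \<open>S \<Otimes>\<^sub>M R = N\<close>[symmetric] by (subst R.nn_integral_fst[symmetric]) auto
  also have "\<dots> = (\<integral>\<^sup>+u. (\<integral>\<^sup>+r. G u r \<partial>R) \<partial>sphere_measure)"
    unfolding S_def by (rule nn_integral_sphere_restrict[symmetric]) measurable
  also have "\<dots> = (\<integral>\<^sup>+u. (\<integral>\<^sup>+y. G u (norm y) \<partial>(lborel :: 'a measure)) \<partial>sphere_measure)"
    unfolding R_def by (simp add: nn_integral_distr)
  finally show ?thesis .
qed

text \<open>The excluded points lie in the hyperplane orthogonal to a vector e that is orthogonal to
  z. For a unit vector z, what remains are the points whose component orthogonal to z is nonzero, as
  the computations on lines parallel to z require.\<close>

lemma null_line:
  fixes z :: "'a::euclidean_space"
  assumes "DIM('a) \<ge> 2"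
  shows "AE y in lborel. y \<noteq> (y \<bullet> z) *\<^sub>R z"
proof -
  obtain e :: 'a where e: "e \<noteq> 0" "orthogonal z e"
    using orthogonal_to_vector_exists[of z] assms by auto
  have "negligible {y. e \<bullet> y = 0}" using e by (intro negligible_hyperplane) auto
  then have "{y. e \<bullet> y = 0} \<in> null_sets lborel"
    by (simp add: negligible_iff_null_sets null_sets_def)
  from AE_not_in[OF this] have "AE y in lborel. e \<bullet> y \<noteq> 0" by simp
  then show ?thesis
  proof eventually_elim
    case (elim y)
    then show ?case using e(2) by (metis inner_commute inner_scaleR_right mult_zero_right orthogonal_def)
  qed
qed

text \<open>A line parallel to z that misses the axis meets the cone in at most two points, and
  almost every such line misses the axis.\<close>

lemma null_cone:
  fixes z :: "'a::euclidean_space"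
  assumes n: "DIM('a) \<ge> 2" and z: "norm z = 1"
  shows "emeasure lborel {y. y \<bullet> z = c * norm y} = 0"
proof -
  have zz: "z \<bullet> z = 1" using z by (simp add: norm_eq_1)
  have [measurable]: "{y. y \<bullet> z = c * norm y} \<in> sets borel" by measurable
  let ?I = "indicator {y. y \<bullet> z = c * norm y} :: 'a \<Rightarrow> ennreal"
  have line: "(\<integral>\<^sup>+t. ?I (y + t *\<^sub>R z) \<partial>lborel) = 0" if y: "y \<noteq> (y \<bullet> z) *\<^sub>R z" for y
  proof -
    define w where "w = y - (y \<bullet> z) *\<^sub>R z"
    have w: "w \<noteq> 0" "w \<bullet> z = 0" using y by (auto simp: w_def inner_diff_left zz)
    define a where "a = w \<bullet> w"
    have a: "a > 0" using w by (simp add: a_def)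
    have nrm: "norm (y + t *\<^sub>R z)^2 = (y \<bullet> z + t)\<^sup>2 + a" for t
    proof -
      have "y + t *\<^sub>R z = w + (y \<bullet> z + t) *\<^sub>R z" by (simp add: w_def algebra_simps)
      then show ?thesis using w(2)
        by (simp add: power2_norm_eq_inner inner_add_left inner_add_right inner_commute zz a_def)
           (simp add: power2_eq_square)
    qed
    define k where "k = sqrt (c\<^sup>2 * a / (1 - c\<^sup>2))"
    have sol: "t = k - y \<bullet> z \<or> t = - k - y \<bullet> z" if t: "(y + t *\<^sub>R z) \<bullet> z = c * norm (y + t *\<^sub>R z)" for t
    proof -
      have "(y \<bullet> z + t)\<^sup>2 = c\<^sup>2 * ((y \<bullet> z + t)\<^sup>2 + a)"
        using t unfolding nrm[symmetric] by (metis inner_add_left inner_scaleR_left mult.right_neutral power_mult_distrib zz)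
      then have *: "(y \<bullet> z + t)\<^sup>2 * (1 - c\<^sup>2) = c\<^sup>2 * a" by (simp add: algebra_simps)
      \<comment> \<open>For \<open>c\<^sup>2 = 1\<close> the equation would read
        \<open>0 = a\<close>, whereas \<open>a\<close> is the squared distance of the line from the
        axis.\<close>
      have "c\<^sup>2 \<noteq> 1" using * a by auto
      then have "(y \<bullet> z + t)\<^sup>2 = c\<^sup>2 * a / (1 - c\<^sup>2)" using * by (simp add: field_simps)
      then have "k = \<bar>y \<bullet> z + t\<bar>" unfolding k_def by (metis real_sqrt_abs)
      then show ?thesis by linarith
    qed
    have "AE t in lborel. ?I (y + t *\<^sub>R z) = 0"
      using AE_lborel_singleton[of "k - y \<bullet> z"] AE_lborel_singleton[of "- k - y \<bullet> z"]
    proof eventually_elim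
      case (elim t)
      then show ?case using sol[of t] by (auto simp: indicator_def)
    qed
    then show ?thesis by (simp add: nn_integral_0_iff_AE)
  qed
  have "emeasure lborel {y. y \<bullet> z = c * norm y} = (\<integral>\<^sup>+y. ?I y \<partial>lborel)" by simp
  also have "\<dots> = (\<integral>\<^sup>+y. indicator {0..<1} (y \<bullet> z) * (\<integral>\<^sup>+t. ?I (y + t *\<^sub>R z) \<partial>lborel) \<partial>lborel)"
    by (rule nn_integral_lborel_lines[OF _ z]) measurable
  also have "\<dots> = (\<integral>\<^sup>+y. 0 \<partial>(lborel :: 'a measure))"
    by (intro nn_integral_cong_AE eventually_mono[OF null_line[OF n, of z]]) (simp add: line)
  finally show ?thesis by simp
qed

lemma sphere_level_null:
  fixes z :: "'a::euclidean_space"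
  assumes n: "DIM('a) \<ge> 2" and z: "norm z = 1"
  shows "AE u in sphere_measure. u \<bullet> z \<noteq> c"
proof (rule AE_I)
  show M: "{u \<in> sphere 0 1. u \<bullet> z = c} \<in> sets sphere_measure"
    by (auto simp: sets_sphere_measure_iff)
  have "ball 0 1 \<inter> sgn -` {u \<in> sphere 0 1. u \<bullet> z = c} \<subseteq> {y. y \<bullet> z = c * norm y}"
    by (auto simp: sgn_div_norm field_simps)
  then have le: "emeasure lborel (ball 0 1 \<inter> sgn -` {u \<in> sphere 0 1. u \<bullet> z = c}) \<le> 0"
    unfolding null_cone[OF n z, of c, symmetric] by (intro emeasure_mono) auto
  show "emeasure sphere_measure {u \<in> sphere 0 1. u \<bullet> z = c} = 0"
    unfolding emeasure_sphere_measure[OF M] le[unfolded le_zero_eq] by simp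
qed auto

section \<open>The distribution of the mirror image of a fixed point\<close>

lemma reflection_measurable[measurable (raw)]:
  fixes f g :: "'b \<Rightarrow> 'a::euclidean_space"
  assumes [measurable]: "f \<in> borel_measurable M" "g \<in> borel_measurable M"
  shows "(\<lambda>w. reflection (f w) (g w)) \<in> borel_measurable M"
  unfolding reflection_def by measurable

text \<open>On the line \<open>w + t x\<close>, doubling the angle to \<open>x\<close> is Boole's map \<open>t \<mapsto> (t - w \<bullet> w / t) / 2\<close>.\<close>

lemma reflection_dist_half:
  fixes x :: "'a::euclidean_space"
  assumes t: "t > 0" and x: "norm x = 1" and w: "w \<bullet> x = 0" "w \<noteq> 0"
  defines "a \<equiv> w \<bullet> w" and "\<xi> \<equiv> w + t *\<^sub>R x" and "y \<equiv> - (w + ((t - w \<bullet> w / t) / 2) *\<^sub>R x)"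
  shows "reflection (sgn \<xi>) x = sgn y" "norm (x - sgn y)^2 = 4 * t\<^sup>2 / (t\<^sup>2 + a)"
    "norm y * norm (x - sgn y) = norm \<xi>" "norm \<xi>^2 = t\<^sup>2 + a"
proof -
  have xx: "x \<bullet> x = 1" "x \<bullet> w = 0" using x w by (simp_all add: norm_eq_1 inner_commute)
  have a: "a > 0" using w by (simp add: a_def)
  define N where "N = t\<^sup>2 + a"
  have N: "N > 0" using a by (simp add: N_def add_nonneg_pos)
  show n\<xi>: "norm \<xi>^2 = t\<^sup>2 + a"
    using w xx by (simp add: \<xi>_def power2_norm_eq_inner inner_add_left inner_add_right a_def)
      (simp add: power2_eq_square)
  define k where "k = (t - a / t) / 2"
  have yk: "y = - (w + k *\<^sub>R x)" by (simp add: y_def k_def a_def)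
  \<comment> \<open>The squares of (t - a/t)/2 and (t + a/t)/2 differ by a; hence the length of
    \<open>y\<close> is rational in t.\<close>
  have "norm y^2 = a + k\<^sup>2"
    unfolding yk norm_minus_cancel using w xx
    by (simp add: power2_norm_eq_inner inner_add_left inner_add_right a_def)
      (simp add: power2_eq_square)
  also have "\<dots> = (N / (2 * t))\<^sup>2"
    using t by (simp add: k_def N_def field_simps power2_eq_square)
  finally have ny: "norm y = N / (2 * t)" using N t by (simp add: power2_eq_iff_nonneg)
  have n\<xi>': "norm \<xi>^2 = N" by (simp add: n\<xi> N_def)
  have "reflection (sgn \<xi>) x = x - (2 * (\<xi> \<bullet> x) / norm \<xi>^2) *\<^sub>R \<xi>"
    by (simp add: reflection_def sgn_div_norm power2_eq_square divide_inverse mult_ac)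
  also have "\<dots> = x - (2 * t / N) *\<^sub>R (w + t *\<^sub>R x)"
    unfolding n\<xi>' using xx w by (simp add: \<xi>_def inner_add_left)
  finally have refl: "reflection (sgn \<xi>) x = (1 - 2 * t * t / N) *\<^sub>R x - (2 * t / N) *\<^sub>R w"
    by (simp add: algebra_simps)
  also have "1 - 2 * t * t / N = - (2 * t / N) * k"
    using t N by (simp add: field_simps) (simp add: k_def N_def power2_eq_square field_simps)
  also have "(- (2 * t / N) * k) *\<^sub>R x - (2 * t / N) *\<^sub>R w = (2 * t / N) *\<^sub>R y"
    by (simp add: yk algebra_simps)
  also have "\<dots> = sgn y" by (simp add: sgn_div_norm ny)
  finally show s: "reflection (sgn \<xi>) x = sgn y" .
  have "y \<noteq> 0" using ny N t by auto
  then have "sgn y \<bullet> sgn y = 1" by (metis norm_eq_1 norm_sgn)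
  then have "norm (x - sgn y)^2 = 2 - 2 * (x \<bullet> sgn y)"
    by (simp add: power2_norm_eq_inner inner_diff_left inner_diff_right xx inner_commute)
  also have "x \<bullet> sgn y = 1 - 2 * t * t / N"
    unfolding s[symmetric] refl using xx by (simp add: inner_diff_right)
  finally have c: "norm (x - sgn y)^2 = 4 * t\<^sup>2 / N" by (simp add: power2_eq_square)
  then show "norm (x - sgn y)^2 = 4 * t\<^sup>2 / (t\<^sup>2 + a)" by (simp add: N_def)
  have "(norm y * norm (x - sgn y))^2 = norm \<xi> ^ 2"
    unfolding power_mult_distrib c n\<xi>' ny using t N by (simp add: field_simps power2_eq_square)
  then show "norm y * norm (x - sgn y) = norm \<xi>"
    by (simp add: power2_eq_iff_nonneg)
qed

lemma lborel_distr_minus: "distr lborel borel uminus = (lborel :: 'a::euclidean_space measure)"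
  using lborel_affine[of "-1" "0::'a"] by (simp add: density_1)

text \<open>Only the diameter of the sphere is used to bound the density |x - y|^(1 - d) from below.
  The density is computed in the ball: on each line parallel to x, Boole's map turns a vector \<xi>
  into one whose direction is the mirror image u of x, up to the sign built into
  \<open>reflection_dist_half\<close>, and in polar coordinates the condition on \<xi> becomes a
  ball of radius 1 / |x - u|.\<close>

lemma reflection_kernel:
  fixes x :: "'a::euclidean_space"
  assumes d: "DIM('a) = d + 1" "d \<ge> 1" and x: "norm x = 1" and C: "C \<in> sets sphere_measure"
  shows "ennreal (2 / 2 ^ d) * emeasure sphere_measure C
    \<le> emeasure sphere_measure {u \<in> sphere 0 1. reflection u x \<in> C}"
proof -
  have n2: "DIM('a) \<ge> 2" using d by simp
  have xx: "x \<bullet> x = 1" using x by (simp add: norm_eq_1)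
  have CB: "C \<in> sets borel" "C \<subseteq> sphere 0 1" using C by (auto simp: sets_sphere_measure_iff)
  note [measurable] = CB(1)
  define V where "V = emeasure lborel (ball (0::'a) 1)"
  have V: "V \<noteq> 0" "V < \<infinity>" using emeasure_unit_ball[where 'a='a] by (auto simp: V_def)
  \<comment> \<open>The weight is the reciprocal of the Jacobian of Boole's map, and the last
    indicator is the condition that \<xi> lies in the unit ball, expressed through its image: the
    length of \<xi> is \<open>r * norm (x - u)\<close>.\<close>
  define G0 where "G0 u r = indicator C u * ennreal ((norm (x - u))\<^sup>2 / 2) * indicator {..<1} (r * norm (x - u))" for u :: 'a and r
  define G where "G y = G0 (sgn y) (norm y)" for y :: 'a
  have G0m[measurable]: "case_prod G0 \<in> borel_measurable (borel \<Otimes>\<^sub>M borel)"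
    unfolding G0_def by measurable
  have [measurable]: "G \<in> borel_measurable borel" unfolding G_def G0_def by measurable
  define E where "E = {y::'a. norm y < 1 \<and> y \<bullet> x > 0 \<and> reflection (sgn y) x \<in> C}"
  have E[measurable]: "E \<in> sets borel" unfolding E_def by measurable
  have intG: "ennreal (1 / 2 ^ d) * V * emeasure sphere_measure C \<le> (\<integral>\<^sup>+y. G y \<partial>lborel)"
  proof -
    have "ennreal (1 / 2 ^ d) * V * emeasure sphere_measure C =
        (\<integral>\<^sup>+u. ennreal (1 / 2 ^ d) * V * indicator C u \<partial>sphere_measure)"
      using C by (simp add: nn_integral_cmult)
    also have "\<dots> \<le> (\<integral>\<^sup>+u. (\<integral>\<^sup>+y. G0 u (norm y) \<partial>(lborel :: 'a measure)) \<partial>sphere_measure)"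
    proof (rule nn_integral_mono_AE)
      have "AE u in sphere_measure. u \<bullet> x \<noteq> 1" by (rule sphere_level_null[OF n2 x])
      moreover have "AE u in sphere_measure. u \<in> sphere (0::'a) 1" by (rule AE_I2) simp
      ultimately show "AE u in sphere_measure. ennreal (1 / 2 ^ d) * V * indicator C u
          \<le> (\<integral>\<^sup>+y. G0 u (norm y) \<partial>(lborel :: 'a measure))"
      proof eventually_elim
        case (elim u)
        define c where "c = norm (x - u)"
        have "x \<noteq> u" using elim xx by auto
        then have c: "c > 0" by (simp add: c_def)
        have c2: "c \<le> 2" using norm_triangle_ineq4[of x u] x elim by (simp add: c_def)
        show ?case
        proof (cases "u \<in> C")
          case True
          have "(\<integral>\<^sup>+y. G0 u (norm y) \<partial>(lborel :: 'a measure)) =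
            (\<integral>\<^sup>+y. ennreal (c\<^sup>2 / 2) * indicator {y. c *\<^sub>R y \<in> ball 0 1} y \<partial>(lborel :: 'a measure))"
            using True c by (intro nn_integral_cong) (auto simp: G0_def c_def[symmetric] indicator_def mult.commute)
          also have "\<dots> = ennreal (c\<^sup>2 / 2) * emeasure lborel {y::'a. c *\<^sub>R y \<in> ball 0 1}"
            by (subst nn_integral_cmult) auto
          finally have eq: "(\<integral>\<^sup>+y. G0 u (norm y) \<partial>(lborel :: 'a measure)) =
             ennreal (c\<^sup>2 / 2) * emeasure lborel {y::'a. c *\<^sub>R y \<in> ball 0 1}" .
          \<comment> \<open>The radial integral is V c^(1 - d) / 2: the weight gives c^2 / 2, and
            shrinking the ball by the factor c gives c^(- d - 1). With c at most 2 this is at least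
            V / 2^d, which is where the power of two originates.\<close>
          have "1 / 2 ^ d * c ^ DIM('a) \<le> c\<^sup>2 / 2"
          proof -
            obtain d' where d': "d = Suc d'" using d by (cases d) auto
            have "c ^ d' \<le> 2 ^ d'" using c c2 by (intro power_mono) auto
            then have "c\<^sup>2 * c ^ d' \<le> c\<^sup>2 * 2 ^ d'" by (intro mult_left_mono) auto
            then show ?thesis by (simp add: d d' field_simps power2_eq_square)
          qed
          then have "ennreal (1 / 2 ^ d * c ^ DIM('a)) * emeasure lborel {y::'a. c *\<^sub>R y \<in> ball 0 1}
            \<le> ennreal (c\<^sup>2 / 2) * emeasure lborel {y::'a. c *\<^sub>R y \<in> ball 0 1}"
            by (intro mult_right_mono ennreal_leI) auto
          moreover have "ennreal (1 / 2 ^ d) * V = ennreal (1 / 2 ^ d * c ^ DIM('a)) * emeasure lborel {y::'a. c *\<^sub>R y \<in> ball 0 1}"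
          proof -
            have split: "ennreal (1 / 2 ^ d * c ^ DIM('a)) = ennreal (1 / 2 ^ d) * ennreal (c ^ DIM('a))"
              using c by (intro ennreal_mult) auto
            show ?thesis unfolding V_def split by (subst emeasure_lborel_scale[OF c]) (auto simp: mult.assoc)
          qed
          ultimately show ?thesis unfolding eq using True by simp
        qed simp
      qed
    qed
    also have "\<dots> = (\<integral>\<^sup>+y. G y \<partial>lborel)"
      unfolding G_def by (rule nn_integral_polar[symmetric]) (rule G0m)
    finally show ?thesis .
  qed
  have line: "(\<integral>\<^sup>+t. G (- (y + t *\<^sub>R x)) \<partial>lborel) = (\<integral>\<^sup>+t. indicator E (y + t *\<^sub>R x) \<partial>lborel)"
    if y: "y \<noteq> (y \<bullet> x) *\<^sub>R x" for y
  proof -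
    define w where "w = y - (y \<bullet> x) *\<^sub>R x"
    have w: "w \<bullet> x = 0" "w \<noteq> 0" using y by (auto simp: w_def inner_diff_left xx)
    define a where "a = w \<bullet> w"
    have a: "a > 0" using w by (simp add: a_def)
    have yw: "y + t *\<^sub>R x = w + (y \<bullet> x + t) *\<^sub>R x" for t by (simp add: w_def algebra_simps)
    have "(\<integral>\<^sup>+t. G (- (y + t *\<^sub>R x)) \<partial>lborel) = (\<integral>\<^sup>+t. G (- (w + t *\<^sub>R x)) \<partial>lborel)"
      unfolding yw by (rule nn_integral_lborel_translate[of "\<lambda>t. G (- (w + t *\<^sub>R x))"]) measurable
    also have "\<dots> = (\<integral>\<^sup>+t. indicator {0<..} t * ennreal ((1 + a / t\<^sup>2) / 2) * G (- (w + ((t - a / t) / 2) *\<^sub>R x)) \<partial>lborel)"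
      by (rule nn_integral_joukowski[OF a, symmetric]) measurable
    also have "\<dots> = (\<integral>\<^sup>+t. indicator E (w + t *\<^sub>R x) \<partial>lborel)"
    proof (rule nn_integral_cong)
      fix t :: real
      show "indicator {0<..} t * ennreal ((1 + a / t\<^sup>2) / 2) * G (- (w + ((t - a / t) / 2) *\<^sub>R x)) = indicator E (w + t *\<^sub>R x)"
      proof (cases "t > 0")
        case False
        then show ?thesis using w xx by (simp add: E_def inner_add_left)
      next
        case True
        note R = reflection_dist_half[OF True x w, folded a_def]
        have N: "t\<^sup>2 + a > 0" using a by (simp add: add_nonneg_pos)
        have one: "ennreal ((1 + a / t\<^sup>2) / 2) * ennreal (4 * t\<^sup>2 / (t\<^sup>2 + a) / 2) = 1"
        proof -
          have "1 + a / t\<^sup>2 = (t\<^sup>2 + a) / t\<^sup>2" using True by (simp add: add_divide_distrib)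
          moreover have "(q / p) / 2 * (4 * p / q / 2) = 1" if "p > 0" "q > 0" for p q :: real
            using that by simp
          ultimately have "(1 + a / t\<^sup>2) / 2 * (4 * t\<^sup>2 / (t\<^sup>2 + a) / 2) = 1" using True N by (metis zero_less_power)
          moreover have "ennreal ((1 + a / t\<^sup>2) / 2) * ennreal (4 * t\<^sup>2 / (t\<^sup>2 + a) / 2)
              = ennreal ((1 + a / t\<^sup>2) / 2 * (4 * t\<^sup>2 / (t\<^sup>2 + a) / 2))"
            using a by (intro ennreal_mult[symmetric]) auto
          ultimately show ?thesis by (simp only: ennreal_1)
        qed
        have "w + t *\<^sub>R x \<in> E \<longleftrightarrow> norm (w + t *\<^sub>R x) < 1 \<and> reflection (sgn (w + t *\<^sub>R x)) x \<in> C"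
          using True w xx by (simp add: E_def inner_add_left)
        from this[unfolded R(1)] show ?thesis
          using True one unfolding G_def G0_def R(2) R(3)
          by (auto simp: indicator_def)
      qed
    qed
    also have "\<dots> = (\<integral>\<^sup>+t. indicator E (y + t *\<^sub>R x) \<partial>lborel)"
      unfolding yw by (rule nn_integral_lborel_translate[of "\<lambda>t. indicator E (w + t *\<^sub>R x)", symmetric]) measurable
    finally show ?thesis .
  qed
  have "(\<integral>\<^sup>+y. G y \<partial>lborel) = (\<integral>\<^sup>+y. G (- y) \<partial>lborel)"
    using nn_integral_distr[of uminus lborel borel G] by (simp add: lborel_distr_minus)
  also have "\<dots> = (\<integral>\<^sup>+y. indicator {0..<1} (y \<bullet> x) * (\<integral>\<^sup>+t. G (- (y + t *\<^sub>R x)) \<partial>lborel) \<partial>lborel)"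
    by (rule nn_integral_lborel_lines[OF _ x, of "\<lambda>y. G (- y)"]) measurable
  also have "\<dots> = (\<integral>\<^sup>+y. indicator {0..<1} (y \<bullet> x) * (\<integral>\<^sup>+t. indicator E (y + t *\<^sub>R x) \<partial>lborel) \<partial>lborel)"
  proof (intro nn_integral_cong_AE eventually_mono[OF null_line[OF n2, of x]])
    fix y assume "y \<noteq> (y \<bullet> x) *\<^sub>R x"
    from line[OF this] show "indicator {0..<1} (y \<bullet> x) * (\<integral>\<^sup>+t. G (- (y + t *\<^sub>R x)) \<partial>lborel) =
        indicator {0..<1} (y \<bullet> x) * (\<integral>\<^sup>+t. indicator E (y + t *\<^sub>R x) \<partial>lborel)" by (rule arg_cong)
  qed
  also have "\<dots> = emeasure lborel E"
    by (subst nn_integral_lborel_lines[OF _ x, symmetric]) (auto simp: E)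
  finally have GE: "(\<integral>\<^sup>+y. G y \<partial>lborel) = emeasure lborel E" .
  have D: "{u \<in> sphere 0 1. reflection u x \<in> C} \<in> sets sphere_measure" (is "?D \<in> _")
    unfolding sets_sphere_measure_iff by auto measurable
  have mE: "uminus -` E \<in> sets borel" using measurable_sets[of uminus borel borel E] by simp
  have "emeasure lborel (uminus -` E) = emeasure lborel E"
    using emeasure_distr[of uminus lborel borel E] by (simp add: lborel_distr_minus)
  \<comment> \<open>\<open>E\<close> covers only one half of the ball. Since \<xi> and - \<xi>
    define the same reflection, the opposite half contributes equally; this is the numerator 2 of
    the constant.\<close>
  then have "2 * emeasure lborel E = emeasure lborel E + emeasure lborel (uminus -` E)"
    by (simp add: mult_2)
  also have "\<dots> = emeasure lborel (E \<union> uminus -` E)"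
    using mE by (intro plus_emeasure) (auto simp: E_def)
  also have "\<dots> \<le> emeasure lborel (ball 0 1 \<inter> sgn -` ?D)"
  proof (rule emeasure_mono)
    have sm: "sgn (- y) = - sgn y" for y :: 'a by (simp add: sgn_div_norm)
    show "E \<union> uminus -` E \<subseteq> ball 0 1 \<inter> sgn -` ?D"
      by (auto simp: E_def norm_sgn sm reflection_minus)
    show "ball 0 1 \<inter> sgn -` ?D \<in> sets lborel"
      using D measurable_sets[OF sgn_measurable_euclidean, of ?D] by (auto simp: sets_sphere_measure_iff)
  qed
  finally have le: "2 * emeasure lborel E / V \<le> emeasure sphere_measure ?D"
    unfolding emeasure_sphere_measure[OF D] V_def by (rule divide_right_mono_ennreal)
  have "ennreal (2 / 2 ^ d) * emeasure sphere_measure C = 2 * (ennreal (1 / 2 ^ d) * V * emeasure sphere_measure C) / V"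
  proof -
    have "2 * (ennreal (1 / 2 ^ d) * V * emeasure sphere_measure C) / V = (2 * ennreal (1 / 2 ^ d) * emeasure sphere_measure C) * V / V"
      by (simp add: mult_ac)
    also have "\<dots> = 2 * ennreal (1 / 2 ^ d) * emeasure sphere_measure C"
      using V by (intro ennreal_mult_divide_eq) auto
    also have "2 * ennreal (1 / 2 ^ d) = ennreal (2 / 2 ^ d)"
      using ennreal_mult[of 2 "1 / 2 ^ d"] by simp
    finally show ?thesis by simp
  qed
  also have "\<dots> \<le> 2 * emeasure lborel E / V"
    unfolding GE[symmetric] by (intro divide_right_mono_ennreal mult_left_mono intG) auto
  also note le
  finally show ?thesis .
qed

section \<open>Measurability of random polarizations\<close>

lemma dir_class_representative:
  "(SOME v. v \<in> dir_class u) = u \<or> (SOME v. v \<in> dir_class u) = - u"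
  using someI[of "\<lambda>v. v \<in> dir_class u" u] by (auto simp: dir_class_def)

lemma norm_representative:
  assumes "w \<in> directions"
  shows "norm (SOME u. u \<in> w) = 1"
proof -
  obtain u where "w = dir_class u" "norm u = 1" using assms by (auto simp: directions_def)
  then show ?thesis using dir_class_representative[of u] by auto
qed

lemma space_directions_algebra [simp]: "space directions_algebra = directions"
  by (simp add: directions_algebra_def space_measure_of_conv)

text \<open>The sign picked by \<open>SOME\<close> is arbitrary, so measurability of the
  representative itself is out of reach. Even functions do not see the sign and descend to the
  quotient.\<close>

lemma representative_even_measurable:
  fixes f :: "'a::euclidean_space \<Rightarrow> 'b::topological_space"
  assumes f: "f \<in> borel_measurable borel" and even: "\<And>u. f (- u) = f u"
  shows "(\<lambda>w. f (SOME u. u \<in> w)) \<in> borel_measurable directions_algebra"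
proof (rule measurableI)
  fix B :: "'b set" assume B: "B \<in> sets borel"
  have rep: "f (SOME v. v \<in> dir_class u) = f u" for u
    using dir_class_representative[of u] even by metis
  have "f -` B \<in> sets borel" using measurable_sets[OF f B] by simp
  then have "f -` B \<inter> sphere 0 1 \<in> sets sphere_measure"
    by (auto simp: sets_sphere_measure_iff)
  moreover have "dir_class -` ((\<lambda>w. f (SOME u. u \<in> w)) -` B \<inter> directions) \<inter> sphere 0 1 = f -` B \<inter> sphere 0 1"
    by (auto simp: directions_def rep)
  ultimately show "(\<lambda>w. f (SOME u. u \<in> w)) -` B \<inter> space directions_algebra \<in> sets directions_algebra"
    by (simp add: sets_directions_algebra)
qed simp

text \<open>Products of two coordinates of the representative are even. Expanding both inner
  products in the basis separates these products from the measurable vectors \<open>X\<close> and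
  \<open>Y\<close>.\<close>

lemma representative_bilinear_measurable:
  fixes X Y :: "'k \<Rightarrow> 'a::euclidean_space"
  assumes W: "W \<in> K \<rightarrow>\<^sub>M directions_algebra"
    and [measurable]: "X \<in> borel_measurable K" "Y \<in> borel_measurable K"
  shows "(\<lambda>k. ((SOME u. u \<in> W k) \<bullet> X k) * ((SOME u. u \<in> W k) \<bullet> Y k)) \<in> borel_measurable K"
proof -
  have [measurable]: "(\<lambda>k. ((SOME u. u \<in> W k) \<bullet> b) * ((SOME u. u \<in> W k) \<bullet> c)) \<in> borel_measurable K" for b c
    by (rule measurable_compose[OF W representative_even_measurable[of "\<lambda>u. (u \<bullet> b) * (u \<bullet> c)"]]) auto
  have "(\<lambda>k. ((SOME u. u \<in> W k) \<bullet> X k) * ((SOME u. u \<in> W k) \<bullet> Y k)) =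
    (\<lambda>k. \<Sum>b\<in>Basis. \<Sum>c\<in>Basis. (((SOME u. u \<in> W k) \<bullet> b) * ((SOME u. u \<in> W k) \<bullet> c)) * ((X k \<bullet> b) * (Y k \<bullet> c)))"
    by (subst (1 2) euclidean_inner) (simp add: sum_product mult_ac)
  then show ?thesis by simp
qed

lemma representative_reflection_measurable:
  fixes X :: "'k \<Rightarrow> 'a::euclidean_space"
  assumes W: "W \<in> K \<rightarrow>\<^sub>M directions_algebra" and X[measurable]: "X \<in> borel_measurable K"
  shows "(\<lambda>k. reflection (SOME u. u \<in> W k) (X k)) \<in> borel_measurable K"
proof (subst borel_measurable_euclidean_space, rule ballI)
  fix b :: 'a
  note [measurable] = representative_bilinear_measurable[OF W X, of "\<lambda>_. b"]
  have "(\<lambda>k. reflection (SOME u. u \<in> W k) (X k) \<bullet> b) =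
     (\<lambda>k. X k \<bullet> b - 2 * (((SOME u. u \<in> W k) \<bullet> X k) * ((SOME u. u \<in> W k) \<bullet> b)))"
    by (simp add: reflection_def inner_diff_left mult.assoc)
  then show "(\<lambda>k. reflection (SOME u. u \<in> W k) (X k) \<bullet> b) \<in> borel_measurable K" by simp
qed

lemma geodesic_dist_le_iff:
  fixes x y z :: "'a::euclidean_space"
  assumes "norm x = 1" "norm y = 1" "norm z = 1"
  shows "geodesic_dist x z \<le> geodesic_dist y z \<longleftrightarrow> y \<bullet> z \<le> x \<bullet> z"
proof -
  have "\<bar>x \<bullet> z\<bar> \<le> 1" "\<bar>y \<bullet> z\<bar> \<le> 1"
    using Cauchy_Schwarz_ineq2[of x z] Cauchy_Schwarz_ineq2[of y z] assms by auto
  then show ?thesis by (simp add: geodesic_dist_def arccos_le_mono)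
qed

lemma norm_reflection: "norm u = 1 \<Longrightarrow> norm (reflection u x) = norm x"
  by (rule orthogonal_transformation_norm[OF orthogonal_transformation_reflection])

text \<open>Comparing the two geodesic distances amounts to the sign of the product of
  \<open>u \<bullet> x\<close> and \<open>u \<bullet> z\<close>. In this form u enters only through
  even expressions, which are measurable on the space of directions.\<close>

lemma mem_polarization_dir:
  fixes x z :: "'a::euclidean_space"
  assumes "norm u = 1" "norm z = 1" "A \<subseteq> sphere 0 1"
  shows "x \<in> polarization_dir z u A \<longleftrightarrow> norm x = 1 \<and>
    (if u \<bullet> z = 0 then x \<in> A
     else if 0 \<le> (u \<bullet> x) * (u \<bullet> z) then x \<in> A \<or> reflection u x \<in> A
     else x \<in> A \<and> reflection u x \<in> A)"
proof (cases "norm x = 1")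
  case True
  have "reflection u x \<bullet> z \<le> x \<bullet> z \<longleftrightarrow> 0 \<le> (u \<bullet> x) * (u \<bullet> z)"
    by (simp add: reflection_def inner_diff_left)
  then show ?thesis
    using True assms geodesic_dist_le_iff[of x "reflection u x" z]
    by (auto simp: polarization_dir_def norm_reflection)
qed (use assms in \<open>auto simp: polarization_dir_def\<close>)

text \<open>Joint measurability in parameter and point is the property that polarization by a random
  direction preserves, and it makes \<open>k \<mapsto> m (T k)\<close> measurable. The points range
  over the ambient Borel space, so that reflections can be composed without tracking the
  sphere.\<close>

definition measurable_family :: "'k measure \<Rightarrow> ('k \<Rightarrow> 'a::euclidean_space set) \<Rightarrow> bool" where
  "measurable_family K T \<longleftrightarrow> (\<forall>k\<in>space K. T k \<subseteq> sphere 0 1) \<and>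
     Measurable.pred (K \<Otimes>\<^sub>M borel) (\<lambda>p. snd p \<in> T (fst p))"

lemma measurable_family_const:
  "A \<in> sets sphere_measure \<Longrightarrow> measurable_family K (\<lambda>_. A)"
  by (auto simp: measurable_family_def sets_sphere_measure_iff)

lemma measurable_family_compose:
  assumes T: "measurable_family L T" and f: "f \<in> K \<rightarrow>\<^sub>M L"
  shows "measurable_family K (\<lambda>k. T (f k))"
proof -
  have "(\<lambda>p. (f (fst p), snd p)) \<in> K \<Otimes>\<^sub>M borel \<rightarrow>\<^sub>M L \<Otimes>\<^sub>M borel" using f by measurable
  from measurable_compose[OF this, of "\<lambda>p. snd p \<in> T (fst p)" "count_space UNIV"] show ?thesis
    using T measurable_space[OF f] by (auto simp: measurable_family_def)
qed

lemma measurable_family_polarization: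
  fixes T :: "'k \<Rightarrow> 'a::euclidean_space set"
  assumes T: "measurable_family K T" and W: "W \<in> K \<rightarrow>\<^sub>M directions_algebra" and z: "norm z = 1"
  shows "measurable_family K (\<lambda>k. polarization z (W k) (T k))"
proof -
  have W': "(\<lambda>p. W (fst p)) \<in> K \<Otimes>\<^sub>M (borel :: 'a measure) \<rightarrow>\<^sub>M directions_algebra"
    using W by measurable
  have nW: "norm (SOME u. u \<in> W k) = 1" if "k \<in> space K" for k
    using measurable_space[OF W that] norm_representative by simp
  note [measurable] = representative_reflection_measurable[OF W', of snd]
    representative_bilinear_measurable[OF W', of snd "\<lambda>_. z"]
    representative_bilinear_measurable[OF W', of "\<lambda>_. z" "\<lambda>_. z"]
  have Tp[measurable]: "Measurable.pred (K \<Otimes>\<^sub>M borel) (\<lambda>p. snd p \<in> T (fst p))"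
    using T by (simp add: measurable_family_def)
  have [measurable]: "Measurable.pred (K \<Otimes>\<^sub>M borel) (\<lambda>p. reflection (SOME u. u \<in> W (fst p)) (snd p) \<in> T (fst p))"
    by (rule measurable_compose[of "\<lambda>p. (fst p, reflection (SOME u. u \<in> W (fst p)) (snd p))", OF _ Tp, simplified]) measurable
  \<comment> \<open>The test \<open>u \<bullet> z = 0\<close> is written with a square, because only
    even functions of the representative are known to be measurable.\<close>
  define R where "R p \<longleftrightarrow> norm (snd p) = 1 \<and>
    (if ((SOME u. u \<in> W (fst p)) \<bullet> z) * ((SOME u. u \<in> W (fst p)) \<bullet> z) = 0 then snd p \<in> T (fst p)
     else if 0 \<le> ((SOME u. u \<in> W (fst p)) \<bullet> snd p) * ((SOME u. u \<in> W (fst p)) \<bullet> z)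
       then snd p \<in> T (fst p) \<or> reflection (SOME u. u \<in> W (fst p)) (snd p) \<in> T (fst p)
     else snd p \<in> T (fst p) \<and> reflection (SOME u. u \<in> W (fst p)) (snd p) \<in> T (fst p))" for p
  have R: "Measurable.pred (K \<Otimes>\<^sub>M borel) R"
    unfolding R_def by measurable
  have eq: "snd p \<in> polarization z (W (fst p)) (T (fst p)) \<longleftrightarrow> R p"
    if "p \<in> space (K \<Otimes>\<^sub>M (borel :: 'a measure))" for p
  proof -
    have k: "fst p \<in> space K" using that by (auto simp: space_pair_measure)
    then have "T (fst p) \<subseteq> sphere 0 1" using T by (simp add: measurable_family_def)
    from mem_polarization_dir[OF nW[OF k] z this] show ?thesis
      unfolding polarization_def R_def by simp
  qed
  have "Measurable.pred (K \<Otimes>\<^sub>M borel) (\<lambda>p. snd p \<in> polarization z (W (fst p)) (T (fst p)))"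
    by (rule measurable_cong[THEN iffD2, OF eq R])
  moreover have "polarization z (W k) (T k) \<subseteq> sphere 0 1" if "k \<in> space K" for k
    unfolding polarization_def using that T nW[of k] z
    by (auto simp: measurable_family_def mem_polarization_dir)
  ultimately show ?thesis by (auto simp: measurable_family_def)
qed

lemma polarizations_snoc:
  "polarizations z (ws @ [w]) A = polarization z w (polarizations z ws A)"
  by (simp add: polarizations_def)

lemma measurable_family_polarizations:
  assumes A: "A \<in> sets sphere_measure" and W: "\<And>i. i \<in> {1..n} \<Longrightarrow> W i \<in> K \<rightarrow>\<^sub>M directions_algebra" and z: "norm z = 1"
  shows "measurable_family K (\<lambda>k. polarizations z (map (\<lambda>i. W i k) [1..<Suc n]) A)"
  using W
proof (induction n)
  case 0
  then show ?case using A by (simp add: polarizations_def measurable_family_const)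
next
  case (Suc n)
  have "map (\<lambda>i. W i k) [1..<Suc (Suc n)] = map (\<lambda>i. W i k) [1..<Suc n] @ [W (Suc n) k]" for k
    by simp
  then show ?case
    unfolding polarizations_snoc
    using Suc by (simp only: polarizations_snoc) (auto intro!: measurable_family_polarization Suc.IH z)
qed

lemma measurable_family_sets:
  assumes "measurable_family K T" "k \<in> space K"
  shows "T k \<in> sets sphere_measure"
proof -
  have "Measurable.pred borel (\<lambda>x. x \<in> T k)"
    using measurable_compose[OF measurable_Pair1'[OF assms(2)], of "\<lambda>p. snd p \<in> T (fst p)" borel "count_space UNIV"] assms(1)
    by (simp add: measurable_family_def)
  then have "T k \<in> sets borel" by (simp add: pred_def)
  then show ?thesis using assms by (auto simp: sets_sphere_measure_iff measurable_family_def)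
qed

lemma measurable_family_sym_diff:
  assumes "measurable_family K T" "B \<in> sets sphere_measure"
  shows "measurable_family K (\<lambda>k. sym_diff (T k) B)"
proof -
  have [measurable]: "B \<in> sets borel" "Measurable.pred (K \<Otimes>\<^sub>M borel) (\<lambda>p. snd p \<in> T (fst p))"
    using assms by (auto simp: measurable_family_def sets_sphere_measure_iff)
  have "Measurable.pred (K \<Otimes>\<^sub>M borel) (\<lambda>p. (snd p \<in> T (fst p) \<and> snd p \<notin> B) \<or> (snd p \<in> B \<and> snd p \<notin> T (fst p)))"
    by measurable
  then show ?thesis using assms by (auto simp: measurable_family_def sets_sphere_measure_iff)
qed

interpretation sphere: prob_space "sphere_measure :: 'a::euclidean_space measure"
  by (rule prob_space_sphere_measure)

lemma measurable_family_measure: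
  fixes T :: "'k \<Rightarrow> 'a::euclidean_space set"
  assumes T: "measurable_family K T"
  shows "(\<lambda>k. measure sphere_measure (T k)) \<in> borel_measurable K"
proof -
  have "(\<lambda>x. x) \<in> (sphere_measure :: 'a measure) \<rightarrow>\<^sub>M borel"
    by (rule borel_measurable_sphere) simp
  then have "snd \<in> K \<Otimes>\<^sub>M (sphere_measure :: 'a measure) \<rightarrow>\<^sub>M borel"
    using measurable_compose[OF measurable_snd] by fast
  then have id: "(\<lambda>p. (fst p, snd p)) \<in> K \<Otimes>\<^sub>M (sphere_measure :: 'a measure) \<rightarrow>\<^sub>M K \<Otimes>\<^sub>M borel"
    by (intro measurable_Pair measurable_fst)
  have "Measurable.pred (K \<Otimes>\<^sub>M (sphere_measure :: 'a measure)) (\<lambda>p. snd p \<in> T (fst p))"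
    using measurable_compose[OF id, of "\<lambda>p. snd p \<in> T (fst p)" "count_space UNIV"] T
    unfolding measurable_family_def fst_conv snd_conv by blast
  then have Q: "{p \<in> space (K \<Otimes>\<^sub>M (sphere_measure :: 'a measure)). snd p \<in> T (fst p)} \<in> sets (K \<Otimes>\<^sub>M sphere_measure)" (is "?Q \<in> _")
    unfolding pred_def .
  have M: "(\<lambda>k. emeasure sphere_measure (Pair k -` ?Q)) \<in> borel_measurable K"
    by (rule sphere.measurable_emeasure_Pair[OF Q])
  have eq: "emeasure sphere_measure (Pair k -` ?Q) = emeasure sphere_measure (T k)" if "k \<in> space K" for k
  proof -
    have "T k \<subseteq> sphere 0 1" using that T by (simp add: measurable_family_def)
    then have "Pair k -` ?Q = T k" using that by (auto simp: space_pair_measure)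
    then show ?thesis by simp
  qed
  have "(\<lambda>k. emeasure sphere_measure (T k)) \<in> borel_measurable K"
    by (rule measurable_cong[THEN iffD1, OF eq M])
  then show ?thesis unfolding measure_def by measurable
qed

section \<open>Conditioning on the earlier directions\<close>

lemma sets_uniform_directions: "sets uniform_directions = sets directions_algebra"
  by (simp add: uniform_directions_def)

text \<open>By independence the last direction can be averaged with the earlier ones held fixed, and
  since it is distributed as the class of a uniform point, this average is an integral over the
  sphere. A general bounded \<open>\<phi>\<close> is allowed because the upper bound follows the
  distance itself and the lower bound a logarithm of it.\<close>

lemma expectation_polarization_step:
  fixes U :: "nat \<Rightarrow> 'w \<Rightarrow> 'a::euclidean_space set" and \<phi> :: "real \<Rightarrow> real"
  assumes P: "prob_space P"
    and ind: "prob_space.indep_vars P (\<lambda>_. uniform_directions) U {1..}"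
    and dist: "\<forall>i\<ge>1. distr P uniform_directions (U i) = uniform_directions"
    and z: "norm z = 1" and A: "A \<in> sets sphere_measure" and B: "B \<in> sets sphere_measure"
    and \<phi>: "\<phi> \<in> borel_measurable borel" and bound: "\<And>t. t \<in> {0..1} \<Longrightarrow> \<bar>\<phi> t\<bar> \<le> c"
  shows "(\<integral>\<omega>. \<phi> (measure sphere_measure (sym_diff (polarizations z (map (\<lambda>i. U i \<omega>) [1..<Suc (Suc n)]) A) B)) \<partial>P) =
    (\<integral>\<omega>. (\<integral>u. \<phi> (measure sphere_measure
       (sym_diff (polarization_dir z u (polarizations z (map (\<lambda>i. U i \<omega>) [1..<Suc n]) A)) B)) \<partial>sphere_measure) \<partial>P)"
      (is ?step)
    and "integrable P (\<lambda>\<omega>. \<integral>u. \<phi> (measure sphere_measure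
       (sym_diff (polarization_dir z u (polarizations z (map (\<lambda>i. U i \<omega>) [1..<Suc n]) A)) B)) \<partial>sphere_measure)"
      (is ?int)
proof -
  interpret P: prob_space P by fact
  let ?D = "uniform_directions :: 'a set measure"
  have D: "prob_space ?D" unfolding uniform_directions_def
    by (rule prob_space.prob_space_distr[OF prob_space_sphere_measure dir_class_measurable])
  interpret D: prob_space ?D by fact
  let ?I = "{1..n}" and ?K = "PiM {1..n} (\<lambda>_. ?D)"
  have rv: "U i \<in> P \<rightarrow>\<^sub>M ?D" if "i \<ge> 1" for i
    using ind that unfolding P.indep_vars_def by auto
  define Y where "Y \<omega> = restrict (\<lambda>i. U i \<omega>) ?I" for \<omega>
  \<comment> \<open>Independence is available for restrictions of the family to disjoint index sets,
    so the single direction \<open>U (Suc n)\<close> is handled as a function on a one-point index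
    set.\<close>
  let ?L = "PiM {Suc n} (\<lambda>_. ?D)"
  define Z where "Z \<omega> = restrict (\<lambda>i. U i \<omega>) {Suc n}" for \<omega>
  have "P.indep_var ?K Y ?L Z"
    unfolding Y_def Z_def by (rule P.indep_var_restrict[OF ind]) auto
  then have Y: "Y \<in> P \<rightarrow>\<^sub>M ?K" and Z: "Z \<in> P \<rightarrow>\<^sub>M ?L"
    and joint: "distr P ?K Y \<Otimes>\<^sub>M distr P ?L Z = distr P (?K \<Otimes>\<^sub>M ?L) (\<lambda>\<omega>. (Y \<omega>, Z \<omega>))"
    unfolding P.indep_var_distribution_eq by auto
  interpret Y: prob_space "distr P ?K Y" by (rule P.prob_space_distr[OF Y])
  interpret Z: prob_space "distr P ?L Z" by (rule P.prob_space_distr[OF Z])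
  interpret YZ: pair_prob_space "distr P ?K Y" "distr P ?L Z" ..
  define T where "T y = polarizations z (map (\<lambda>i. y i) [1..<Suc n]) A" for y
  define g where "g p = \<phi> (measure sphere_measure (sym_diff (polarization z (snd p) (T (fst p))) B))" for p
  have dirm: "measurable M ?D = measurable M directions_algebra" for M :: "'q measure"
    by (rule measurable_cong_sets[OF refl sets_uniform_directions])
  have fT: "measurable_family ?K T"
    unfolding T_def by (rule measurable_family_polarizations[OF A _ z]) (unfold dirm[symmetric], measurable)
  have "measurable_family (?K \<Otimes>\<^sub>M ?D) (\<lambda>p. sym_diff (polarization z (snd p) (T (fst p))) B)"
    by (intro measurable_family_sym_diff[OF measurable_family_polarization] B z
        measurable_family_compose[OF fT] measurable_fst) (unfold dirm[symmetric], measurable)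
  from measurable_family_measure[OF this]
  have g[measurable]: "g \<in> borel_measurable (?K \<Otimes>\<^sub>M ?D)"
    unfolding g_def by (rule measurable_compose[OF _ \<phi>])
  have gb: "\<bar>g p\<bar> \<le> c" for p
    unfolding g_def by (intro bound) auto
  have TY: "polarizations z (map (\<lambda>i. U i \<omega>) [1..<Suc n]) A = T (Y \<omega>)" for \<omega>
    unfolding T_def Y_def by (rule arg_cong[where f="\<lambda>l. polarizations z l A"]) auto
  have TSuc: "polarizations z (map (\<lambda>i. U i \<omega>) [1..<Suc (Suc n)]) A = polarization z (U (Suc n) \<omega>) (T (Y \<omega>))" for \<omega>
    unfolding TY[symmetric] polarizations_snoc[symmetric] by simp
  have gL: "(\<lambda>p. g (fst p, snd p (Suc n))) \<in> borel_measurable (?K \<Otimes>\<^sub>M ?L)"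
    by (rule measurable_compose[OF _ g, of "\<lambda>p. (fst p, snd p (Suc n))"]) measurable
  have gL': "(\<lambda>p. g (fst p, snd p (Suc n))) \<in> borel_measurable (distr P ?K Y \<Otimes>\<^sub>M distr P ?L Z)"
    "(\<lambda>p. g (fst p, snd p (Suc n))) \<in> borel_measurable (?K \<Otimes>\<^sub>M distr P ?L Z)"
  proof -
    have "sets (distr P ?K Y \<Otimes>\<^sub>M distr P ?L Z) = sets (?K \<Otimes>\<^sub>M ?L)" "sets (?K \<Otimes>\<^sub>M distr P ?L Z) = sets (?K \<Otimes>\<^sub>M ?L)"
      by (rule sets_pair_measure_cong; simp)+
    from this[THEN measurable_cong_sets[OF _ refl]] gL
    show "(\<lambda>p. g (fst p, snd p (Suc n))) \<in> borel_measurable (distr P ?K Y \<Otimes>\<^sub>M distr P ?L Z)"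
      "(\<lambda>p. g (fst p, snd p (Suc n))) \<in> borel_measurable (?K \<Otimes>\<^sub>M distr P ?L Z)" by blast+
  qed
  have inner: "(\<integral>u. \<phi> (measure sphere_measure (sym_diff (polarization_dir z u (T y)) B)) \<partial>sphere_measure)
      = (\<integral>f. g (y, f (Suc n)) \<partial>distr P ?L Z)"
    if y: "y \<in> space ?K" for y
  proof -
    have gy: "(\<lambda>w. g (y, w)) \<in> borel_measurable ?D" using y by measurable
    then have gy': "(\<lambda>w. g (y, w)) \<in> borel_measurable directions_algebra"
      by (simp add: measurable_cong_sets[OF sets_uniform_directions refl])
    have "(\<integral>f. g (y, f (Suc n)) \<partial>distr P ?L Z) = (\<integral>\<omega>. g (y, Z \<omega> (Suc n)) \<partial>P)"
      by (rule integral_distr[OF Z], rule measurable_compose[OF _ gy, of "\<lambda>f. f (Suc n)"]) measurable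
    also have "\<dots> = (\<integral>\<omega>. g (y, U (Suc n) \<omega>) \<partial>P)" by (simp add: Z_def)
    also have "\<dots> = (\<integral>w. g (y, w) \<partial>distr P ?D (U (Suc n)))"
      by (rule integral_distr[symmetric, OF rv gy]) simp
    also have "\<dots> = (\<integral>w. g (y, w) \<partial>?D)" using dist by simp
    also have "\<dots> = (\<integral>u. g (y, dir_class u) \<partial>sphere_measure)"
      unfolding uniform_directions_def by (rule integral_distr[OF dir_class_measurable gy'])
    finally show ?thesis by (simp add: g_def polarization_dir_class)
  qed
  have gint: "integrable (distr P ?K Y \<Otimes>\<^sub>M distr P ?L Z) (\<lambda>p. g (fst p, snd p (Suc n)))"
    by (rule YZ.P.integrable_const_bound[where B=c, OF _ gL'(1)]) (use gb in auto)
  have inner_m: "(\<lambda>y. \<integral>f. g (y, f (Suc n)) \<partial>distr P ?L Z) \<in> borel_measurable ?K"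
    by (rule Z.borel_measurable_lebesgue_integral) (use gL'(2) in \<open>simp add: case_prod_beta'\<close>)
  have "integrable (distr P ?K Y) (\<lambda>y. \<integral>f. g (y, f (Suc n)) \<partial>distr P ?L Z)"
    using YZ.integrable_fst'[OF gint] by simp
  then have "integrable P (\<lambda>\<omega>. \<integral>f. g (Y \<omega>, f (Suc n)) \<partial>distr P ?L Z)"
    by (subst (asm) integrable_distr_eq[OF Y inner_m])
  then show ?int
    unfolding TY using measurable_space[OF Y] by (subst Bochner_Integration.integrable_cong[OF refl inner]) auto
  have "(\<integral>\<omega>. \<phi> (measure sphere_measure (sym_diff (polarizations z (map (\<lambda>i. U i \<omega>) [1..<Suc (Suc n)]) A) B)) \<partial>P)
     = (\<integral>\<omega>. g (Y \<omega>, Z \<omega> (Suc n)) \<partial>P)"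
    unfolding TSuc g_def by (simp add: Z_def)
  also have "\<dots> = (\<integral>p. g (fst p, snd p (Suc n)) \<partial>distr P (?K \<Otimes>\<^sub>M ?L) (\<lambda>\<omega>. (Y \<omega>, Z \<omega>)))"
    by (subst integral_distr[OF measurable_Pair[OF Y Z] gL]) simp
  also have "\<dots> = (\<integral>p. g (fst p, snd p (Suc n)) \<partial>(distr P ?K Y \<Otimes>\<^sub>M distr P ?L Z))" by (simp only: joint)
  also have "\<dots> = (\<integral>y. (\<integral>f. g (fst (y, f), snd (y, f) (Suc n)) \<partial>distr P ?L Z) \<partial>distr P ?K Y)"
    by (rule YZ.integral_fst'[OF gint, symmetric])
  also have "\<dots> = (\<integral>y. (\<integral>f. g (y, f (Suc n)) \<partial>distr P ?L Z) \<partial>distr P ?K Y)" by simp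
  also have "\<dots> = (\<integral>\<omega>. (\<integral>f. g (Y \<omega>, f (Suc n)) \<partial>distr P ?L Z) \<partial>P)"
    by (rule integral_distr[OF Y inner_m])
  also have "\<dots> = (\<integral>\<omega>. (\<integral>u. \<phi> (measure sphere_measure (sym_diff (polarization_dir z u (T (Y \<omega>))) B)) \<partial>sphere_measure) \<partial>P)"
    using measurable_space[OF Y] by (intro Bochner_Integration.integral_cong refl inner[symmetric]) auto
  finally show ?step unfolding TY .
qed

section \<open>The expected gain of one polarization\<close>

lemma reflection_reflection: "norm u = 1 \<Longrightarrow> reflection u (reflection u x) = x"
  by (simp add: reflection_def inner_diff_right norm_eq_1 algebra_simps)

lemma geodesic_ball_eq:
  assumes "norm z = 1" "r \<in> {0..pi}"
  shows "geodesic_ball z r = {x \<in> sphere 0 1. cos r \<le> x \<bullet> z}"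
proof -
  have "arccos (x \<bullet> z) \<le> r \<longleftrightarrow> cos r \<le> x \<bullet> z" if "norm x = 1" for x
  proof -
    have b: "\<bar>x \<bullet> z\<bar> \<le> 1" using Cauchy_Schwarz_ineq2[of x z] assms that by auto
    have "arccos (x \<bullet> z) \<le> arccos (cos r) \<longleftrightarrow> cos r \<le> x \<bullet> z"
      by (rule arccos_le_mono) (use b in auto)
    then show ?thesis using assms by (simp add: arccos_cos)
  qed
  then show ?thesis by (auto simp: geodesic_ball_def geodesic_dist_def)
qed

lemma sphere_halfspace_sets: "{x \<in> sphere 0 1. c \<le> x \<bullet> z} \<in> sets sphere_measure"
  by (auto simp: sets_sphere_measure_iff)

lemma measure_sphere_level:
  fixes z :: "'a::euclidean_space"
  assumes n: "DIM('a) \<ge> 2" and z: "norm z = 1"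
  shows "measure sphere_measure {x \<in> sphere 0 1. x \<bullet> z = c} = 0"
proof -
  have M: "{x \<in> sphere 0 1. x \<bullet> z = c} \<in> sets sphere_measure" by (auto simp: sets_sphere_measure_iff)
  have "emeasure sphere_measure {x \<in> sphere 0 1. x \<bullet> z = c} = 0"
    using sphere_level_null[OF n z, of c] AE_iff_measurable[OF M, of "\<lambda>x. x \<bullet> z \<noteq> c"] by simp
  then show ?thesis by (simp add: measure_def)
qed

text \<open>This is the intermediate value theorem for the distribution function of
  \<open>- (x \<bullet> z)\<close>, which is continuous because level sets are null. The minus sign
  makes closed caps correspond to closed lower half-lines.\<close>

lemma cap_with_measure:
  fixes z :: "'a::euclidean_space"
  assumes n: "DIM('a) \<ge> 2" and z: "norm z = 1" and p: "p \<in> {0..1}"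
  shows "\<exists>r\<in>{0..pi}. measure sphere_measure (geodesic_ball z r) = p"
proof -
  define \<nu> where "\<nu> = distr sphere_measure borel (\<lambda>x. - (x \<bullet> z))"
  have meas: "(\<lambda>x. - (x \<bullet> z)) \<in> borel_measurable sphere_measure"
    by (rule borel_measurable_sphere) measurable
  interpret \<nu>: real_distribution \<nu>
    unfolding \<nu>_def by (rule real_distribution.intro[OF sphere.prob_space_distr[OF meas]])
       (simp add: real_distribution_axioms_def)
  have cdf: "cdf \<nu> t = measure sphere_measure {x \<in> sphere 0 1. - t \<le> x \<bullet> z}" for t
    unfolding cdf_def \<nu>_def by (subst measure_distr[OF meas]) (auto intro!: arg_cong[where f="measure sphere_measure"])
  have cont: "isCont (cdf \<nu>) t" for t
  proof -
    have "measure \<nu> {t} = measure sphere_measure {x \<in> sphere 0 1. x \<bullet> z = - t}"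
      unfolding \<nu>_def by (subst measure_distr[OF meas]) (auto intro!: arg_cong[where f="measure sphere_measure"])
    also have "\<dots> = 0" by (rule measure_sphere_level[OF n z])
    finally show ?thesis by (simp add: \<nu>.isCont_cdf)
  qed
  have xz: "x \<bullet> z \<le> 1" "-1 \<le> x \<bullet> z" if "norm x = 1" for x
    using Cauchy_Schwarz_ineq2[of x z] z that by auto
  have "cdf \<nu> (-1) = measure sphere_measure {x \<in> sphere 0 1. x \<bullet> z = 1}"
    unfolding cdf by (rule arg_cong[where f="measure sphere_measure"]) (auto intro: antisym xz)
  also have "\<dots> = 0" by (rule measure_sphere_level[OF n z])
  finally have l: "cdf \<nu> (-1) = 0" .
  have "cdf \<nu> 1 = measure sphere_measure (space (sphere_measure :: 'a measure))"
    unfolding cdf by (rule arg_cong[where f="measure sphere_measure"]) (auto simp: xz)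
  then have u: "cdf \<nu> 1 = 1" by (simp only: sphere.prob_space)
  obtain t where t: "-1 \<le> t" "t \<le> 1" "cdf \<nu> t = p"
    using IVT[of "cdf \<nu>" "-1" p 1] l u p cont by auto
  have "geodesic_ball z (arccos (- t)) = {x \<in> sphere 0 1. - t \<le> x \<bullet> z}"
    using t by (subst geodesic_ball_eq[OF z]) (auto simp: arccos_bounded cos_arccos)
  then show ?thesis using t cdf arccos_lbound[of "-t"] arccos_ubound[of "-t"] by (intro bexI[of _ "arccos (- t)"]) auto
qed

text \<open>The radius chosen by \<open>SOME\<close> is never determined. That the set is a
  superlevel set of the height above the equator, with the right measure, is all that the later
  arguments use.\<close>

lemma polar_cap_props:
  fixes z :: "'a::euclidean_space"
  assumes n: "DIM('a) \<ge> 2" and z: "norm z = 1"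
  obtains c where "polar_cap z A = {x \<in> sphere 0 1. c \<le> x \<bullet> z}"
    "measure sphere_measure (polar_cap z A) = measure sphere_measure A"
proof -
  let ?P = "\<lambda>r. r \<in> {0..pi} \<and> measure sphere_measure (geodesic_ball z r) = measure sphere_measure A"
  have "\<exists>r. ?P r" using cap_with_measure[OF n z, of "measure sphere_measure A"] by auto
  then have P: "?P (SOME r. ?P r)" by (rule someI_ex)
  define r where "r = (SOME r. ?P r)"
  have r: "r \<in> {0..pi}" "measure sphere_measure (geodesic_ball z r) = measure sphere_measure A"
    using P unfolding r_def by blast+
  have "polar_cap z A = geodesic_ball z r" unfolding polar_cap_def r_def ..
  with r show ?thesis using that[of "cos r"] geodesic_ball_eq[OF z r(1)] by simp
qed

text \<open>If the indicators balance on every mirror pair, their difference is odd under the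
  reflection, and by invariance an odd function has integral zero. Measures can thus be compared by
  a case analysis on pairs.\<close>

lemma measure_eq_by_reflection:
  fixes u :: "'a::euclidean_space"
  assumes u: "norm u = 1" and X: "X \<in> sets sphere_measure" and Y: "Y \<in> sets sphere_measure"
    and Z: "Z \<in> sets sphere_measure"
    and eq: "\<And>x. norm x = 1 \<Longrightarrow> indicat_real X x + indicat_real X (reflection u x) =
      (indicat_real Y x + indicat_real Y (reflection u x)) + (indicat_real Z x + indicat_real Z (reflection u x))"
  shows "measure sphere_measure X = measure sphere_measure Y + measure sphere_measure Z"
proof -
  define h where "h x = indicat_real X x - indicat_real Y x - indicat_real Z x" for x
  have h: "h \<in> borel_measurable sphere_measure" unfolding h_def using X Y Z by measurable
  have "(\<integral>x. h x \<partial>sphere_measure) = (\<integral>x. h (reflection u x) \<partial>sphere_measure)"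
    by (rule integral_sphere_orthogonal[OF orthogonal_transformation_reflection[OF u] h, symmetric])
  also have "\<dots> = (\<integral>x. - h x \<partial>sphere_measure)"
    by (rule Bochner_Integration.integral_cong) (use eq in \<open>auto simp: h_def algebra_simps\<close>)
  finally have "(\<integral>x. h x \<partial>sphere_measure) = 0" by simp
  moreover have "(\<integral>x. h x \<partial>sphere_measure) = measure sphere_measure X - measure sphere_measure Y - measure sphere_measure Z"
    unfolding h_def using X Y Z by (simp add: sphere.emeasure_eq_measure sets_sphere_measure_iff Int_absorb2)
  ultimately show ?thesis by simp
qed

lemma polarization_dir_sets:
  assumes u: "norm u = 1" and z: "norm z = 1" and A: "A \<in> sets sphere_measure"
  shows "polarization_dir z u A \<in> sets sphere_measure"
proof -
  have W: "(\<lambda>_. dir_class u) \<in> sphere_measure \<rightarrow>\<^sub>M directions_algebra"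
    using u by (intro measurable_const) (auto simp: directions_def)
  have "measurable_family sphere_measure (\<lambda>_::'a. polarization z (dir_class u) A)"
    by (rule measurable_family_polarization[OF measurable_family_const[OF A] W z])
  from measurable_family_sets[OF this, of u] u show ?thesis by (simp add: polarization_dir_class)
qed

text \<open>Polarization keeps the number of points of \<open>A\<close> in a mirror pair and moves a
  single point to the side of the pole. A cap contains the point on the side of the pole whenever it
  contains the other one, so a pair contributes a gain exactly when the first lies in
  \<open>B - A\<close> and the second in \<open>A - B\<close>.\<close>

lemma measure_polarization_dir_Int_cap:
  fixes z :: "'a::euclidean_space"
  assumes u: "norm u = 1" and z: "norm z = 1" and A: "A \<in> sets sphere_measure"
    and B: "B = {x \<in> sphere 0 1. c \<le> x \<bullet> z}"
  shows "measure sphere_measure (polarization_dir z u A \<inter> B) =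
    measure sphere_measure (A \<inter> B) + measure sphere_measure {x \<in> B - A. reflection u x \<in> A - B}"
proof -
  have uu: "u \<bullet> u = 1" using u by (simp add: norm_eq_1)
  have AS: "A \<subseteq> sphere 0 1" using A by (simp add: sets_sphere_measure_iff)
  have Bs: "B \<in> sets sphere_measure" unfolding B by (rule sphere_halfspace_sets)
  have G: "{x \<in> B - A. reflection u x \<in> A - B} \<in> sets sphere_measure"
  proof -
    have "reflection u -` (A - B) \<inter> space sphere_measure \<in> sets sphere_measure"
      using A Bs orthogonal_transformation_measurable_sphere[OF orthogonal_transformation_reflection[OF u]]
      by (intro measurable_sets) auto
    moreover have "{x \<in> B - A. reflection u x \<in> A - B} = (reflection u -` (A - B) \<inter> space sphere_measure) \<inter> (B - A)"
      by (auto simp: B)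
    ultimately show ?thesis using A Bs by auto
  qed
  show ?thesis
  proof (rule measure_eq_by_reflection[OF u _ _ G])
    fix x :: 'a assume x: "norm x = 1"
    have fixp: "reflection u x = x" if "u \<bullet> x = 0" using that by (simp add: reflection_def)
    have neg: "u \<bullet> reflection u x = - (u \<bullet> x)" by (simp add: reflection_def inner_diff_right uu)
    have rz: "reflection u x \<bullet> z = x \<bullet> z - 2 * ((u \<bullet> x) * (u \<bullet> z))" by (simp add: reflection_def inner_diff_left)
    have nr: "norm (reflection u x) = 1" using x by (simp add: norm_reflection[OF u])
    define y where "y = reflection u x"
    have yx: "reflection u y = x" unfolding y_def by (rule reflection_reflection[OF u])
    have rz': "y \<bullet> z = x \<bullet> z - 2 * ((u \<bullet> x) * (u \<bullet> z))" using rz by (simp add: y_def)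
    \<comment> \<open>A nonnegative product means that \<open>x\<close> is at least as high above
      the equator as \<open>y\<close>, and membership in the cap depends on the height only.\<close>
    have up: "y \<in> B \<Longrightarrow> x \<in> B" if "0 \<le> (u \<bullet> x) * (u \<bullet> z)"
      using that x unfolding B by (simp add: rz')
    have dn: "x \<in> B \<Longrightarrow> y \<in> B" if "(u \<bullet> x) * (u \<bullet> z) \<le> 0"
      using that nr unfolding B by (simp add: rz' flip: y_def)
    have mem: "w \<in> polarization_dir z u A \<longleftrightarrow> norm w = 1 \<and>
      (if u \<bullet> z = 0 then w \<in> A else if 0 \<le> (u \<bullet> w) * (u \<bullet> z) then w \<in> A \<or> reflection u w \<in> A
       else w \<in> A \<and> reflection u w \<in> A)" for w
      by (rule mem_polarization_dir[OF u z AS])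
    have my: "(u \<bullet> y) * (u \<bullet> z) = - ((u \<bullet> x) * (u \<bullet> z))" using neg by (simp add: y_def)
    have norms: "norm x = 1" "norm y = 1" using x nr by (simp_all add: y_def)
    have G: "w \<in> {x \<in> B - A. reflection u x \<in> A - B} \<longleftrightarrow> w \<in> B \<and> w \<notin> A \<and> reflection u w \<in> A \<and> reflection u w \<notin> B" for w
      by auto
    consider "(u \<bullet> x) * (u \<bullet> z) = 0" | "(u \<bullet> x) * (u \<bullet> z) > 0" | "(u \<bullet> x) * (u \<bullet> z) < 0" by linarith
    then have "indicat_real (polarization_dir z u A \<inter> B) x + indicat_real (polarization_dir z u A \<inter> B) (y) =
      (indicat_real (A \<inter> B) x + indicat_real (A \<inter> B) (y)) +
      (indicat_real {x \<in> B - A. reflection u x \<in> A - B} x + indicat_real {x \<in> B - A. reflection u x \<in> A - B} (y))"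
    proof cases
      case 1
      show ?thesis
      proof (cases "u \<bullet> z = 0")
        case True
        \<comment> \<open>Here the polarization is the identity by convention. The mirror preserves
          heights, so the gain set is empty on this pair as well.\<close>
        have "x \<in> polarization_dir z u A \<longleftrightarrow> x \<in> A" "y \<in> polarization_dir z u A \<longleftrightarrow> y \<in> A"
          using True norms by (simp_all add: mem)
        moreover have "x \<in> B \<longleftrightarrow> y \<in> B" using up dn 1 by auto
        ultimately show ?thesis unfolding indicator_def Int_iff G y_def[symmetric] yx by auto
      next
        case False
        then have "y = x" using 1 fixp by (simp add: y_def)
        then show ?thesis using False 1 norms yx unfolding indicator_def Int_iff G y_def[symmetric] mem by simp
      qed
    next
      case 2
      then have "u \<bullet> z \<noteq> 0" by auto
      then have S: "x \<in> polarization_dir z u A \<longleftrightarrow> x \<in> A \<or> y \<in> A" "y \<in> polarization_dir z u A \<longleftrightarrow> x \<in> A \<and> y \<in> A"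
        using 2 norms unfolding mem my y_def[symmetric] yx by auto
      have "y \<in> B \<Longrightarrow> x \<in> B" using up 2 by simp
      then show ?thesis unfolding indicator_def Int_iff G y_def[symmetric] yx S
        by (cases "x \<in> A"; cases "y \<in> A"; cases "x \<in> B"; cases "y \<in> B") simp_all
    next
      case 3
      then have "u \<bullet> z \<noteq> 0" by auto
      then have S: "y \<in> polarization_dir z u A \<longleftrightarrow> x \<in> A \<or> y \<in> A" "x \<in> polarization_dir z u A \<longleftrightarrow> x \<in> A \<and> y \<in> A"
        using 3 norms unfolding mem my y_def[symmetric] yx by auto
      have "x \<in> B \<Longrightarrow> y \<in> B" using dn 3 by simp
      then show ?thesis unfolding indicator_def Int_iff G y_def[symmetric] yx S
        by (cases "x \<in> A"; cases "y \<in> A"; cases "x \<in> B"; cases "y \<in> B") simp_all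
    qed
    then show "indicat_real (polarization_dir z u A \<inter> B) x + indicat_real (polarization_dir z u A \<inter> B) (reflection u x) =
      (indicat_real (A \<inter> B) x + indicat_real (A \<inter> B) (reflection u x)) +
      (indicat_real {x \<in> B - A. reflection u x \<in> A - B} x + indicat_real {x \<in> B - A. reflection u x \<in> A - B} (reflection u x))"
      unfolding y_def .
  qed (use A Bs polarization_dir_sets[OF u z A] in auto)
qed

lemma measure_polarization_dir:
  fixes z :: "'a::euclidean_space"
  assumes u: "norm u = 1" and z: "norm z = 1" and A: "A \<in> sets sphere_measure"
  shows "measure sphere_measure (polarization_dir z u A) = measure sphere_measure A"
proof -
  \<comment> \<open>At level -1 the cap is the whole sphere, its complement is empty, and the gain
    term vanishes.\<close>
  define B where "B = {x \<in> sphere 0 1. -1 \<le> x \<bullet> z}"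
  have "-1 \<le> x \<bullet> z" if "norm x = 1" for x using Cauchy_Schwarz_ineq2[of x z] z that by auto
  then have "B = sphere 0 1" by (auto simp: B_def)
  then have eqs: "polarization_dir z u A \<inter> B = polarization_dir z u A" "A \<inter> B = A" "{x \<in> B - A. reflection u x \<in> A - B} = {}"
    using A polarization_dir_sets[OF u z A] by (auto simp: sets_sphere_measure_iff)
  show ?thesis using measure_polarization_dir_Int_cap[OF u z A B_def] unfolding eqs by simp
qed

lemma measure_sym_diff:
  assumes "A \<in> sets sphere_measure" "B \<in> sets sphere_measure"
  shows "measure sphere_measure (sym_diff A B) =
    measure sphere_measure A + measure sphere_measure B - 2 * measure sphere_measure (A \<inter> B)"
proof -
  have "measure sphere_measure (sym_diff A B) = measure sphere_measure (A - B) + measure sphere_measure (B - A)"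
    using assms by (intro sphere.finite_measure_Union) auto
  also have "measure sphere_measure (A - B) = measure sphere_measure A - measure sphere_measure (A \<inter> B)"
    using assms by (rule sphere.finite_measure_Diff')
  also have "measure sphere_measure (B - A) = measure sphere_measure B - measure sphere_measure (A \<inter> B)"
    using sphere.finite_measure_Diff'[OF assms(2,1)] by (simp add: Int_commute)
  finally show ?thesis by simp
qed

text \<open>Equal measures split the symmetric difference into two halves of measure f / 2. The
  kernel bound gives a mean gain of at least (2 / 2^d) (f / 2)^2, and a gain lowers the symmetric
  difference twice, by what enters \<open>B\<close> and by what leaves its complement.\<close>

lemma integral_sym_diff_polarization:
  fixes z :: "'a::euclidean_space"
  assumes d: "DIM('a) = d + 1" "d \<ge> 1" and z: "norm z = 1" and A: "A \<in> sets sphere_measure"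
    and B: "B = {x \<in> sphere 0 1. c \<le> x \<bullet> z}" and AB: "measure sphere_measure B = measure sphere_measure A"
  shows "(\<integral>u. measure sphere_measure (sym_diff (polarization_dir z u A) B) \<partial>sphere_measure) \<le>
    measure sphere_measure (sym_diff A B) - (measure sphere_measure (sym_diff A B))\<^sup>2 / 2 ^ d"
proof -
  have Bs: "B \<in> sets sphere_measure" unfolding B by (rule sphere_halfspace_sets)
  define f where "f = measure sphere_measure (sym_diff A B)"
  define E where "E = A - B" define F where "F = B - A"
  have E[measurable]: "E \<in> sets sphere_measure" and F[measurable]: "F \<in> sets sphere_measure"
    using A Bs by (auto simp: E_def F_def)
  have EB: "E \<in> sets borel" "F \<in> sets borel" "E \<subseteq> sphere 0 1" "F \<subseteq> sphere 0 1" using E F by (auto simp: sets_sphere_measure_iff)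
  have fE: "measure sphere_measure E = f / 2" "measure sphere_measure F = f / 2"
    unfolding E_def F_def f_def
    using sphere.finite_measure_Diff'[OF A Bs] sphere.finite_measure_Diff'[OF Bs A] AB measure_sym_diff[OF A Bs]
    by (simp_all add: Int_commute)
  define g where "g u = measure sphere_measure {x \<in> F. reflection u x \<in> E}" for u
  have step: "measure sphere_measure (sym_diff (polarization_dir z u A) B) = f - 2 * g u" if "u \<in> sphere 0 1" for u
  proof -
    have u: "norm u = 1" using that by simp
    show ?thesis
      unfolding f_def g_def measure_sym_diff[OF polarization_dir_sets[OF u z A] Bs] measure_sym_diff[OF A Bs]
        measure_polarization_dir[OF u z A] measure_polarization_dir_Int_cap[OF u z A B] E_def F_def by simp
  qed
  have pr[measurable]: "fst \<in> sphere_measure \<Otimes>\<^sub>M sphere_measure \<rightarrow>\<^sub>M (borel :: 'a measure)" "snd \<in> sphere_measure \<Otimes>\<^sub>M sphere_measure \<rightarrow>\<^sub>M (borel :: 'a measure)"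
    by (rule measurable_compose[OF measurable_fst borel_measurable_sphere[OF measurable_ident_sets[OF refl]]]
        measurable_compose[OF measurable_snd borel_measurable_sphere[OF measurable_ident_sets[OF refl]]])+
  note [measurable] = EB(1,2)
  define Q where "Q = {p \<in> space (sphere_measure \<Otimes>\<^sub>M sphere_measure). snd p \<in> F \<and> reflection (fst p) (snd p) \<in> E}"
  have Q: "Q \<in> sets (sphere_measure \<Otimes>\<^sub>M sphere_measure)"
    unfolding Q_def by measurable
  have Qu: "Pair u -` Q = {x \<in> F. reflection u x \<in> E}" if "u \<in> sphere 0 1" for u
    using that EB by (auto simp: Q_def space_pair_measure)
  have Qx: "(\<lambda>u. (u, x)) -` Q = {u \<in> sphere 0 1. reflection u x \<in> E}" if "x \<in> F" for x
    using that EB by (auto simp: Q_def space_pair_measure)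
  have "(\<lambda>u. measure sphere_measure (Pair u -` Q)) \<in> borel_measurable sphere_measure"
    unfolding measure_def using sphere.measurable_emeasure_Pair[OF Q] by measurable
  then have gm: "g \<in> borel_measurable sphere_measure"
    by (rule measurable_cong[THEN iffD1, rotated]) (simp add: g_def Qu)
  have gi: "integrable sphere_measure g"
    by (rule sphere.integrable_const_bound[where B=1]) (use gm in \<open>auto simp: g_def\<close>)
  interpret SS: pair_prob_space "sphere_measure :: 'a measure" "sphere_measure :: 'a measure" ..
  \<comment> \<open>Tonelli on the set \<open>Q\<close> of pairs (u, x): its section at fixed x in
    \<open>F\<close> is bounded below by \<open>reflection_kernel\<close>, its section at fixed u
    has measure \<open>g u\<close>.\<close>
  have "ennreal (2 / 2 ^ d * (f / 2) * (f / 2)) = (\<integral>\<^sup>+x. ennreal (2 / 2 ^ d) * emeasure sphere_measure E * indicator F x \<partial>sphere_measure)"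
    using F by (simp add: nn_integral_cmult sphere.emeasure_eq_measure fE ennreal_mult''[symmetric] f_def)
  also have "\<dots> \<le> (\<integral>\<^sup>+x. emeasure sphere_measure ((\<lambda>u. (u, x)) -` Q) \<partial>sphere_measure)"
  proof (rule nn_integral_mono)
    fix x :: 'a assume "x \<in> space sphere_measure"
    then have x: "norm x = 1" by simp
    show "ennreal (2 / 2 ^ d) * emeasure sphere_measure E * indicator F x \<le> emeasure sphere_measure ((\<lambda>u. (u, x)) -` Q)"
      using reflection_kernel[OF d x E] Qx[of x] by (cases "x \<in> F") auto
  qed
  also have "\<dots> = emeasure (sphere_measure \<Otimes>\<^sub>M sphere_measure) Q"
    by (rule SS.emeasure_pair_measure_alt2[OF Q, symmetric])
  also have "\<dots> = (\<integral>\<^sup>+u. emeasure sphere_measure (Pair u -` Q) \<partial>sphere_measure)"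
    by (rule sphere.emeasure_pair_measure_alt[OF Q])
  also have "\<dots> = (\<integral>\<^sup>+u. ennreal (g u) \<partial>sphere_measure)"
    by (rule nn_integral_cong) (simp add: Qu g_def sphere.emeasure_eq_measure)
  also have "\<dots> = ennreal (\<integral>u. g u \<partial>sphere_measure)"
    by (rule nn_integral_eq_integral[OF gi]) (simp add: g_def)
  finally have "ennreal (2 / 2 ^ d * (f / 2) * (f / 2)) \<le> ennreal (\<integral>u. g u \<partial>sphere_measure)" .
  moreover have "0 \<le> (\<integral>u. g u \<partial>sphere_measure)"
    by (rule integral_nonneg_AE) (simp add: g_def)
  ultimately have le: "2 / 2 ^ d * (f / 2) * (f / 2) \<le> (\<integral>u. g u \<partial>sphere_measure)"
    by (simp only: ennreal_le_iff)
  have "(\<integral>u. measure sphere_measure (sym_diff (polarization_dir z u A) B) \<partial>sphere_measure) = (\<integral>u. f - 2 * g u \<partial>sphere_measure)"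
    by (rule Bochner_Integration.integral_cong) (auto simp: step)
  also have "\<dots> = f - 2 * (\<integral>u. g u \<partial>sphere_measure)"
    using gi sphere.prob_space[where ?'a='a] by simp
  also have "\<dots> \<le> f - f\<^sup>2 / 2 ^ d"
    using le by (simp add: power2_eq_square)
  finally show ?thesis unfolding f_def .
qed

section \<open>Rotations in a coordinate plane\<close>

definition plane_rotation :: "'a::euclidean_space \<Rightarrow> 'a \<Rightarrow> real \<Rightarrow> 'a \<Rightarrow> 'a" where
  "plane_rotation e f t x = x + ((cos t - 1) * (x \<bullet> e) - sin t * (x \<bullet> f)) *\<^sub>R e
     + ((cos t - 1) * (x \<bullet> f) + sin t * (x \<bullet> e)) *\<^sub>R f"

lemma plane_rotation_inner:
  assumes "norm e = 1" "norm f = 1" "e \<bullet> f = 0"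
  shows "plane_rotation e f t x \<bullet> e = (x \<bullet> e) * cos t - (x \<bullet> f) * sin t"
    and "plane_rotation e f t x \<bullet> f = (x \<bullet> f) * cos t + (x \<bullet> e) * sin t"
    and "\<And>b. b \<bullet> e = 0 \<Longrightarrow> b \<bullet> f = 0 \<Longrightarrow> plane_rotation e f t x \<bullet> b = x \<bullet> b"
  using assms by (simp_all add: plane_rotation_def inner_add_left norm_eq_1 inner_commute algebra_simps)

lemma orthogonal_transformation_plane_rotation:
  assumes ef: "norm e = 1" "norm f = 1" "e \<bullet> f = 0"
  shows "orthogonal_transformation (plane_rotation e f t)"
proof -
  have ee: "e \<bullet> e = 1" "f \<bullet> f = 1" "f \<bullet> e = 0" using ef by (simp_all add: norm_eq_1 inner_commute)
  have lin: "linear (plane_rotation e f t)"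
    by (rule linearI) (simp_all add: plane_rotation_def algebra_simps inner_add_left)
  have "norm (plane_rotation e f t x) = norm x" for x
  proof -
    define p q where "p = x \<bullet> e" and "q = x \<bullet> f"
    define A B where "A = (cos t - 1) * p - sin t * q" and "B = (cos t - 1) * q + sin t * p"
    have pq: "e \<bullet> x = p" "f \<bullet> x = q" by (simp_all add: p_def q_def inner_commute)
    have "plane_rotation e f t x \<bullet> plane_rotation e f t x = (x + A *\<^sub>R e + B *\<^sub>R f) \<bullet> (x + A *\<^sub>R e + B *\<^sub>R f)"
      by (simp add: plane_rotation_def A_def B_def p_def q_def)
    also have "\<dots> = x \<bullet> x + 2 * (A * p + B * q) + (A * A + B * B)"
      using ee ef by (simp add: inner_add_left inner_add_right pq p_def[symmetric] q_def[symmetric] algebra_simps)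
    also have "\<dots> = x \<bullet> x + (p * p + q * q) * ((sin t)\<^sup>2 + (cos t)\<^sup>2 - 1)"
    proof -
      have "2 * (((c - 1) * p - r * q) * p + ((c - 1) * q + r * p) * q) +
          (((c - 1) * p - r * q) * ((c - 1) * p - r * q) + ((c - 1) * q + r * p) * ((c - 1) * q + r * p)) =
          (p * p + q * q) * (r\<^sup>2 + c\<^sup>2 - 1)" for c r :: real
        by (simp add: algebra_simps power2_eq_square)
      from this[of "cos t" "sin t"] show ?thesis unfolding A_def B_def by linarith
    qed
    finally have "plane_rotation e f t x \<bullet> plane_rotation e f t x = x \<bullet> x" by simp
    then show ?thesis by (simp add: norm_eq)
  qed
  with lin show ?thesis by (simp add: orthogonal_transformation)
qed

text \<open>The sum over \<open>W\<close> is the squared length of the component of x orthogonal to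
  the plane of e and f. In dimension two, the case of the circle, \<open>W\<close> is empty.\<close>

lemma orthonormal_complement_basis:
  fixes e f :: "'a::euclidean_space"
  assumes ef: "norm e = 1" "norm f = 1" "e \<bullet> f = 0"
  obtains W where "finite W" "card W + 2 = DIM('a)" "\<And>b. b \<in> W \<Longrightarrow> norm b = 1 \<and> b \<bullet> e = 0 \<and> b \<bullet> f = 0"
    "pairwise orthogonal W" "\<And>x. (\<Sum>b\<in>W. (x \<bullet> b)\<^sup>2) + (x \<bullet> e)\<^sup>2 + (x \<bullet> f)\<^sup>2 = x \<bullet> x"
proof -
  have ee: "e \<bullet> e = 1" "f \<bullet> f = 1" "f \<bullet> e = 0" using ef by (simp_all add: norm_eq_1 inner_commute)
  define V where "V = {y \<in> UNIV. \<forall>x\<in>span {e, f}. orthogonal x y}"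
  have V: "y \<in> V \<longleftrightarrow> y \<bullet> e = 0 \<and> y \<bullet> f = 0" for y
  proof
    assume "y \<in> V" then show "y \<bullet> e = 0 \<and> y \<bullet> f = 0"
      by (auto simp: V_def orthogonal_def inner_commute span_base)
  next
    assume y: "y \<bullet> e = 0 \<and> y \<bullet> f = 0"
    have "orthogonal y x" if "x \<in> span {e, f}" for x
      by (rule orthogonal_to_span[OF that]) (use y in \<open>auto simp: orthogonal_def\<close>)
    then show "y \<in> V" by (auto simp: V_def orthogonal_commute)
  qed
  have "subspace V" by (auto simp: subspace_def V inner_add_left)
  then obtain W where W: "W \<subseteq> V" "pairwise orthogonal W" "\<And>x. x \<in> W \<Longrightarrow> norm x = 1"
      "independent W" "card W = dim V" "span W = V"
    using orthonormal_basis_subspace by blast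
  have fin: "finite W" using W(4) by (rule independent_imp_finite)
  have "e \<noteq> f" using ee by auto
  have "pairwise orthogonal {e, f}" using ee by (auto simp: pairwise_def orthogonal_def ef)
  then have ind: "independent {e, f}"
    by (rule pairwise_orthogonal_independent) (use ef in auto)
  have "dim (span {e, f}) = 2" using ind \<open>e \<noteq> f\<close> by (simp add: dim_eq_card_independent)
  then have card: "card W + 2 = DIM('a)"
    using dim_subspace_orthogonal_to_vectors[of "span {e, f}" UNIV] by (simp add: W V_def)
  have parseval: "(\<Sum>b\<in>W. (x \<bullet> b)\<^sup>2) + (x \<bullet> e)\<^sup>2 + (x \<bullet> f)\<^sup>2 = x \<bullet> x" for x
  proof -
    define y where "y = x - (x \<bullet> e) *\<^sub>R e - (x \<bullet> f) *\<^sub>R f"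
    have ye: "y \<bullet> e = 0" "y \<bullet> f = 0" using ee ef by (auto simp: y_def inner_diff_left)
    have yb: "y \<bullet> b = x \<bullet> b" if "b \<in> W" for b
    proof -
      have "e \<bullet> b = 0" "f \<bullet> b = 0" using W(1) V[of b] that by (auto simp: inner_commute)
      then show ?thesis by (simp add: y_def inner_diff_left)
    qed
    have "y \<in> span W" using ye W(6) V by simp
    then have "(\<Sum>b\<in>W. (y \<bullet> b) *\<^sub>R b) = y"
      using orthonormal_basis_expand[OF W(2) W(3)] fin by simp
    then have "y \<bullet> y = (\<Sum>b\<in>W. (y \<bullet> b) *\<^sub>R b) \<bullet> y" by simp
    also have "\<dots> = (\<Sum>b\<in>W. (y \<bullet> b) * (b \<bullet> y))" by (simp add: inner_sum_left)
    also have "\<dots> = (\<Sum>b\<in>W. (x \<bullet> b)\<^sup>2)"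
      by (intro sum.cong refl) (metis inner_commute power2_eq_square yb)
    finally have "(\<Sum>b\<in>W. (x \<bullet> b)\<^sup>2) = y \<bullet> y" ..
    also have "y \<bullet> y = y \<bullet> x" using ye by (metis (no_types, lifting) diff_zero inner_diff_right inner_scaleR_right mult_zero_right y_def)
    also have "\<dots> = x \<bullet> x - (x \<bullet> e)\<^sup>2 - (x \<bullet> f)\<^sup>2"
      by (simp add: y_def inner_diff_left power2_eq_square inner_commute[of e x] inner_commute[of f x])
    finally show ?thesis by simp
  qed
  show ?thesis
    by (rule that[of W]) (use W V fin card parseval in auto)
qed

text \<open>
  Infinitesimal rotation invariance: \<open>D u\<close> is the derivative at \<open>t = 0\<close> of \<open>g (R t u)\<close> for
  \<open>g u = (u \<bullet> e) (u \<bullet> f) / (1 + s u)\<close>. Summed over \<open>e \<in> W\<close> and two vectors \<open>f\<close>, it becomes an affine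
  function of \<open>s\<close>; this dictates the choice of \<open>g\<close>.
\<close>

lemma rotation_derivative_integral:
  fixes e f :: "'a::euclidean_space"
  assumes n: "DIM('a) \<ge> 2" and W: "finite W" "e \<in> W" "\<And>b. b \<in> W \<Longrightarrow> norm b = 1" "pairwise orthogonal W"
    and f: "norm f = 1" "\<And>b. b \<in> W \<Longrightarrow> b \<bullet> f = 0"
  defines "s \<equiv> \<lambda>u. sqrt (\<Sum>b\<in>W. (u \<bullet> b)\<^sup>2)"
  defines "D \<equiv> \<lambda>u. ((u \<bullet> e)\<^sup>2 - (u \<bullet> f)\<^sup>2) / (1 + s u) + (u \<bullet> e)\<^sup>2 * (u \<bullet> f)\<^sup>2 / (s u * (1 + s u)\<^sup>2)"
  shows "integrable sphere_measure D" "(\<integral>u. D u \<partial>sphere_measure) = 0"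
proof -
  have e: "norm e = 1" "e \<bullet> f = 0" using W f by auto
  have sm[measurable]: "s \<in> borel_measurable borel" unfolding s_def by measurable
  have s0: "s u \<ge> 0" for u by (simp add: s_def sum_nonneg)
  define g where "g u = (u \<bullet> e) * (u \<bullet> f) / (1 + s u)" for u
  have gm[measurable]: "g \<in> borel_measurable borel" unfolding g_def by measurable
  define R where "R = plane_rotation e f"
  have orth: "orthogonal_transformation (R t)" for t
    unfolding R_def by (rule orthogonal_transformation_plane_rotation[OF e(1) f(1) e(2)])
  note RI = plane_rotation_inner[OF e(1) f(1) e(2), folded R_def]
  define p where "p u t = (u \<bullet> e) * cos t - (u \<bullet> f) * sin t" for u t
  define q where "q u t = (u \<bullet> f) * cos t + (u \<bullet> e) * sin t" for u t
  \<comment> \<open>The rotation in the plane of e and f leaves \<open>\<sigma>\<close> fixed, so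
    \<open>s\<close> varies with t only through the coordinate along e.\<close>
  define \<sigma> where "\<sigma> u = (\<Sum>b\<in>W - {e}. (u \<bullet> b)\<^sup>2)" for u
  define S where "S u t = sqrt (\<sigma> u + (p u t)\<^sup>2)" for u t
  have \<sigma>0: "\<sigma> u \<ge> 0" for u by (simp add: \<sigma>_def sum_nonneg)
  have s\<sigma>: "s u = sqrt (\<sigma> u + (u \<bullet> e)\<^sup>2)" for u
    unfolding s_def \<sigma>_def using W by (subst sum.remove[of W e]) (auto simp: add.commute)
  have \<sigma>R: "\<sigma> (R t u) = \<sigma> u" for t u
    unfolding \<sigma>_def
  proof (rule sum.cong[OF refl])
    fix b assume b: "b \<in> W - {e}"
    then have "b \<bullet> e = 0" using W(2,4) by (auto simp: pairwise_def orthogonal_def)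
    with b f(2) show "(R t u \<bullet> b)\<^sup>2 = (u \<bullet> b)\<^sup>2" by (simp add: RI(3))
  qed
  have gR: "g (R t u) = p u t * q u t / (1 + S u t)" for t u
    by (simp add: g_def s\<sigma> \<sigma>R RI(1,2) p_def q_def S_def)
  have g0: "g u = p u 0 * q u 0 / (1 + S u 0)" for u
    by (simp add: g_def s\<sigma> p_def q_def S_def)
  have S0: "S u t \<ge> 0" for u t using \<sigma>0[of u] by (simp add: S_def)
  \<comment> \<open>This dominates the difference quotients uniformly in u. The numerator
    contributes 4 t and the denominator 2 t.\<close>
  have lip: "\<bar>g (R t u) - g u\<bar> \<le> 6 * t" if u: "norm u = 1" and t: "0 < t" for u t
  proof -
    have ab: "\<bar>u \<bullet> e\<bar> \<le> 1" "\<bar>u \<bullet> f\<bar> \<le> 1"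
      using Cauchy_Schwarz_ineq2[of u e] Cauchy_Schwarz_ineq2[of u f] u e f by auto
    have pq1: "\<bar>p u t\<bar> \<le> 1" "\<bar>q u t\<bar> \<le> 1" for t
      using Cauchy_Schwarz_ineq2[of "R t u" e] Cauchy_Schwarz_ineq2[of "R t u" f] u e f
        orthogonal_transformation_norm[OF orth, of t u] by (auto simp: RI p_def q_def)
    have trig: "\<bar>cos t - 1\<bar> \<le> t" "\<bar>sin t\<bar> \<le> t"
    proof -
      show "\<bar>sin t\<bar> \<le> t" using abs_sin_x_le_abs_x[of t] t by simp
      have "1 - cos t = 2 * (sin (t / 2))\<^sup>2" using cos_double_sin[of "t / 2"] by simp
      also have "\<dots> \<le> 2 * \<bar>sin (t / 2)\<bar>"
        using abs_sin_le_one[of "t/2"]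
        by (metis abs_ge_zero mult.right_neutral mult_left_mono power2_abs power2_eq_square zero_le_numeral)
      also have "\<dots> \<le> t" using abs_sin_x_le_abs_x[of "t/2"] t by simp
      finally show "\<bar>cos t - 1\<bar> \<le> t" using cos_le_one[of t] by simp
    qed
    have dp: "\<bar>p u t - p u 0\<bar> \<le> 2 * t"
    proof -
      have "\<bar>p u t - p u 0\<bar> = \<bar>(u \<bullet> e) * (cos t - 1) - (u \<bullet> f) * sin t\<bar>" by (simp add: p_def algebra_simps)
      also have "\<dots> \<le> \<bar>u \<bullet> e\<bar> * \<bar>cos t - 1\<bar> + \<bar>u \<bullet> f\<bar> * \<bar>sin t\<bar>"
        by (metis abs_mult abs_triangle_ineq4)
      also have "\<dots> \<le> 1 * t + 1 * t" using ab trig t by (intro add_mono mult_mono) auto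
      finally show ?thesis by simp
    qed
    have dq: "\<bar>q u t - q u 0\<bar> \<le> 2 * t"
    proof -
      have "\<bar>q u t - q u 0\<bar> = \<bar>(u \<bullet> f) * (cos t - 1) + (u \<bullet> e) * sin t\<bar>" by (simp add: q_def algebra_simps)
      also have "\<dots> \<le> \<bar>u \<bullet> f\<bar> * \<bar>cos t - 1\<bar> + \<bar>u \<bullet> e\<bar> * \<bar>sin t\<bar>"
        by (metis abs_mult abs_triangle_ineq)
      also have "\<dots> \<le> 1 * t + 1 * t" using ab trig t by (intro add_mono mult_mono) auto
      finally show ?thesis by simp
    qed
    have dS: "\<bar>S u t - S u 0\<bar> \<le> 2 * t"
    proof -
      define r where "r = sqrt (\<sigma> u)"
      have r: "\<sigma> u = r\<^sup>2" using \<sigma>0 by (simp add: r_def)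
      have "\<bar>S u t - S u 0\<bar> \<le> \<bar>p u t - p u 0\<bar>"
      proof -
        have "S u t = norm (Complex r (p u t))" "S u 0 = norm (Complex r (p u 0))"
          by (simp_all add: S_def r complex_norm)
        then have "\<bar>S u t - S u 0\<bar> \<le> norm (Complex r (p u t) - Complex r (p u 0))"
          using norm_triangle_ineq3[of "Complex r (p u t)" "Complex r (p u 0)"] by simp
        then show ?thesis by (simp add: complex_norm complex_diff)
      qed
      with dp show ?thesis by simp
    qed
    define N where "N = p u t * q u t" define N0 where "N0 = p u 0 * q u 0"
    have dN: "\<bar>N - N0\<bar> \<le> 4 * t"
    proof -
      have "N - N0 = p u t * (q u t - q u 0) + (p u t - p u 0) * q u 0" by (simp add: N_def N0_def algebra_simps)
      then have "\<bar>N - N0\<bar> \<le> \<bar>p u t\<bar> * \<bar>q u t - q u 0\<bar> + \<bar>p u t - p u 0\<bar> * \<bar>q u 0\<bar>"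
        by (metis abs_mult abs_triangle_ineq)
      also have "\<dots> \<le> 1 * (2 * t) + (2 * t) * 1" using pq1 dp dq t by (intro add_mono mult_mono) auto
      finally show ?thesis by simp
    qed
    have N0: "\<bar>N0\<bar> \<le> 1" unfolding N0_def abs_mult using pq1[of 0] by (simp add: mult_le_one)
    have "g (R t u) - g u = (N - N0) / (1 + S u t) + N0 * ((S u 0 - S u t) / ((1 + S u t) * (1 + S u 0)))"
      using S0[of u t] S0[of u 0] unfolding gR g0[of u] N_def[symmetric] N0_def[symmetric]
      by (simp add: divide_simps add_nonneg_eq_0_iff) (simp add: algebra_simps)
    then have "\<bar>g (R t u) - g u\<bar> \<le> \<bar>N - N0\<bar> / (1 + S u t) + \<bar>N0\<bar> * (\<bar>S u t - S u 0\<bar> / ((1 + S u t) * (1 + S u 0)))"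
      using S0[of u t] S0[of u 0] abs_triangle_ineq[of "(N - N0) / (1 + S u t)" "N0 * ((S u 0 - S u t) / ((1 + S u t) * (1 + S u 0)))"]
      by (simp add: abs_mult abs_minus_commute)
    also have "\<dots> \<le> \<bar>N - N0\<bar> / 1 + 1 * (\<bar>S u t - S u 0\<bar> / 1)"
    proof (intro add_mono mult_mono divide_left_mono N0)
      have "1 * 1 \<le> (1 + S u t) * (1 + S u 0)" using S0[of u t] S0[of u 0] by (intro mult_mono) auto
      then show "1 \<le> (1 + S u t) * (1 + S u 0)" by simp
    qed (use S0[of u t] S0[of u 0] in auto)
    also have "\<dots> \<le> 6 * t" using dN dS by simp
    finally show ?thesis .
  qed
  define t where "t n = 1 / real (Suc n)" for n
  have t: "t n > 0" "t \<longlonglongrightarrow> 0" for n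
    unfolding t_def using LIMSEQ_inverse_real_of_nat by (auto simp: inverse_eq_divide)
  define F where "F n u = (g (R (t n) u) - g u) / t n" for n u
  have Rm: "R x \<in> borel_measurable borel" for x
    by (rule linear_borel_measurable[OF orthogonal_transformation_linear[OF orth]])
  have gRm: "(\<lambda>u. g (R x u)) \<in> borel_measurable sphere_measure" for x
    by (rule borel_measurable_sphere) (rule measurable_compose[OF Rm gm])
  have gS: "g \<in> borel_measurable sphere_measure" by (rule borel_measurable_sphere[OF gm])
  have gb: "\<bar>g u\<bar> \<le> 1" if "norm u = 1" for u
  proof -
    have "\<bar>u \<bullet> e\<bar> \<le> 1" "\<bar>u \<bullet> f\<bar> \<le> 1"
      using Cauchy_Schwarz_ineq2[of u e] Cauchy_Schwarz_ineq2[of u f] that e f by auto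
    then have "\<bar>(u \<bullet> e) * (u \<bullet> f)\<bar> \<le> 1" by (simp add: abs_mult mult_le_one)
    then show ?thesis using s0[of u] by (simp add: g_def abs_mult divide_le_eq)
  qed
  have gi: "integrable sphere_measure g"
    by (rule sphere.integrable_const_bound[where B=1]) (use gb gS in auto)
  have gRi: "integrable sphere_measure (\<lambda>u. g (R x u))" for x
    by (rule sphere.integrable_const_bound[where B=1])
       (use gb gRm orthogonal_transformation_norm[OF orth] in auto)
  have F0: "(\<integral>u. F n u \<partial>sphere_measure) = 0" for n
    unfolding F_def using integral_sphere_orthogonal[OF orth gS] gi gRi by simp
  \<comment> \<open>The square root in \<open>s\<close> is differentiable only where its argument is
    positive. Requiring \<open>u \<bullet> e \<noteq> 0\<close> ensures this and excludes a null
    set.\<close>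
  have lim: "(\<lambda>n. F n u) \<longlonglongrightarrow> D u" if "u \<bullet> e \<noteq> 0" for u
  proof -
    have pos: "\<sigma> u + (u \<bullet> e)\<^sup>2 > 0" using \<sigma>0[of u] that by (simp add: add_nonneg_pos)
    then have sp: "s u > 0" by (simp add: s\<sigma>)
    have ne: "1 + s u \<noteq> 0" using sp by simp
    have p0: "p u 0 = u \<bullet> e" "q u 0 = u \<bullet> f" by (simp_all add: p_def q_def)
    have dp: "(p u has_real_derivative - (u \<bullet> f)) (at 0)"
      unfolding p_def by (auto intro!: derivative_eq_intros)
    have dq: "(q u has_real_derivative (u \<bullet> e)) (at 0)"
      unfolding q_def by (auto intro!: derivative_eq_intros)
    have Sz: "S u 0 = s u" by (simp add: S_def s\<sigma> p0)
    have dS: "(S u has_real_derivative - ((u \<bullet> e) * (u \<bullet> f) / s u)) (at 0)"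
    proof -
      have base: "((\<lambda>x. \<sigma> u + (p u x)\<^sup>2) has_real_derivative 2 * (u \<bullet> e) * (- (u \<bullet> f))) (at 0)"
        by (rule DERIV_cong[OF DERIV_add[OF DERIV_const DERIV_power[OF dp, of 2]]]) (simp add: p0)
      have "((\<lambda>x. sqrt (\<sigma> u + (p u x)\<^sup>2)) has_real_derivative
          inverse (sqrt (\<sigma> u + (p u 0)\<^sup>2)) / 2 * (2 * (u \<bullet> e) * (- (u \<bullet> f)))) (at 0)"
        by (rule DERIV_chain2[OF DERIV_real_sqrt base]) (use pos p0 in simp)
      note DS = this
      have Seq: "S u = (\<lambda>x. sqrt (\<sigma> u + (p u x)\<^sup>2))" by (rule ext) (simp only: S_def)
      show ?thesis unfolding Seq
        by (rule DERIV_cong[OF DS]) (simp add: p0 s\<sigma> inverse_eq_divide)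
    qed
    have "((\<lambda>x. p u x * q u x / (1 + S u x)) has_real_derivative D u) (at 0)"
    proof (rule DERIV_cong[OF DERIV_divide[OF DERIV_mult[OF dp dq] DERIV_add[OF DERIV_const dS]]])
      have alg: "((- c * c + a * a) * m - a * c * (0 + - (a * c / r))) / (m * m)
          = (a\<^sup>2 - c\<^sup>2) / m + a\<^sup>2 * c\<^sup>2 / (r * m\<^sup>2)" if "m \<noteq> 0" "r \<noteq> 0" for a c m r :: real
        using that by (simp add: field_simps power2_eq_square)
      show "((- (u \<bullet> f) * q u 0 + (u \<bullet> e) * p u 0) * (1 + S u 0) - p u 0 * q u 0 * (0 + - ((u \<bullet> e) * (u \<bullet> f) / s u))) /
          ((1 + S u 0) * (1 + S u 0)) = D u"
        unfolding D_def p0 Sz using alg[of "1 + s u" "s u"] sp ne by simp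
    qed (use ne Sz in simp)
    then have "((\<lambda>h. (p u (0 + h) * q u (0 + h) / (1 + S u (0 + h)) - p u 0 * q u 0 / (1 + S u 0)) / h) \<longlongrightarrow> D u) (at 0)"
      unfolding has_field_derivative_def DERIV_def[symmetric] by (simp add: DERIV_def has_field_derivative_def[symmetric])
    then have "((\<lambda>h. (g (R h u) - g u) / h) \<longlongrightarrow> D u) (at 0)" by (simp add: gR g0[of u])
    moreover have "filterlim t (at 0) sequentially"
    proof (rule filterlim_atI[OF t(2)])
      have "t k \<noteq> 0" for k using t(1)[of k] by simp
      then show "\<forall>\<^sub>F k in sequentially. t k \<noteq> 0" by simp
    qed
    ultimately show ?thesis unfolding F_def by (rule filterlim_compose)
  qed
  have lim': "AE u in sphere_measure. (\<lambda>n. F n u) \<longlonglongrightarrow> D u"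
    using sphere_level_null[OF n e(1), of 0] by eventually_elim (rule lim)
  have bnd: "AE u in sphere_measure. norm (F n u) \<le> 6" for n
    by (rule AE_I2) (use lip t(1)[of n] in \<open>simp add: F_def abs_mult divide_le_eq\<close>)
  have Dm: "D \<in> borel_measurable sphere_measure"
    by (rule borel_measurable_sphere) (unfold D_def, measurable)
  have Fm: "F n \<in> borel_measurable sphere_measure" for n
    unfolding F_def using gS gRm by measurable
  show "integrable sphere_measure D"
    by (rule integrable_dominated_convergence[OF Dm Fm _ lim' bnd]) simp
  have "(\<lambda>n. \<integral>u. F n u \<partial>sphere_measure) \<longlonglongrightarrow> (\<integral>u. D u \<partial>sphere_measure)"
    by (rule integral_dominated_convergence[OF Dm Fm _ lim' bnd]) simp
  then show "(\<integral>u. D u \<partial>sphere_measure) = 0" using F0 by (simp add: LIMSEQ_const_iff)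
qed

text \<open>This is the origin of the constant d in the lower bound. With k = d - 1 the derivatives
  \<open>D b z + D b e\<close> add up over \<open>W\<close> to s - k (1 - s). Each has integral
  zero, hence the mean of s is k / (k + 1), without any explicit density of s.\<close>

lemma integral_projection_codim2:
  fixes z e :: "'a::euclidean_space"
  assumes d: "DIM('a) = d + 1" "d \<ge> 1" and ze: "norm z = 1" "norm e = 1" "z \<bullet> e = 0"
  shows "(\<integral>u. 1 - sqrt (1 - (u \<bullet> z)\<^sup>2 - (u \<bullet> e)\<^sup>2) \<partial>sphere_measure) = 1 / d"
proof -
  obtain W where W: "finite W" "card W + 2 = DIM('a)" "\<And>b. b \<in> W \<Longrightarrow> norm b = 1 \<and> b \<bullet> z = 0 \<and> b \<bullet> e = 0"
    "pairwise orthogonal W" "\<And>x. (\<Sum>b\<in>W. (x \<bullet> b)\<^sup>2) + (x \<bullet> z)\<^sup>2 + (x \<bullet> e)\<^sup>2 = x \<bullet> x"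
    using orthonormal_complement_basis[OF ze] by metis
  define k where "k = real (card W)"
  have k: "k + 1 = real d" using W(2) d by (simp add: k_def)
  define s where "s u = sqrt (\<Sum>b\<in>W. (u \<bullet> b)\<^sup>2)" for u
  have s0: "s u \<ge> 0" for u by (simp add: s_def sum_nonneg)
  have s2: "(s u)\<^sup>2 = (\<Sum>b\<in>W. (u \<bullet> b)\<^sup>2)" for u by (simp add: s_def sum_nonneg)
  have sW: "(u \<bullet> z)\<^sup>2 + (u \<bullet> e)\<^sup>2 = 1 - (s u)\<^sup>2" if "norm u = 1" for u
    using W(5)[of u] that by (simp add: s2 norm_eq_1)
  have ss: "sqrt (1 - (u \<bullet> z)\<^sup>2 - (u \<bullet> e)\<^sup>2) = s u" if "norm u = 1" for u
    using sW[OF that] s0[of u] by (metis add_diff_cancel_left' diff_diff_add diff_diff_eq2 real_sqrt_unique diff_add_cancel add.commute)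
  define D where "D b f u = ((u \<bullet> b)\<^sup>2 - (u \<bullet> f)\<^sup>2) / (1 + s u) + (u \<bullet> b)\<^sup>2 * (u \<bullet> f)\<^sup>2 / (s u * (1 + s u)\<^sup>2)" for b f u
  have n2: "DIM('a) \<ge> 2" using d by simp
  have D: "integrable sphere_measure (D b f)" "(\<integral>u. D b f u \<partial>sphere_measure) = 0" if "b \<in> W" "f \<in> {z, e}" for b f
    unfolding D_def s_def
    by (rule rotation_derivative_integral[OF n2 W(1) that(1) _ W(4)]; use W(3) ze that in auto)+
  have sumD: "(\<Sum>b\<in>W. D b z u + D b e u) = s u - k * (1 - s u)" if "norm u = 1" for u
  proof -
    have ne: "1 + s u > 0" using s0[of u] by simp
    have "(\<Sum>b\<in>W. D b z u + D b e u) =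
      (\<Sum>b\<in>W. (2 / (1 + s u)) * (u \<bullet> b)\<^sup>2 - (1 - (s u)\<^sup>2) / (1 + s u) + (1 - (s u)\<^sup>2) / (s u * (1 + s u)\<^sup>2) * (u \<bullet> b)\<^sup>2)"
      unfolding D_def sW[OF that, symmetric]
      by (rule sum.cong[OF refl]) (simp add: add_divide_distrib diff_divide_distrib distrib_left mult.commute)
    also have "\<dots> = (2 / (1 + s u)) * (s u)\<^sup>2 - k * ((1 - (s u)\<^sup>2) / (1 + s u)) + (1 - (s u)\<^sup>2) / (s u * (1 + s u)\<^sup>2) * (s u)\<^sup>2"
      unfolding s2 by (simp add: sum.distrib sum_subtractf sum_distrib_left k_def)
    also have "1 - (s u)\<^sup>2 = (1 - s u) * (1 + s u)" by (simp add: power2_eq_square algebra_simps)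
    also have "(1 - s u) * (1 + s u) / (1 + s u) = 1 - s u" using ne by simp
    also have "(1 - s u) * (1 + s u) / (s u * (1 + s u)\<^sup>2) * (s u)\<^sup>2 = (1 - s u) * s u / (1 + s u)"
    proof -
      \<comment> \<open>For r = 0 the quotient is 0 by the convention on division and both sides
        vanish. So the identity also covers points with \<open>s u = 0\<close>, which on the circle
        are all points.\<close>
      have "b * a / (r * a\<^sup>2) * r\<^sup>2 = b * r / a" if "a \<noteq> 0" for a b r :: real
        using that by (cases "r = 0") (auto simp: power2_eq_square)
      from this[of "1 + s u"] ne show ?thesis by simp
    qed
    also have "2 / (1 + s u) * (s u)\<^sup>2 - k * (1 - s u) + (1 - s u) * s u / (1 + s u) = s u - k * (1 - s u)"
    proof -
      have "2 / (1 + s u) * (s u)\<^sup>2 + (1 - s u) * s u / (1 + s u) = (2 * (s u)\<^sup>2 + (1 - s u) * s u) / (1 + s u)"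
        by (simp add: add_divide_distrib)
      also have "2 * (s u)\<^sup>2 + (1 - s u) * s u = s u * (1 + s u)" by (simp add: algebra_simps power2_eq_square)
      finally show ?thesis using ne by simp
    qed
    finally show ?thesis .
  qed
  have sm: "s \<in> borel_measurable sphere_measure"
    by (rule borel_measurable_sphere) (unfold s_def, measurable)
  have s1: "s u \<le> 1" if "norm u = 1" for u
  proof -
    have "(s u)\<^sup>2 \<le> 1" using sW[OF that] by (metis add_nonneg_nonneg diff_ge_0_iff_ge zero_le_power2)
    then show ?thesis using s0 by (simp add: power2_le_iff_abs_le abs_le_iff power_le_one_iff)
  qed
  have si: "integrable sphere_measure s"
    by (rule sphere.integrable_const_bound[where B=1]) (use sm s0 s1 in auto)
  have "0 = (\<integral>u. (\<Sum>b\<in>W. D b z u + D b e u) \<partial>sphere_measure)"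
    using D by (subst Bochner_Integration.integral_sum) auto
  also have "\<dots> = (\<integral>u. s u - k * (1 - s u) \<partial>sphere_measure)"
    by (rule Bochner_Integration.integral_cong) (auto simp: sumD)
  also have "\<dots> = (k + 1) * (\<integral>u. s u \<partial>sphere_measure) - k"
    using si sphere.prob_space[where ?'a='a] by (simp add: algebra_simps)
  finally have Es: "(\<integral>u. s u \<partial>sphere_measure) = k / (k + 1)" by (simp add: k_def field_simps)
  have "(\<integral>u. 1 - sqrt (1 - (u \<bullet> z)\<^sup>2 - (u \<bullet> e)\<^sup>2) \<partial>sphere_measure) = (\<integral>u. 1 - s u \<partial>sphere_measure)"
    by (rule Bochner_Integration.integral_cong) (auto simp: ss)
  also have "\<dots> = 1 - (\<integral>u. s u \<partial>sphere_measure)"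
    using si sphere.prob_space[where ?'a='a] by simp
  also have "\<dots> = 1 / (k + 1)" unfolding Es by (simp add: k_def field_simps)
  finally show ?thesis unfolding k .
qed

section \<open>Averaging over the rotations of a plane through the pole\<close>

lemma nn_integral_plane_average:
  fixes e f :: "'a::euclidean_space" and h :: "'a \<Rightarrow> ennreal"
  assumes ef: "norm e = 1" "norm f = 1" "e \<bullet> f = 0" and h[measurable]: "h \<in> borel_measurable borel"
  shows "ennreal pi * (\<integral>\<^sup>+u. h u \<partial>sphere_measure) =
    (\<integral>\<^sup>+u. (\<integral>\<^sup>+t. indicator {0..<pi} t * h (plane_rotation e f t u) \<partial>lborel) \<partial>sphere_measure)"
proof -
  interpret SL: pair_sigma_finite "lborel :: real measure" "sphere_measure :: 'a measure" ..
  have id: "(\<lambda>x. x) \<in> (sphere_measure :: 'a measure) \<rightarrow>\<^sub>M borel"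
    by (rule borel_measurable_sphere) simp
  have [measurable]: "snd \<in> lborel \<Otimes>\<^sub>M (sphere_measure :: 'a measure) \<rightarrow>\<^sub>M borel"
    using measurable_compose[OF measurable_snd id] by fast
  have [measurable]: "fst \<in> lborel \<Otimes>\<^sub>M (sphere_measure :: 'a measure) \<rightarrow>\<^sub>M (borel :: real measure)"
    using measurable_compose[OF measurable_fst, of "\<lambda>x. x" lborel borel] by fastforce
  have m: "(\<lambda>(t, u). indicator {0..<pi} t * h (plane_rotation e f t u)) \<in> borel_measurable (lborel \<Otimes>\<^sub>M sphere_measure)"
    unfolding plane_rotation_def case_prod_beta by measurable
  have "(\<integral>\<^sup>+u. (\<integral>\<^sup>+t. indicator {0..<pi} t * h (plane_rotation e f t u) \<partial>lborel) \<partial>sphere_measure) =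
     (\<integral>\<^sup>+t. (\<integral>\<^sup>+u. indicator {0..<pi} t * h (plane_rotation e f t u) \<partial>sphere_measure) \<partial>lborel)"
    by (rule SL.Fubini'[OF m])
  also have "\<dots> = (\<integral>\<^sup>+t. (\<integral>\<^sup>+u. h u \<partial>sphere_measure) * indicator {0..<pi} t \<partial>lborel)"
  proof (rule nn_integral_cong)
    fix t :: real
    have "(\<integral>\<^sup>+u. h (plane_rotation e f t u) \<partial>sphere_measure) = (\<integral>\<^sup>+u. h u \<partial>sphere_measure)"
      by (rule nn_integral_sphere_orthogonal[OF orthogonal_transformation_plane_rotation[OF ef] borel_measurable_sphere[OF h]])
    then show "(\<integral>\<^sup>+u. indicator {0..<pi} t * h (plane_rotation e f t u) \<partial>sphere_measure) =
        (\<integral>\<^sup>+u. h u \<partial>sphere_measure) * indicator {0..<pi} t"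
      by (cases "t \<in> {0..<pi}") auto
  qed
  also have "\<dots> = ennreal pi * (\<integral>\<^sup>+u. h u \<partial>sphere_measure)"
    by (simp add: nn_integral_cmult_indicator mult.commute)
  finally show ?thesis by simp
qed

lemma nn_integral_periodic:
  fixes G :: "real \<Rightarrow> ennreal"
  assumes [measurable]: "G \<in> borel_measurable borel" and T: "T > 0"
    and per: "\<And>k t. G (t + of_int k * T) = G t"
  shows "(\<integral>\<^sup>+t. indicator {a..<a + T} t * G t \<partial>lborel) = (\<integral>\<^sup>+t. indicator {0..<T} t * G t \<partial>lborel)"
proof -
  define k where "k = \<lceil>a / T\<rceil>"
  define b where "b = of_int k * T"
  define c where "c = a - (b - T)"
  have "of_int k - 1 < a / T" "a / T \<le> of_int k" unfolding k_def by linarith+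
  then have ab: "b - T < a" "a \<le> b" unfolding b_def using T by (auto simp: field_simps)
  have sh: "(\<integral>\<^sup>+t. indicator {x..<y} t * G t \<partial>lborel) = (\<integral>\<^sup>+t. indicator {x - of_int j * T..<y - of_int j * T} t * G t \<partial>lborel)" for x y and j :: int
  proof -
    have "(\<integral>\<^sup>+t. indicator {x..<y} t * G t \<partial>lborel) = (\<integral>\<^sup>+t. indicator {x..<y} (of_int j * T + t) * G (of_int j * T + t) \<partial>lborel)"
      by (rule nn_integral_lborel_translate[symmetric]) measurable
    also have "\<dots> = (\<integral>\<^sup>+t. indicator {x - of_int j * T..<y - of_int j * T} t * G t \<partial>lborel)"
      by (intro nn_integral_cong) (auto simp: indicator_def per add.commute)
    finally show ?thesis .
  qed
  have add: "(\<integral>\<^sup>+t. indicator {x..<y} t * G t \<partial>lborel) + (\<integral>\<^sup>+t. indicator {y..<w} t * G t \<partial>lborel) =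
      (\<integral>\<^sup>+t. indicator {x..<w} t * G t \<partial>lborel)" if "x \<le> y" "y \<le> w" for x y w
    by (subst nn_integral_add[symmetric]) (use that in \<open>auto intro!: nn_integral_cong simp: indicator_def\<close>)
  have "(\<integral>\<^sup>+t. indicator {a..<a + T} t * G t \<partial>lborel) =
      (\<integral>\<^sup>+t. indicator {a..<b} t * G t \<partial>lborel) + (\<integral>\<^sup>+t. indicator {b..<a + T} t * G t \<partial>lborel)"
    by (rule add[symmetric]) (use ab in auto)
  also have "(\<integral>\<^sup>+t. indicator {a..<b} t * G t \<partial>lborel) = (\<integral>\<^sup>+t. indicator {c..<T} t * G t \<partial>lborel)"
    by (subst sh[of _ _ "k - 1"]) (simp add: c_def b_def algebra_simps)
  also have "(\<integral>\<^sup>+t. indicator {b..<a + T} t * G t \<partial>lborel) = (\<integral>\<^sup>+t. indicator {0..<c} t * G t \<partial>lborel)"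
    by (subst sh[of _ _ k]) (simp add: c_def b_def algebra_simps)
  also have "(\<integral>\<^sup>+t. indicator {c..<T} t * G t \<partial>lborel) + (\<integral>\<^sup>+t. indicator {0..<c} t * G t \<partial>lborel) =
      (\<integral>\<^sup>+t. indicator {0..<T} t * G t \<partial>lborel)"
    by (subst add.commute, rule add) (use ab in \<open>auto simp: c_def\<close>)
  finally show ?thesis .
qed

text \<open>The doubled angle runs through a full period while t runs through half a turn, and
  periodicity absorbs the phase b. The minus sign puts the smallest value at g = 0, so that small
  |g| will describe reflections that move the normal.\<close>

lemma nn_integral_cos_shift:
  fixes F :: "real \<Rightarrow> ennreal"
  assumes F[measurable]: "F \<in> borel_measurable borel"
  shows "2 * (\<integral>\<^sup>+t. indicator {0..<pi} t * F (cos (2 * t + b)) \<partial>lborel) =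
    (\<integral>\<^sup>+g. indicator {-pi..<pi} g * F (- cos g) \<partial>lborel)"
proof -
  have [measurable]: "(\<lambda>g. F (- cos g)) \<in> borel_measurable borel"
    by (rule measurable_compose[OF _ F]) (intro borel_measurable_continuous_onI continuous_intros)
  have meas: "(\<lambda>g. indicator {-pi..<pi} g * F (- cos g)) \<in> borel_measurable borel" by measurable
  have "(\<integral>\<^sup>+g. indicator {-pi..<pi} g * F (- cos g) \<partial>lborel) =
    ennreal \<bar>2\<bar> * (\<integral>\<^sup>+t. indicator {-pi..<pi} ((b - pi) + 2 * t) * F (- cos ((b - pi) + 2 * t)) \<partial>lborel)"
    by (rule nn_integral_real_affine[OF meas]) simp
  also have "(\<integral>\<^sup>+t. indicator {-pi..<pi} ((b - pi) + 2 * t) * F (- cos ((b - pi) + 2 * t)) \<partial>lborel) =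
    (\<integral>\<^sup>+t. indicator {- b / 2..<- b / 2 + pi} t * F (cos (2 * t + b)) \<partial>lborel)"
  proof (rule nn_integral_cong)
    fix t :: real
    have "cos ((b - pi) + 2 * t) = - cos (2 * t + b)"
      using cos_minus_pi[of "2 * t + b"] by (simp add: algebra_simps)
    then show "indicator {-pi..<pi} ((b - pi) + 2 * t) * F (- cos ((b - pi) + 2 * t)) =
       indicator {- b / 2..<- b / 2 + pi} t * F (cos (2 * t + b))"
      by (auto simp: indicator_def)
  qed
  also have "\<dots> = (\<integral>\<^sup>+t. indicator {0..<pi} t * F (cos (2 * t + b)) \<partial>lborel)"
  proof (rule nn_integral_periodic)
    fix k :: int and t :: real
    have "2 * (t + of_int k * pi) + b = (2 * t + b) + (2 * pi) * of_int k" by (simp add: algebra_simps)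
    then show "F (cos (2 * (t + of_int k * pi) + b)) = F (cos (2 * t + b))"
      by (simp only: cos_add cos_int_2pin sin_int_2pin) simp
  qed simp_all
  finally show ?thesis by simp
qed

text \<open>A rotation by t adds t to the polar angle of u in the plane, and a product of two
  cosines is half the sum of cosines of the difference and the sum of the angles. Thus, given the
  squared length r^2 of the projection of u to the plane, the product is distributed as r^2 / 2
  times cos \<theta> - cos g with g uniform; the factor 2 \<pi> is the length of the range of
  g.\<close>

lemma nn_integral_sphere_plane:
  fixes z e :: "'a::euclidean_space" and F :: "real \<Rightarrow> ennreal"
  assumes ze: "norm z = 1" "norm e = 1" "z \<bullet> e = 0" and F[measurable]: "F \<in> borel_measurable borel"
    and v: "v = cos \<theta> *\<^sub>R z + sin \<theta> *\<^sub>R e"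
  shows "2 * (ennreal pi * (\<integral>\<^sup>+u. F ((u \<bullet> v) * (u \<bullet> z)) \<partial>sphere_measure)) =
    (\<integral>\<^sup>+u. (\<integral>\<^sup>+g. indicator {-pi..<pi} g * F (((u \<bullet> z)\<^sup>2 + (u \<bullet> e)\<^sup>2) / 2 * (cos \<theta> - cos g)) \<partial>lborel) \<partial>sphere_measure)"
proof -
  have eq: "2 * (\<integral>\<^sup>+t. indicator {0..<pi} t * F ((plane_rotation z e t u \<bullet> v) * (plane_rotation z e t u \<bullet> z)) \<partial>lborel) =
     (\<integral>\<^sup>+g. indicator {-pi..<pi} g * F (((u \<bullet> z)\<^sup>2 + (u \<bullet> e)\<^sup>2) / 2 * (cos \<theta> - cos g)) \<partial>lborel)" for u :: 'a
  proof -
    obtain r a where ra: "u \<bullet> z = r * cos a" "u \<bullet> e = r * sin a" using polar_Ex by blast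
    have r2: "(u \<bullet> z)\<^sup>2 + (u \<bullet> e)\<^sup>2 = r\<^sup>2"
    proof -
      have "(u \<bullet> z)\<^sup>2 + (u \<bullet> e)\<^sup>2 = r\<^sup>2 * ((cos a)\<^sup>2 + (sin a)\<^sup>2)" unfolding ra by (simp only: power_mult_distrib distrib_left)
      then show ?thesis by simp
    qed
    have prod: "(plane_rotation z e t u \<bullet> v) * (plane_rotation z e t u \<bullet> z) = r\<^sup>2 / 2 * (cos \<theta> + cos (2 * t + (2 * a - \<theta>)))" for t
    proof -
      have 1: "plane_rotation z e t u \<bullet> z = r * cos (a + t)" "plane_rotation z e t u \<bullet> e = r * sin (a + t)"
        by (simp_all add: plane_rotation_inner[OF ze] ra cos_add sin_add algebra_simps)
      have "plane_rotation z e t u \<bullet> v = r * cos (a + t - \<theta>)"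
        unfolding v inner_add_right inner_scaleR_right 1 by (simp add: cos_diff algebra_simps)
      then have "(plane_rotation z e t u \<bullet> v) * (plane_rotation z e t u \<bullet> z) = r\<^sup>2 * (cos (a + t - \<theta>) * cos (a + t))"
        unfolding 1 by (simp add: power2_eq_square)
      also have "cos (a + t - \<theta>) * cos (a + t) = (cos \<theta> + cos (2 * t + (2 * a - \<theta>))) / 2"
        unfolding cos_times_cos by (simp add: algebra_simps)
      finally show ?thesis by simp
    qed
    show ?thesis
      unfolding prod r2 using nn_integral_cos_shift[of "\<lambda>x. F (r\<^sup>2 / 2 * (cos \<theta> + x))" "2 * a - \<theta>"] by simp
  qed
  have "ennreal pi * (\<integral>\<^sup>+u. F ((u \<bullet> v) * (u \<bullet> z)) \<partial>sphere_measure) =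
    (\<integral>\<^sup>+u. (\<integral>\<^sup>+t. indicator {0..<pi} t * F ((plane_rotation z e t u \<bullet> v) * (plane_rotation z e t u \<bullet> z)) \<partial>lborel) \<partial>sphere_measure)"
    by (rule nn_integral_plane_average[OF ze]) measurable
  then have "2 * (ennreal pi * (\<integral>\<^sup>+u. F ((u \<bullet> v) * (u \<bullet> z)) \<partial>sphere_measure)) =
    2 * (\<integral>\<^sup>+u. (\<integral>\<^sup>+t. indicator {0..<pi} t * F ((plane_rotation z e t u \<bullet> v) * (plane_rotation z e t u \<bullet> z)) \<partial>lborel) \<partial>sphere_measure)"
    by simp
  also have "\<dots> = (\<integral>\<^sup>+u. 2 * (\<integral>\<^sup>+t. indicator {0..<pi} t * F ((plane_rotation z e t u \<bullet> v) * (plane_rotation z e t u \<bullet> z)) \<partial>lborel) \<partial>sphere_measure)"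
  proof (rule nn_integral_cmult[symmetric], rule borel_measurable_sphere, rule lborel.borel_measurable_nn_integral)
    show "(\<lambda>(u, t). indicator {0..<pi} t * F ((plane_rotation z e t u \<bullet> v) * (plane_rotation z e t u \<bullet> z))) \<in> borel_measurable (borel \<Otimes>\<^sub>M lborel)"
      unfolding plane_rotation_def by measurable
  qed
  also have "\<dots> = (\<integral>\<^sup>+u. (\<integral>\<^sup>+g. indicator {-pi..<pi} g * F (((u \<bullet> z)\<^sup>2 + (u \<bullet> e)\<^sup>2) / 2 * (cos \<theta> - cos g)) \<partial>lborel) \<partial>sphere_measure)"
    unfolding eq ..
  finally show ?thesis .
qed

section \<open>Elementary estimates for the mean drop of the logarithm\<close>

lemma sin_scale_ge:
  fixes l x :: real
  assumes l: "0 \<le> l" "l \<le> 1" and x: "0 \<le> x" "x \<le> pi"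
  shows "l * sin x \<le> sin (l * x)"
proof -
  have "convex_on {0..pi} (\<lambda>x. - sin x)"
    by (rule f''_ge0_imp_convex[where f'="\<lambda>x. - cos x" and f''=sin])
       (auto intro!: derivative_eq_intros sin_ge_zero)
  from convex_onD[OF this l(1) l(2), of 0 x] x show ?thesis by simp
qed

text \<open>Concavity of the sine at half angles. The bound is an equality at g = 0 and |g| =
  \<theta>, and it replaces the cosine by a quadratic in g, whose logarithm has an elementary
  antiderivative.\<close>

lemma one_minus_cos_scale_ge:
  fixes g \<theta> :: real
  assumes "0 < \<theta>" "\<theta> \<le> pi" "\<bar>g\<bar> \<le> \<theta>"
  shows "(1 - cos \<theta>) * (g / \<theta>)\<^sup>2 \<le> 1 - cos g"
proof -
  define l where "l = \<bar>g\<bar> / \<theta>"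
  have l: "0 \<le> l" "l \<le> 1" using assms by (auto simp: l_def)
  have "l * sin (\<theta> / 2) \<le> sin (l * (\<theta> / 2))" using assms l by (intro sin_scale_ge) auto
  moreover have "0 \<le> l * sin (\<theta> / 2)" using assms l by (intro mult_nonneg_nonneg sin_ge_zero) auto
  ultimately have "(l * sin (\<theta> / 2))\<^sup>2 \<le> (sin (l * (\<theta> / 2)))\<^sup>2" by (rule power_mono)
  moreover have half: "1 - cos x = 2 * (sin (x / 2))\<^sup>2" for x :: real using cos_double_sin[of "x / 2"] by simp
  have "l * (\<theta> / 2) = \<bar>g\<bar> / 2" using assms by (simp add: l_def)
  moreover have "1 - cos g = 2 * (sin (\<bar>g\<bar> / 2))\<^sup>2" using half[of "\<bar>g\<bar>"] by (simp only: cos_abs_real)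
  moreover have "(1 - cos \<theta>) * (g / \<theta>)\<^sup>2 = 2 * (l * sin (\<theta> / 2))\<^sup>2"
    unfolding half by (simp add: l_def power_divide power_mult_distrib)
  ultimately show ?thesis by simp
qed

text \<open>The integral equals \<open>2 \<theta> (1 - \<psi> cot \<psi>)\<close> with \<open>s = cos \<psi>\<close>, and \<open>sin \<psi> \<le> \<psi>\<close>.\<close>

lemma nn_integral_log_quadratic_le:
  fixes s \<theta> :: real
  assumes s: "0 < s" "s \<le> 1" and \<theta>: "0 < \<theta>"
  shows "(\<integral>\<^sup>+g. ennreal (- ln (s\<^sup>2 + (1 - s\<^sup>2) * (g / \<theta>)\<^sup>2) / 2) * indicator {-\<theta>..\<theta>} g \<partial>lborel) \<le> ennreal (2 * \<theta> * (1 - s))"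
proof (cases "s = 1")
  case True
  then show ?thesis by simp
next
  case False
  define c where "c = sqrt (1 - s\<^sup>2)"
  have s1: "s\<^sup>2 < 1" using s False by (simp add: power_less_one_iff)
  then have c: "c > 0" "c\<^sup>2 = 1 - s\<^sup>2" by (simp_all add: c_def)
  \<comment> \<open>An antiderivative of
    \<open>- ln (s\<^sup>2 + c\<^sup>2 * \<tau>\<^sup>2) / 2\<close> found by parts. It divides by
    \<open>c\<close>, hence the separate case \<open>s = 1\<close>.\<close>
  define K where "K \<tau> = - \<tau> * ln (s\<^sup>2 + c\<^sup>2 * \<tau>\<^sup>2) / 2 + \<tau> - (s / c) * arctan (c / s * \<tau>)" for \<tau>
  have pos: "s\<^sup>2 + c\<^sup>2 * \<tau>\<^sup>2 > 0" for \<tau> using s by (simp add: add_pos_nonneg)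
  have dK: "(K has_real_derivative - ln (s\<^sup>2 + c\<^sup>2 * \<tau>\<^sup>2) / 2) (at \<tau>)" for \<tau>
  proof -
    define Q where "Q = s\<^sup>2 + c\<^sup>2 * \<tau>\<^sup>2"
    have Q: "Q > 0" using pos by (simp add: Q_def)
    have dQ: "((\<lambda>x. s\<^sup>2 + c\<^sup>2 * x\<^sup>2) has_real_derivative c\<^sup>2 * (2 * \<tau>)) (at \<tau>)"
      by (auto intro!: derivative_eq_intros)
    have dln: "((\<lambda>x. ln (s\<^sup>2 + c\<^sup>2 * x\<^sup>2)) has_real_derivative 1 / Q * (c\<^sup>2 * (2 * \<tau>))) (at \<tau>)"
      unfolding Q_def by (rule DERIV_chain2[OF DERIV_ln_divide[OF pos] dQ])
    have darc: "((\<lambda>x. arctan (c / s * x)) has_real_derivative inverse (1 + (c / s * \<tau>)\<^sup>2) * (c / s)) (at \<tau>)"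
      by (rule DERIV_chain2[OF DERIV_arctan]) (use s in \<open>auto intro!: derivative_eq_intros\<close>)
    note dK = DERIV_diff[OF DERIV_add[OF DERIV_cdivide[OF DERIV_mult[OF DERIV_minus[OF DERIV_ident] dln], of 2] DERIV_ident]
        DERIV_cmult[OF darc, of "s / c"]]
    have "1 + (c / s * \<tau>)\<^sup>2 = Q / s\<^sup>2" using s by (simp add: Q_def field_simps power2_eq_square)
    then have A: "s / c * (inverse (1 + (c / s * \<tau>)\<^sup>2) * (c / s)) = s\<^sup>2 / Q"
      using s c(1) by (simp add: power2_eq_square)
    have B: "(1 / Q * (c\<^sup>2 * (2 * \<tau>))) * (- \<tau>) = - 2 * (c\<^sup>2 * \<tau>\<^sup>2 / Q)" by (simp add: power2_eq_square)
    have C: "c\<^sup>2 * \<tau>\<^sup>2 / Q + s\<^sup>2 / Q = 1"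
      using Q by (simp add: Q_def add_divide_distrib[symmetric] add.commute)
    have "(- 1 * L + - 2 * X) / 2 + 1 - Y = - L / 2" if "X + Y = 1" for L X Y :: real
      using that by (simp add: field_simps)
    from this[OF C] show ?thesis unfolding K_def
      by (intro DERIV_cong[OF dK]) (simp only: A B)
  qed
  define H where "H g = \<theta> * K (g / \<theta>)" for g
  have "(\<integral>\<^sup>+g. ennreal (- ln (s\<^sup>2 + (1 - s\<^sup>2) * (g / \<theta>)\<^sup>2) / 2) * indicator {-\<theta>..\<theta>} g \<partial>lborel) = ennreal (H \<theta> - H (-\<theta>))"
  proof (rule nn_integral_FTC_Icc)
    show "(\<lambda>g. - ln (s\<^sup>2 + (1 - s\<^sup>2) * (g / \<theta>)\<^sup>2) / 2) \<in> borel_measurable borel" by measurable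
    fix g assume g: "g \<in> {-\<theta>..\<theta>}"
    have "((\<lambda>g. K (g / \<theta>)) has_real_derivative - ln (s\<^sup>2 + c\<^sup>2 * (g / \<theta>)\<^sup>2) / 2 * (1 / \<theta>)) (at g)"
      by (rule DERIV_chain2[OF dK]) (use \<theta> in \<open>auto intro!: derivative_eq_intros\<close>)
    from DERIV_cmult[OF this, of \<theta>] show "(H has_real_derivative - ln (s\<^sup>2 + (1 - s\<^sup>2) * (g / \<theta>)\<^sup>2) / 2) (at g)"
      unfolding H_def c(2) using \<theta> by simp
    have "\<bar>g / \<theta>\<bar> \<le> 1" using g \<theta> by (auto simp: abs_le_iff field_simps)
    then have "(g / \<theta>)\<^sup>2 \<le> 1" by (simp add: abs_square_le_1)
    then have "(1 - s\<^sup>2) * (g / \<theta>)\<^sup>2 \<le> 1 - s\<^sup>2" using s1 by (simp add: mult_left_le)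
    then have "ln (s\<^sup>2 + (1 - s\<^sup>2) * (g / \<theta>)\<^sup>2) \<le> 0"
      using pos[of "g / \<theta>"] unfolding c(2) by simp
    then show "0 \<le> - ln (s\<^sup>2 + (1 - s\<^sup>2) * (g / \<theta>)\<^sup>2) / 2" by simp
  qed (use \<theta> in simp)
  also have "H \<theta> - H (-\<theta>) = 2 * \<theta> * (1 - (s / c) * arctan (c / s))"
    using \<theta> c(2) by (simp add: H_def K_def arctan_minus algebra_simps)
  also have "ennreal \<dots> \<le> ennreal (2 * \<theta> * (1 - s))"
  proof -
    have "sin (arctan (c / s)) \<le> arctan (c / s)" using s c by (intro sin_x_le_x) simp
    moreover have "sin (arctan (c / s)) = c"
    proof -
      have "1 + (c / s)\<^sup>2 = (1 / s)\<^sup>2" using s c(2) by (simp add: field_simps power_divide)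
      then have "sqrt (1 + (c / s)\<^sup>2) = 1 / s" using s by simp
      then show ?thesis using s by (simp add: sin_arctan)
    qed
    ultimately have "c \<le> arctan (c / s)" by simp
    then have "(s / c) * c \<le> (s / c) * arctan (c / s)" using s c by (intro mult_left_mono) auto
    then have "s \<le> (s / c) * arctan (c / s)" using c by simp
    then show ?thesis using \<theta> by (intro ennreal_leI) simp
  qed
  finally show ?thesis .
qed

section \<open>Polarization of hemispheres\<close>

definition hemisphere :: "'a::euclidean_space \<Rightarrow> 'a set" where
  "hemisphere v = {x \<in> sphere 0 1. 0 \<le> x \<bullet> v}"

lemma hemisphere_sets: "hemisphere v \<in> sets sphere_measure"
  unfolding hemisphere_def by (rule sphere_halfspace_sets)

text \<open>Polarization of a single point: \<open>v\<close> crosses the mirror exactly when the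
  mirror separates it from the pole.\<close>

definition polarized_normal :: "'a::euclidean_space \<Rightarrow> 'a \<Rightarrow> 'a \<Rightarrow> 'a" where
  "polarized_normal z u v = (if (u \<bullet> v) * (u \<bullet> z) < 0 then reflection u v else v)"

lemma norm_polarized_normal: "norm u = 1 \<Longrightarrow> norm (polarized_normal z u v) = norm v"
  by (simp add: polarized_normal_def norm_reflection)

lemma polarized_normal_inner:
  "polarized_normal z u v \<bullet> z = v \<bullet> z - 2 * min 0 ((u \<bullet> v) * (u \<bullet> z))"
  by (auto simp: polarized_normal_def reflection_def inner_diff_left min_def)

text \<open>The numbers \<open>x \<bullet> v\<close> and \<open>reflection u x \<bullet> v\<close>
  differ by twice the product of \<open>u \<bullet> x\<close> and \<open>u \<bullet> v\<close>,
  whose sign depends only on the sides of the mirror on which x and v lie. So one of the two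
  half-space conditions implies the other, and their disjunction or conjunction collapses to the
  condition for one normal.\<close>

lemma polarization_dir_hemisphere:
  fixes z :: "'a::euclidean_space"
  assumes u: "norm u = 1" and z: "norm z = 1"
  shows "polarization_dir z u (hemisphere v) = hemisphere (polarized_normal z u v)"
proof (rule set_eqI)
  fix x :: 'a
  have H: "hemisphere v \<subseteq> sphere 0 1" by (auto simp: hemisphere_def)
  have refl: "reflection u x \<bullet> v = x \<bullet> v - 2 * ((u \<bullet> x) * (u \<bullet> v))"
    "x \<bullet> reflection u v = x \<bullet> v - 2 * ((u \<bullet> x) * (u \<bullet> v))"
    by (simp_all add: reflection_def inner_diff_left inner_diff_right inner_commute[of x u] mult_ac)
  define p q r where "p = u \<bullet> z" and "q = u \<bullet> v" and "r = u \<bullet> x"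
  have pos: "r * q \<ge> 0" if "r * p \<ge> 0" "q * p \<ge> 0" "p \<noteq> 0"
    using that by (auto simp: zero_le_mult_iff)
  have neg: "r * q \<le> 0" if "r * p \<ge> 0" "q * p < 0"
    using that by (auto simp: zero_le_mult_iff mult_less_0_iff mult_le_0_iff)
  have neg': "r * q \<le> 0" if "r * p < 0" "q * p \<ge> 0"
    using that by (auto simp: zero_le_mult_iff mult_less_0_iff mult_le_0_iff)
  have pos': "r * q \<ge> 0" if "r * p < 0" "q * p < 0"
    using that by (auto simp: zero_le_mult_iff mult_less_0_iff mult_le_0_iff)
  show "x \<in> polarization_dir z u (hemisphere v) \<longleftrightarrow> x \<in> hemisphere (polarized_normal z u v)"
  proof (cases "norm x = 1")
    case False
    then show ?thesis unfolding mem_polarization_dir[OF u z H] by (simp add: hemisphere_def)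
  next
    case True
    have "x \<in> polarization_dir z u (hemisphere v) \<longleftrightarrow>
      (if p = 0 then 0 \<le> x \<bullet> v else if 0 \<le> r * p then 0 \<le> x \<bullet> v \<or> 0 \<le> x \<bullet> v - 2 * (r * q)
       else 0 \<le> x \<bullet> v \<and> 0 \<le> x \<bullet> v - 2 * (r * q))"
      using True unfolding mem_polarization_dir[OF u z H]
      by (simp add: hemisphere_def norm_reflection[OF u] refl p_def q_def r_def)
    also have "\<dots> \<longleftrightarrow> 0 \<le> (if q * p < 0 then x \<bullet> v - 2 * (r * q) else x \<bullet> v)"
      using pos neg neg' pos' by (cases "p = 0"; cases "0 \<le> r * p"; cases "q * p < 0") (simp; linarith)+
    also have "\<dots> \<longleftrightarrow> x \<in> hemisphere (polarized_normal z u v)"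
      using True by (simp add: hemisphere_def polarized_normal_def refl p_def q_def r_def)
    finally show ?thesis .
  qed
qed

lemma plane_decomposition:
  fixes v z :: "'a::euclidean_space"
  assumes n: "DIM('a) \<ge> 2" and v: "norm v = 1" and z: "norm z = 1"
  obtains e where "norm e = 1" "z \<bullet> e = 0" "v = cos (arccos (v \<bullet> z)) *\<^sub>R z + sin (arccos (v \<bullet> z)) *\<^sub>R e"
proof -
  have b: "\<bar>v \<bullet> z\<bar> \<le> 1" using Cauchy_Schwarz_ineq2[of v z] v z by auto
  have zz: "z \<bullet> z = 1" "v \<bullet> v = 1" using v z by (simp_all add: norm_eq_1)
  define w where "w = v - (v \<bullet> z) *\<^sub>R z"
  have wz: "z \<bullet> w = 0" by (simp add: w_def inner_diff_right zz inner_commute)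
  have "w \<bullet> w = 1 - (v \<bullet> z)\<^sup>2"
    by (simp add: w_def inner_diff_left inner_diff_right zz inner_commute power2_eq_square)
  then have nw: "norm w = sin (arccos (v \<bullet> z))"
    using b by (simp add: norm_eq_sqrt_inner sin_arccos_abs)
  have c: "cos (arccos (v \<bullet> z)) = v \<bullet> z" using b by (simp add: cos_arccos_abs)
  show ?thesis
  proof (cases "w = 0")
    case True
    \<comment> \<open>Here v is parallel to z and the sine of the angle vanishes, so any unit vector
      orthogonal to z will do.\<close>
    obtain x :: 'a where x: "x \<noteq> 0" "orthogonal z x"
      using orthogonal_to_vector_exists[of z] n by auto
    show ?thesis
    proof (rule that[of "sgn x"])
      show "norm (sgn x) = 1" using x by (simp add: norm_sgn)
      show "z \<bullet> sgn x = 0" using x by (simp add: sgn_div_norm orthogonal_def)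
      show "v = cos (arccos (v \<bullet> z)) *\<^sub>R z + sin (arccos (v \<bullet> z)) *\<^sub>R sgn x"
        using True nw c by (simp add: w_def)
    qed
  next
    case False
    show ?thesis
    proof (rule that[of "sgn w"])
      show "norm (sgn w) = 1" using False by (simp add: norm_sgn)
      show "z \<bullet> sgn w = 0" using wz by (simp add: sgn_div_norm)
      show "v = cos (arccos (v \<bullet> z)) *\<^sub>R z + sin (arccos (v \<bullet> z)) *\<^sub>R sgn w"
        unfolding nw[symmetric] c using False by (simp add: sgn_div_norm w_def)
    qed
  qed
qed

lemma arccos_inner_bounds:
  fixes v z :: "'a::euclidean_space"
  assumes "norm v = 1" "norm z = 1"
  shows "arccos (v \<bullet> z) \<in> {0..pi}" "cos (arccos (v \<bullet> z)) = v \<bullet> z"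
proof -
  have b: "\<bar>v \<bullet> z\<bar> \<le> 1" using Cauchy_Schwarz_ineq2[of v z] assms by auto
  then show "arccos (v \<bullet> z) \<in> {0..pi}" "cos (arccos (v \<bullet> z)) = v \<bullet> z"
    by (auto simp: cos_arccos_abs intro: arccos_lbound arccos_ubound)
qed

text \<open>Up to null sets the symmetric difference consists of the u whose inner products with v
  and z have opposite signs. By \<open>nn_integral_sphere_plane\<close> this means cos \<theta> <
  cos g, that is |g| < \<theta>, which is the fraction \<theta> / \<pi> of the range of g whatever
  the projected length.\<close>

lemma measure_lune:
  fixes v z :: "'a::euclidean_space"
  assumes n: "DIM('a) \<ge> 2" and v: "norm v = 1" and z: "norm z = 1"
  shows "measure sphere_measure (sym_diff (hemisphere v) (hemisphere z)) = arccos (v \<bullet> z) / pi"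
proof -
  define \<theta> where "\<theta> = arccos (v \<bullet> z)"
  have \<theta>: "0 \<le> \<theta>" "\<theta> \<le> pi" using arccos_inner_bounds(1)[OF v z] by (auto simp: \<theta>_def)
  obtain e where e: "norm e = 1" "z \<bullet> e = 0" and ve: "v = cos \<theta> *\<^sub>R z + sin \<theta> *\<^sub>R e"
    using plane_decomposition[OF n v z] unfolding \<theta>_def by blast
  let ?L = "{u \<in> sphere 0 1. (u \<bullet> v) * (u \<bullet> z) < 0}"
  have L: "?L \<in> sets sphere_measure" by (auto simp: sets_sphere_measure_iff)
  define F :: "real \<Rightarrow> ennreal" where "F = indicator {..<0}"
  have [measurable]: "F \<in> borel_measurable borel" by (simp add: F_def)
  have inner: "(\<integral>\<^sup>+g. indicator {-pi..<pi} g * F (\<rho> / 2 * (cos \<theta> - cos g)) \<partial>lborel) = ennreal (2 * \<theta>)" if "\<rho> > 0" for \<rho>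
  proof -
    have "indicator {-pi..<pi} g * F (\<rho> / 2 * (cos \<theta> - cos g)) = indicator {-\<theta><..<\<theta>} g" if "g \<noteq> -pi" "g \<noteq> pi" for g
    proof -
      have "\<rho> / 2 * (cos \<theta> - cos g) < 0 \<longleftrightarrow> cos \<theta> < cos \<bar>g\<bar>"
        using \<open>\<rho> > 0\<close> by (simp add: mult_less_0_iff cos_abs_real)
      moreover have "cos \<theta> < cos \<bar>g\<bar> \<longleftrightarrow> \<bar>g\<bar> < \<theta>" if "\<bar>g\<bar> \<le> pi"
        using that \<theta> by (intro cos_mono_less_eq) auto
      ultimately show ?thesis using that \<theta> by (auto simp: F_def indicator_def abs_le_iff abs_less_iff)
    qed
    then have "AE g in lborel. indicator {-pi..<pi} g * F (\<rho> / 2 * (cos \<theta> - cos g)) = indicator {-\<theta><..<\<theta>} g"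
      using AE_lborel_singleton[of "-pi"] AE_lborel_singleton[of pi] by (auto elim!: eventually_elim2)
    then have "(\<integral>\<^sup>+g. indicator {-pi..<pi} g * F (\<rho> / 2 * (cos \<theta> - cos g)) \<partial>lborel) = (\<integral>\<^sup>+g. indicator {-\<theta><..<\<theta>} g \<partial>lborel)"
      by (rule nn_integral_cong_AE)
    also have "\<dots> = ennreal (2 * \<theta>)" using \<theta> by simp
    finally show ?thesis .
  qed
  have "2 * (ennreal pi * emeasure sphere_measure ?L) = 2 * (ennreal pi * (\<integral>\<^sup>+u. F ((u \<bullet> v) * (u \<bullet> z)) \<partial>sphere_measure))"
  proof -
    have "(\<integral>\<^sup>+u. F ((u \<bullet> v) * (u \<bullet> z)) \<partial>sphere_measure) = (\<integral>\<^sup>+u. indicator ?L u \<partial>sphere_measure)"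
      by (rule nn_integral_cong) (auto simp: F_def indicator_def)
    then show ?thesis using L by simp
  qed
  also have "\<dots> = (\<integral>\<^sup>+u. (\<integral>\<^sup>+g. indicator {-pi..<pi} g * F (((u \<bullet> z)\<^sup>2 + (u \<bullet> e)\<^sup>2) / 2 * (cos \<theta> - cos g)) \<partial>lborel) \<partial>sphere_measure)"
    by (rule nn_integral_sphere_plane[OF z e(1) e(2) _ ve]) measurable
  also have "\<dots> = (\<integral>\<^sup>+u. ennreal (2 * \<theta>) \<partial>(sphere_measure :: 'a measure))"
  proof (rule nn_integral_cong_AE)
    show "AE u in sphere_measure. (\<integral>\<^sup>+g. indicator {-pi..<pi} g * F (((u \<bullet> z)\<^sup>2 + (u \<bullet> e)\<^sup>2) / 2 * (cos \<theta> - cos g)) \<partial>lborel) = ennreal (2 * \<theta>)"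
      using sphere_level_null[OF n z, of 0] by eventually_elim (rule inner, simp add: add_pos_nonneg)
  qed
  also have "\<dots> = ennreal (2 * \<theta>)"
    by (simp add: sphere.emeasure_space_1[simplified])
  finally have "ennreal (2 * (pi * measure sphere_measure ?L)) = ennreal (2 * \<theta>)"
    by (simp add: sphere.emeasure_eq_measure ennreal_mult)
  then have mL: "measure sphere_measure ?L = \<theta> / pi" using \<theta> by (simp add: field_simps)
  have "measure sphere_measure (sym_diff (hemisphere v) (hemisphere z)) = measure sphere_measure ?L"
  proof (rule measure_eq_AE)
    show "AE x in sphere_measure. x \<in> sym_diff (hemisphere v) (hemisphere z) \<longleftrightarrow> x \<in> ?L"
      using sphere_level_null[OF n z, of 0] sphere_level_null[OF n v, of 0]
      by eventually_elim (auto simp: hemisphere_def mult_less_0_iff)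
  qed (use L hemisphere_sets in auto)
  then show ?thesis using mL by (simp add: \<theta>_def)
qed

text \<open>The shift \<open>\<delta>\<close> only decreases the drop and keeps the logarithms bounded. With \<open>w = 1 - cos \<theta>\<close> and
  \<open>\<rho>\<close> the squared length of the projection of \<open>u\<close> to the plane of \<open>v\<close> and \<open>z\<close>, a reflection that moves
  \<open>v\<close> replaces \<open>w\<close> by \<open>(1 - \<rho>) w + \<rho> (1 - cos g)\<close>, \<open>g\<close> being uniform.\<close>

lemma nn_integral_log_drop:
  fixes v z :: "'a::euclidean_space"
  assumes d: "DIM('a) = d + 1" "d \<ge> 1" and v: "norm v = 1" and z: "norm z = 1" and \<delta>: "\<delta> > 0"
  shows "(\<integral>\<^sup>+u. ennreal (ln (1 - v \<bullet> z + \<delta>) / 2 - ln (1 - v \<bullet> z + 2 * min 0 ((u \<bullet> v) * (u \<bullet> z)) + \<delta>) / 2) \<partial>sphere_measure)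
    \<le> ennreal (arccos (v \<bullet> z) / pi / d)"
proof -
  have n: "DIM('a) \<ge> 2" using d by simp
  define \<theta> where "\<theta> = arccos (v \<bullet> z)"
  have \<theta>: "0 \<le> \<theta>" "\<theta> \<le> pi" "cos \<theta> = v \<bullet> z" using arccos_inner_bounds[OF v z] by (auto simp: \<theta>_def)
  obtain e where e: "norm e = 1" "z \<bullet> e = 0" and ve: "v = cos \<theta> *\<^sub>R z + sin \<theta> *\<^sub>R e"
    using plane_decomposition[OF n v z] unfolding \<theta>_def by blast
  define w where "w = 1 - cos \<theta>"
  have w: "w \<ge> 0" by (simp add: w_def)
  define F where "F x = ennreal (ln (w + \<delta>) / 2 - ln (w + 2 * min 0 x + \<delta>) / 2)" for x
  have [measurable]: "F \<in> borel_measurable borel" unfolding F_def by measurable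
  define \<rho> where "\<rho> u = (u \<bullet> z)\<^sup>2 + (u \<bullet> e)\<^sup>2" for u
  have \<rho>: "0 \<le> \<rho> u" "\<rho> u \<le> 1" if "norm u = 1" for u
  proof -
    show "0 \<le> \<rho> u" by (simp add: \<rho>_def)
    obtain W where "(\<Sum>b\<in>W. (u \<bullet> b)\<^sup>2) + (u \<bullet> z)\<^sup>2 + (u \<bullet> e)\<^sup>2 = u \<bullet> u"
      using orthonormal_complement_basis[OF z e(1) e(2)] by metis
    moreover have "(\<Sum>b\<in>W. (u \<bullet> b)\<^sup>2) \<ge> 0" by (simp add: sum_nonneg)
    ultimately show "\<rho> u \<le> 1" using that by (simp add: \<rho>_def norm_eq_1)
  qed
  have inner: "(\<integral>\<^sup>+g. indicator {-pi..<pi} g * F (r / 2 * (cos \<theta> - cos g)) \<partial>lborel) \<le> ennreal (2 * \<theta> * (1 - sqrt (1 - r)))"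
    if r: "0 \<le> r" "r \<le> 1" for r
  proof (cases "\<theta> = 0")
    case True
    have "F (r / 2 * (cos \<theta> - cos g)) = 0" for g
      using r cos_le_one[of g] by (simp add: F_def True min_absorb1)
    then show ?thesis by simp
  next
    case False
    then have th: "\<theta> > 0" using \<theta> by simp
    \<comment> \<open>The shift damps r to \<open>\<kappa> \<le> r\<close>. Since \<delta> > 0,
      \<open>\<kappa>\<close> stays below 1 even for r = 1, which makes \<open>s\<close> positive as
      the integral estimate demands, and \<open>s\<close> is at least the square root of 1 -
      r.\<close>
    define \<kappa> where "\<kappa> = r * w / (w + \<delta>)"
    define s where "s = sqrt (1 - \<kappa>)"
    have wd: "w + \<delta> > 0" using w \<delta> by simp
    have k: "0 \<le> \<kappa>" "\<kappa> \<le> r" "\<kappa> < 1"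
    proof -
      show "0 \<le> \<kappa>" using r w \<delta> by (simp add: \<kappa>_def)
      have "r * w \<le> r * (w + \<delta>)" using r \<delta> by (intro mult_left_mono) auto
      then show "\<kappa> \<le> r" using wd by (simp add: \<kappa>_def divide_le_eq)
      have "r * w \<le> 1 * w" using r w by (intro mult_right_mono) auto
      then have "r * w < w + \<delta>" using \<delta> by simp
      then show "\<kappa> < 1" using wd by (simp add: \<kappa>_def divide_less_eq)
    qed
    have s: "0 < s" "s \<le> 1" "1 - s\<^sup>2 = \<kappa>" "sqrt (1 - r) \<le> s" using k by (auto simp: s_def)
    have pt: "indicator {-pi..<pi} g * F (r / 2 * (cos \<theta> - cos g)) \<le>
        ennreal (- ln (s\<^sup>2 + (1 - s\<^sup>2) * (g / \<theta>)\<^sup>2) / 2) * indicator {-\<theta>..\<theta>} g" for g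
    proof (cases "g \<in> {-pi..<pi}")
      case False then show ?thesis by simp
    next
      case True
      show ?thesis
      proof (cases "\<bar>g\<bar> \<le> \<theta>")
        case False
        have "cos \<bar>g\<bar> \<le> cos \<theta>" using False True \<theta> by (intro cos_monotone_0_pi_le) auto
        then have "F (r / 2 * (cos \<theta> - cos g)) = 0"
          using r by (simp add: F_def min_absorb1 cos_abs_real)
        then show ?thesis by simp
      next
        case gt: True
        define \<tau> where "\<tau> = g / \<theta>"
        define q where "q = s\<^sup>2 + (1 - s\<^sup>2) * \<tau>\<^sup>2"
        have q: "q > 0" using s k by (simp add: q_def add_pos_nonneg)
        have "w * \<tau>\<^sup>2 \<le> 1 - cos g"
          unfolding w_def \<tau>_def using one_minus_cos_scale_ge[OF th \<theta>(2) gt] .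
        then have "r * (w * \<tau>\<^sup>2) \<le> r * (1 - cos g)" using r by (intro mult_left_mono)
        \<comment> \<open>The quadratic \<open>q\<close> thereby bounds the ratio of the new to the
          old value of 1 - cos \<theta> + \<delta> from below, and - ln q / 2 is the integrand of
          \<open>nn_integral_log_quadratic_le\<close>.\<close>
        moreover have "(w + \<delta>) * q = w + \<delta> - r * w + r * (w * \<tau>\<^sup>2)"
        proof -
          have "(w + \<delta>) * q = (w + \<delta>) - (w + \<delta>) * \<kappa> + (w + \<delta>) * \<kappa> * \<tau>\<^sup>2"
          proof -
            have q_eq: "q = 1 - \<kappa> + \<kappa> * \<tau>\<^sup>2" unfolding q_def s(3) using s(3) by linarith
            show ?thesis by (subst q_eq) (simp add: algebra_simps)
          qed
          also have "(w + \<delta>) * \<kappa> = r * w" using wd by (simp add: \<kappa>_def)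
          finally show ?thesis by simp
        qed
        ultimately have le: "(w + \<delta>) * q \<le> w + r * (cos \<theta> - cos g) + \<delta>"
          by (simp add: w_def algebra_simps)
        have "cos \<theta> \<le> cos \<bar>g\<bar>" using gt \<theta> by (intro cos_monotone_0_pi_le) auto
        then have "r * (cos \<theta> - cos g) \<le> 0" using r by (simp add: mult_le_0_iff cos_abs_real)
        then have m: "2 * min 0 (r / 2 * (cos \<theta> - cos g)) = r * (cos \<theta> - cos g)" by (simp add: min_absorb2)
        have "ln ((w + \<delta>) * q) \<le> ln (w + r * (cos \<theta> - cos g) + \<delta>)"
          using le wd q by (subst ln_le_cancel_iff) (auto intro: less_le_trans[OF mult_pos_pos])
        then have "ln (w + \<delta>) + ln q \<le> ln (w + r * (cos \<theta> - cos g) + \<delta>)"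
          using wd q by (simp add: ln_mult)
        then have "F (r / 2 * (cos \<theta> - cos g)) \<le> ennreal (- ln q / 2)"
          unfolding F_def m by (intro ennreal_leI) linarith
        then show ?thesis using True gt unfolding q_def \<tau>_def by (simp add: abs_le_iff indicator_def)
      qed
    qed
    have "(\<integral>\<^sup>+g. indicator {-pi..<pi} g * F (r / 2 * (cos \<theta> - cos g)) \<partial>lborel) \<le> ennreal (2 * \<theta> * (1 - s))"
      by (rule order_trans[OF nn_integral_mono[OF pt] nn_integral_log_quadratic_le[OF s(1,2) th]])
    also have "\<dots> \<le> ennreal (2 * \<theta> * (1 - sqrt (1 - r)))"
      using s(4) \<theta> by (intro ennreal_leI mult_left_mono) auto
    finally show ?thesis .
  qed
  have sq: "1 - sqrt (1 - (u \<bullet> z)\<^sup>2 - (u \<bullet> e)\<^sup>2) = 1 - sqrt (1 - \<rho> u)" for u by (simp add: \<rho>_def diff_diff_eq)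
  have qm: "(\<lambda>u. 1 - sqrt (1 - \<rho> u)) \<in> borel_measurable sphere_measure"
    by (rule borel_measurable_sphere) (unfold \<rho>_def, measurable)
  have qb: "0 \<le> 1 - sqrt (1 - \<rho> u)" "1 - sqrt (1 - \<rho> u) \<le> 1" if "norm u = 1" for u
    using \<rho>[OF that] by auto
  have qi: "integrable sphere_measure (\<lambda>u. 1 - sqrt (1 - \<rho> u))"
    by (rule sphere.integrable_const_bound[where B=1, OF _ qm]) (use qb in auto)
  have "2 * (ennreal pi * (\<integral>\<^sup>+u. F ((u \<bullet> v) * (u \<bullet> z)) \<partial>sphere_measure)) =
    (\<integral>\<^sup>+u. (\<integral>\<^sup>+g. indicator {-pi..<pi} g * F (\<rho> u / 2 * (cos \<theta> - cos g)) \<partial>lborel) \<partial>sphere_measure)"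
    unfolding \<rho>_def by (rule nn_integral_sphere_plane[OF z e(1) e(2) _ ve]) measurable
  also have "\<dots> \<le> (\<integral>\<^sup>+u. ennreal (2 * \<theta> * (1 - sqrt (1 - \<rho> u))) \<partial>sphere_measure)"
    by (rule nn_integral_mono, rule inner) (use \<rho> in auto)
  also have "\<dots> = ennreal (\<integral>u. 2 * \<theta> * (1 - sqrt (1 - \<rho> u)) \<partial>sphere_measure)"
    by (rule nn_integral_eq_integral) (use qi qb \<theta> in \<open>auto intro!: AE_I2 mult_nonneg_nonneg\<close>)
  \<comment> \<open>The square root of 1 - \<rho> is the length of the component of u orthogonal to
    the plane of z and e; its mean brings in 1/d.\<close>
  also have "(\<integral>u. 2 * \<theta> * (1 - sqrt (1 - \<rho> u)) \<partial>sphere_measure) = 2 * \<theta> * (1 / d)"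
    using integral_projection_codim2[OF d z e(1) e(2)] unfolding sq by simp
  finally have main: "2 * (ennreal pi * (\<integral>\<^sup>+u. F ((u \<bullet> v) * (u \<bullet> z)) \<partial>sphere_measure)) \<le> ennreal (2 * \<theta> * (1 / d))" .
  have "(\<integral>\<^sup>+u. F ((u \<bullet> v) * (u \<bullet> z)) \<partial>sphere_measure) = ennreal (1 / (2 * pi)) * (2 * (ennreal pi * (\<integral>\<^sup>+u. F ((u \<bullet> v) * (u \<bullet> z)) \<partial>sphere_measure)))"
  proof -
    have "ennreal (1 / (2 * pi)) * (2 * ennreal pi) = ennreal (1 / (2 * pi) * (2 * pi))"
      by (simp add: ennreal_mult''[symmetric] ennreal_mult'[symmetric] flip: ennreal_numeral)
    also have "1 / (2 * pi) * (2 * pi) = 1" by simp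
    finally show ?thesis by (simp add: mult.assoc[symmetric])
  qed
  also have "\<dots> \<le> ennreal (1 / (2 * pi)) * ennreal (2 * \<theta> * (1 / d))"
    by (rule mult_left_mono[OF main]) simp
  also have "\<dots> = ennreal (\<theta> / pi / d)"
    using \<theta> by (subst ennreal_mult[symmetric]) (auto simp: field_simps)
  finally show ?thesis unfolding F_def w_def \<theta>(3) unfolding \<theta>_def .
qed

text \<open>The reflection in the direction v - z maps one unit vector to the other and carries the
  hemispheres along.\<close>

lemma measure_hemisphere:
  fixes v z :: "'a::euclidean_space"
  assumes "norm v = 1" "norm z = 1"
  shows "measure sphere_measure (hemisphere v) = measure sphere_measure (hemisphere z)"
proof -
  obtain f where f: "orthogonal_transformation f" "f v = z"
  proof (cases "v = z")
    case True
    then show ?thesis using that[of "\<lambda>x. x"] orthogonal_transformation_id by simp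
  next
    case False
    define u where "u = sgn (v - z)"
    have u: "norm u = 1" using False by (simp add: u_def norm_sgn)
    have eq: "(norm (v - z))\<^sup>2 = 2 * ((v - z) \<bullet> v)"
      using assms by (simp add: power2_norm_eq_inner norm_eq_1 inner_diff_left inner_diff_right inner_commute)
    have "2 * ((v - z) \<bullet> v) / (norm (v - z))\<^sup>2 = 1"
      unfolding eq[symmetric] using False by (intro divide_self) simp
    then have "(2 * (u \<bullet> v)) *\<^sub>R u = 1 *\<^sub>R (v - z)"
      by (simp add: u_def sgn_div_norm power2_eq_square divide_inverse mult_ac)
    then have "reflection u v = z" by (simp add: reflection_def)
    then show ?thesis using that orthogonal_transformation_reflection[OF u] by blast
  qed
  have m: "f \<in> sphere_measure \<rightarrow>\<^sub>M sphere_measure" by (rule orthogonal_transformation_measurable_sphere[OF f(1)])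
  have "f x \<bullet> z = x \<bullet> v" for x using f by (auto simp: orthogonal_transformation_def)
  then have eq: "f -` hemisphere z \<inter> space sphere_measure = hemisphere v"
    using orthogonal_transformation_norm[OF f(1)] by (auto simp: hemisphere_def)
  have "measure sphere_measure (hemisphere z) = measure (distr sphere_measure sphere_measure f) (hemisphere z)"
    by (simp only: sphere_measure_orthogonal_invariant[OF f(1)])
  also have "\<dots> = measure sphere_measure (hemisphere v)"
    by (simp only: measure_distr[OF m hemisphere_sets] eq)
  finally show ?thesis ..
qed

text \<open>The level of the polar cap is unknown, but caps about the same pole are nested, and
  nested sets of equal measure differ by a null set. So the cap may be replaced by the hemisphere
  about z.\<close>

lemma measure_sym_diff_polar_cap_hemisphere:
  fixes v z :: "'a::euclidean_space"
  assumes n: "DIM('a) \<ge> 2" and v: "norm v = 1" and z: "norm z = 1" and X: "X \<in> sets sphere_measure"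
  shows "measure sphere_measure (sym_diff X (polar_cap z (hemisphere v))) = measure sphere_measure (sym_diff X (hemisphere z))"
proof -
  obtain c where c: "polar_cap z (hemisphere v) = {x \<in> sphere 0 1. c \<le> x \<bullet> z}"
    "measure sphere_measure (polar_cap z (hemisphere v)) = measure sphere_measure (hemisphere v)"
    using polar_cap_props[OF n z] by metis
  define B where "B = polar_cap z (hemisphere v)"
  have Bs: "B \<in> sets sphere_measure" unfolding B_def c(1) by (rule sphere_halfspace_sets)
  have mB: "measure sphere_measure B = measure sphere_measure (hemisphere z)"
    unfolding B_def c(2) by (rule measure_hemisphere[OF v z])
  have "measure sphere_measure (B - hemisphere z) = 0 \<and> measure sphere_measure (hemisphere z - B) = 0"
  proof (cases "c \<ge> 0")
    case True
    then have sub: "B \<subseteq> hemisphere z" unfolding B_def c(1) by (auto simp: hemisphere_def)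
    then have empty: "B - hemisphere z = {}" by auto
    have "measure sphere_measure (hemisphere z - B) = 0"
      using sphere.finite_measure_Diff[OF hemisphere_sets Bs sub] mB by linarith
    then show ?thesis unfolding empty by simp
  next
    case False
    then have sub: "hemisphere z \<subseteq> B" unfolding B_def c(1) by (auto simp: hemisphere_def)
    then have empty: "hemisphere z - B = {}" by auto
    have "measure sphere_measure (B - hemisphere z) = 0"
      using sphere.finite_measure_Diff[OF Bs hemisphere_sets sub] mB by linarith
    then show ?thesis unfolding empty by simp
  qed
  then have "B - hemisphere z \<in> null_sets sphere_measure" "hemisphere z - B \<in> null_sets sphere_measure"
    using Bs hemisphere_sets[of z] by (auto simp: null_sets_def sphere.emeasure_eq_measure)
  then have "AE x in sphere_measure. x \<in> B \<longleftrightarrow> x \<in> hemisphere z"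
    by (auto dest!: AE_not_in elim: eventually_elim2)
  then have "AE x in sphere_measure. x \<in> sym_diff X B \<longleftrightarrow> x \<in> sym_diff X (hemisphere z)"
    by eventually_elim auto
  then show ?thesis unfolding B_def[symmetric]
    using X Bs hemisphere_sets[of z] by (intro measure_eq_AE) auto
qed

text \<open>By \<open>measure_lune\<close> the distance of \<open>hemisphere v\<close> is \<theta> /
  \<pi>, so \<open>\<phi>\<close> of the distance is
  \<open>ln (1 - v \<bullet> z + \<delta>) / 2\<close>, and the bound of
  \<open>nn_integral_log_drop\<close> is the distance divided by d.\<close>

lemma polarization_step_log:
  fixes v z :: "'a::euclidean_space"
  assumes d: "DIM('a) = d + 1" "d \<ge> 1" and v: "norm v = 1" and z: "norm z = 1" and \<delta>: "\<delta> > 0"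
  defines "\<phi> \<equiv> \<lambda>t. ln (1 - cos (pi * t) + \<delta>) / 2"
    and "m \<equiv> \<lambda>A. measure sphere_measure (sym_diff A (hemisphere z))"
  shows "\<phi> (m (hemisphere v)) - m (hemisphere v) / d \<le>
    (\<integral>u. \<phi> (m (polarization_dir z u (hemisphere v))) \<partial>sphere_measure)"
proof -
  have n: "DIM('a) \<ge> 2" using d by simp
  have \<phi>m: "\<phi> (m (hemisphere x)) = ln (1 - x \<bullet> z + \<delta>) / 2" if "norm x = 1" for x
    using arccos_inner_bounds(2)[OF that z] by (simp add: \<phi>_def m_def measure_lune[OF n that z])
  define \<Delta> where "\<Delta> u = ln (1 - v \<bullet> z + \<delta>) / 2 - ln (1 - v \<bullet> z + 2 * min 0 ((u \<bullet> v) * (u \<bullet> z)) + \<delta>) / 2" for u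
  have step: "\<phi> (m (polarization_dir z u (hemisphere v))) = \<phi> (m (hemisphere v)) - \<Delta> u" if "norm u = 1" for u
  proof -
    have np: "norm (polarized_normal z u v) = 1" using norm_polarized_normal[OF that] v by simp
    have eq: "1 - polarized_normal z u v \<bullet> z + \<delta> = 1 - v \<bullet> z + 2 * min 0 ((u \<bullet> v) * (u \<bullet> z)) + \<delta>"
      by (simp add: polarized_normal_inner)
    show ?thesis
      unfolding polarization_dir_hemisphere[OF that z] \<phi>m[OF np] \<phi>m[OF v] \<Delta>_def eq by simp
  qed
  have pos: "1 - x \<bullet> z \<ge> 0" if "norm x = 1" for x using Cauchy_Schwarz_ineq2[of x z] z that by auto
  have arg: "0 < 1 - v \<bullet> z + 2 * min 0 ((u \<bullet> v) * (u \<bullet> z)) + \<delta>" if "norm u = 1" for u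
    using pos[of "polarized_normal z u v"] norm_polarized_normal[OF that, of z v] v \<delta>
    by (simp add: polarized_normal_inner)
  have \<Delta>0: "0 \<le> \<Delta> u" if "norm u = 1" for u
    using arg[OF that] by (simp add: \<Delta>_def)
  \<comment> \<open>The lower bound \<delta> on both arguments makes the drop bounded, hence
    integrable, which permits the passage from the nonnegative to the real integral.\<close>
  have \<Delta>1: "\<Delta> u \<le> ln (2 + \<delta>) / 2 - ln \<delta> / 2" if "norm u = 1" for u
  proof -
    have "0 \<le> 1 - polarized_normal z u v \<bullet> z" using pos norm_polarized_normal[OF that] v by simp
    then have "ln \<delta> \<le> ln (1 - v \<bullet> z + 2 * min 0 ((u \<bullet> v) * (u \<bullet> z)) + \<delta>)"
      using \<delta> arg[OF that] by (simp add: polarized_normal_inner)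
    moreover have "- (v \<bullet> z) \<le> 1" using Cauchy_Schwarz_ineq2[of v z] z v by auto
    then have "ln (1 - v \<bullet> z + \<delta>) \<le> ln (2 + \<delta>)" using pos[OF v] \<delta> by simp
    ultimately show ?thesis by (simp add: \<Delta>_def)
  qed
  have \<Delta>m: "\<Delta> \<in> borel_measurable sphere_measure"
    by (rule borel_measurable_sphere) (unfold \<Delta>_def, measurable)
  have \<Delta>i: "integrable sphere_measure \<Delta>"
    by (rule sphere.integrable_const_bound[where B="ln (2 + \<delta>) / 2 - ln \<delta> / 2", OF _ \<Delta>m]) (use \<Delta>0 \<Delta>1 in auto)
  have "ennreal (\<integral>u. \<Delta> u \<partial>sphere_measure) = (\<integral>\<^sup>+u. ennreal (\<Delta> u) \<partial>sphere_measure)"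
    by (rule nn_integral_eq_integral[symmetric, OF \<Delta>i]) (use \<Delta>0 in auto)
  also have "\<dots> \<le> ennreal (arccos (v \<bullet> z) / pi / d)"
    unfolding \<Delta>_def by (rule nn_integral_log_drop[OF d v z \<delta>])
  finally have le: "(\<integral>u. \<Delta> u \<partial>sphere_measure) \<le> arccos (v \<bullet> z) / pi / d"
    using arccos_inner_bounds(1)[OF v z] by (subst (asm) ennreal_le_iff) auto
  have "(\<integral>u. \<phi> (m (polarization_dir z u (hemisphere v))) \<partial>sphere_measure) = (\<integral>u. \<phi> (m (hemisphere v)) - \<Delta> u \<partial>sphere_measure)"
    by (rule Bochner_Integration.integral_cong) (auto simp: step)
  also have "\<dots> = \<phi> (m (hemisphere v)) - (\<integral>u. \<Delta> u \<partial>sphere_measure)"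
    using \<Delta>i sphere.prob_space[where ?'a='a] by simp
  finally show ?thesis using le by (simp add: m_def measure_lune[OF n v z])
qed

section \<open>Iterated polarizations and recursions for real sequences\<close>

lemma polarization_dir_representative:
  "w \<in> directions \<Longrightarrow> \<exists>u. norm u = 1 \<and> polarization z w = polarization_dir z u"
  using norm_representative by (auto simp: polarization_def)

lemma polarizations_hemisphere:
  fixes v z :: "'a::euclidean_space"
  assumes "set ws \<subseteq> directions" "norm z = 1" "norm v = 1"
  shows "\<exists>v'. norm v' = 1 \<and> polarizations z ws (hemisphere v) = hemisphere v'"
  using assms(1)
proof (induction ws rule: rev_induct)
  case Nil
  then show ?case using assms by (auto simp: polarizations_def)
next
  case (snoc w ws)
  then obtain v' where v': "norm v' = 1" "polarizations z ws (hemisphere v) = hemisphere v'" by auto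
  obtain u where u: "norm u = 1" "polarization z w = polarization_dir z u"
    using polarization_dir_representative[of w z] snoc.prems by auto
  show ?case
    unfolding polarizations_snoc u(2) v'(2) polarization_dir_hemisphere[OF u(1) assms(2)]
    using norm_polarized_normal[OF u(1)] v'(1) by metis
qed

lemma polarizations_measure:
  fixes z :: "'a::euclidean_space"
  assumes "set ws \<subseteq> directions" "norm z = 1" "A \<in> sets sphere_measure"
  shows "polarizations z ws A \<in> sets sphere_measure \<and>
    measure sphere_measure (polarizations z ws A) = measure sphere_measure A"
  using assms(1)
proof (induction ws rule: rev_induct)
  case Nil
  then show ?case using assms by (auto simp: polarizations_def)
next
  case (snoc w ws)
  obtain u where u: "norm u = 1" "polarization z w = polarization_dir z u"
    using polarization_dir_representative[of w z] snoc.prems by auto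
  show ?case
    using snoc polarization_dir_sets[OF u(1) assms(2)] measure_polarization_dir[OF u(1) assms(2)]
    by (simp add: polarizations_snoc u(2))
qed

text \<open>Essentially 1/a grows by at least 1/D in each step, since x - x^2/D is at most D x / (D
  + x). The latter expression is increasing in x and avoids reciprocals of terms that may
  vanish.\<close>

lemma quadratic_recursion_bound:
  fixes a :: "nat \<Rightarrow> real"
  assumes D: "D \<ge> 1" and a0: "\<And>n. 0 \<le> a n" and a1: "\<And>n. a n \<le> 1"
    and rec: "\<And>n. a (Suc n) \<le> a n - (a n)\<^sup>2 / D" and n: "n \<ge> 1"
  shows "a n \<le> D / n"
  using n
proof (induction n rule: dec_induct)
  case base
  then show ?case using a1[of 1] D by simp
next
  case (step n)
  define x where "x = a n"
  have x: "0 \<le> x" "x \<le> D / n" using a0 step.IH by (auto simp: x_def)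
  have np: "real n \<ge> 1" using step.hyps by simp
  have Dx: "D + x > 0" using D x by simp
  have "(x - x\<^sup>2 / D) * (D + x) = D * x - x ^ 3 / D"
    using D by (simp add: field_simps power2_eq_square power3_eq_cube)
  also have "\<dots> \<le> D * x" using x D by simp
  finally have "x - x\<^sup>2 / D \<le> D * x / (D + x)" using Dx by (simp add: pos_le_divide_eq)
  also have "\<dots> \<le> D / (real n + 1)"
  proof -
    have "x * n \<le> D" using x(2) np by (simp add: pos_le_divide_eq)
    then have "x * (real n + 1) \<le> D + x" by (simp add: algebra_simps)
    then have "D * (x * (real n + 1)) \<le> D * (D + x)" using D by (intro mult_left_mono) auto
    then show ?thesis using Dx np by (simp add: divide_le_eq pos_le_divide_eq field_simps)
  qed
  finally show ?case using rec[of n] by (simp add: x_def add.commute)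
qed

text \<open>If a n is at most c / n eventually, the partial sums grow at most like c ln n, so the
  left side of \<open>lower\<close> decays no faster than n to the power - c / d. For c < d this is
  slower than the decay c / n of the right side.\<close>

lemma log_recursion_contradiction:
  fixes a :: "nat \<Rightarrow> real" and d c K :: real
  assumes d: "d > 0" and K: "K > 0" and c: "0 \<le> c" "c < d"
    and lower: "\<And>n. exp (- (\<Sum>k<n. a k) / d) \<le> K * a n"
    and upper: "eventually (\<lambda>n. a n \<le> c / n) sequentially"
  shows False
proof -
  obtain N where N: "\<And>n. n \<ge> N \<Longrightarrow> a n \<le> c / n" using upper by (auto simp: eventually_sequentially)
  \<comment> \<open>A start at 2 or later keeps the logarithm of n - 1 defined and nonnegative in
    the induction below.\<close>
  define M where "M = max N 2"
  have M: "M \<ge> 2" "\<And>n. n \<ge> M \<Longrightarrow> a n \<le> c / n" using N by (auto simp: M_def)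
  define S where "S n = (\<Sum>k<n. a k)" for n
  have S: "S n \<le> S M + c * ln n" if "n \<ge> M" for n
  proof -
    \<comment> \<open>\<open>S n\<close> ends with the term of index n - 1, hence the logarithm of n
      - 1; the step uses that 1 / n is at most ln n - ln (n - 1).\<close>
    have "S n \<le> S M + c * ln (real n - 1)" using that
    proof (induction n rule: dec_induct)
      case base
      then show ?case using M(1) c by simp
    next
      case (step n)
      have n: "real n \<ge> 2" using step.hyps M(1) by simp
      have "ln ((real n - 1) / n) \<le> (real n - 1) / n - 1" using n by (intro ln_le_minus_one) simp
      moreover have "ln ((real n - 1) / n) = ln (real n - 1) - ln n" using n by (simp add: ln_div)
      moreover have "(real n - 1) / n - 1 = - (1 / n)" using n by (simp add: field_simps)
      ultimately have "1 / n \<le> ln n - ln (real n - 1)" by linarith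
      then have "c * (1 / n) \<le> c * (ln n - ln (real n - 1))" using c by (intro mult_left_mono) auto
      then have "a n \<le> c * (ln n - ln (real n - 1))" using M(2)[of n] step.hyps by simp
      then show ?case using step.IH by (simp add: S_def algebra_simps)
    qed
    moreover have "c * ln (real n - 1) \<le> c * ln n" using that M(1) c by (intro mult_left_mono) auto
    ultimately show ?thesis by simp
  qed
  define g where "g = c / d"
  have g: "0 \<le> g" "g < 1" using c d by (auto simp: g_def)
  have "exp (- S M / d) \<le> K * c * real n powr (g - 1)" if n: "n \<ge> M" for n
  proof -
    have np: "real n > 0" using n M(1) by simp
    have "(- S M - c * ln n) / d \<le> - S n / d"
      using S[OF n] d by (intro divide_right_mono) auto
    then have "- S M / d + - (g * ln n) \<le> - S n / d"
      by (simp add: g_def diff_divide_distrib)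
    then have "exp (- S M / d + - (g * ln n)) \<le> exp (- S n / d)" by simp
    also have "\<dots> \<le> K * a n" using lower[of n] by (simp add: S_def)
    also have "\<dots> \<le> K * (c / n)" using M(2)[OF n] K by (intro mult_left_mono) auto
    finally have le: "exp (- S M / d + - (g * ln n)) * exp (g * ln n) \<le> K * (c / n) * exp (g * ln n)"
      by (rule mult_right_mono) simp
    have "exp (- S M / d) = exp (- S M / d + - (g * ln n)) * exp (g * ln n)"
      by (simp only: exp_add[symmetric]) simp
    also note le
    also have "K * (c / n) * exp (g * ln n) = K * c * real n powr (g - 1)"
      using np by (simp add: powr_diff) (simp add: powr_def)
    finally show ?thesis .
  qed
  then have "eventually (\<lambda>n. exp (- S M / d) \<le> K * c * real n powr (g - 1)) sequentially"
    by (auto simp: eventually_sequentially)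
  moreover have "(\<lambda>n. K * c * real n powr (g - 1)) \<longlonglongrightarrow> K * c * 0"
    using g by (intro tendsto_intros tendsto_neg_powr filterlim_real_sequentially) auto
  ultimately have "exp (- S M / d) \<le> K * c * 0"
    by (intro tendsto_lowerbound[of "\<lambda>n. K * c * real n powr (g - 1)"]) auto
  then show False by simp
qed

text \<open>It bounds the exponential of ln (1 - cos t + \<delta>) / 2 by an expression affine in t,
  whose mean is known once the mean of t is. The constant lost in estimating 1 - cos t by t^2 does
  not affect the order of decay.\<close>

lemma sqrt_one_minus_cos_le:
  fixes t \<delta> :: real
  assumes "0 \<le> t" "0 < \<delta>"
  shows "sqrt (1 - cos t + \<delta>) \<le> t + sqrt \<delta>"
proof -
  have "1 - cos t = 2 * (sin (t / 2))\<^sup>2" using cos_double_sin[of "t / 2"] by simp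
  also have "(sin (t / 2))\<^sup>2 \<le> (t / 2)\<^sup>2"
    using abs_sin_x_le_abs_x[of "t / 2"] by (simp only: abs_le_square_iff)
  also have "2 * (t / 2)\<^sup>2 \<le> t\<^sup>2" by (simp add: power2_eq_square)
  finally have "sqrt (1 - cos t + \<delta>) \<le> sqrt (t\<^sup>2 + \<delta>)" by simp
  also have "\<dots> \<le> sqrt (t\<^sup>2) + sqrt \<delta>" by (rule sqrt_add_le_add_sqrt) (use assms in auto)
  finally show ?thesis using assms by simp
qed

theorem mainTheorem1:
  fixes d :: nat
    and north :: "'a::euclidean_space"
    and P :: "'w measure"
    and U :: "nat \<Rightarrow> 'w \<Rightarrow> 'a set"
  assumes "d \<ge> 1"
    and "DIM('a) = d + 1"
    and "north \<in> sphere 0 1"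
    and "prob_space P"
    and "prob_space.indep_vars P (\<lambda>_. uniform_directions) U {1..}"
    and "\<forall>i\<ge>1. distr P uniform_directions (U i) = uniform_directions"
  shows "(\<forall>A \<in> sets sphere_measure. \<forall>n\<ge>1.
            expected_distance P U north A n \<le> 2 ^ d * inverse (real n))
       \<and> \<not> (\<exists>p C. p > 1 \<and> (\<forall>A \<in> sets sphere_measure. \<forall>n\<ge>1.
            expected_distance P U north A n \<le> C * real n powr (- p)))
       \<and> (\<forall>C. (\<forall>A \<in> sets sphere_measure. \<forall>n\<ge>1.
            expected_distance P U north A n \<le> C * inverse (real n)) \<longrightarrow> C \<ge> real d)"
proof -
  interpret P: prob_space P by fact
  define z where "z = north"
  have z: "norm z = 1" using assms(3) by (simp add: z_def)
  have n2: "DIM('a) \<ge> 2" using assms(1,2) by simp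
  have d: "DIM('a) = d + 1" "d \<ge> 1" using assms by auto
  define T where "T A n \<omega> = polarizations z (map (\<lambda>i. U i \<omega>) [1..<Suc n]) A" for A n \<omega>
  define X where "X A n \<omega> = measure sphere_measure (sym_diff (T A n \<omega>) (polar_cap z A))" for A n \<omega>
  define a where "a A n = (\<integral>\<omega>. X A n \<omega> \<partial>P)" for A n
  have ed: "expected_distance P U north A n = a A n" for A n
    by (simp add: expected_distance_def a_def X_def T_def z_def)
  have cap: "polar_cap z A \<in> sets sphere_measure" for A
    using polar_cap_props[OF n2 z, of A] sphere_halfspace_sets by metis
  have Um: "U i \<in> P \<rightarrow>\<^sub>M directions_algebra" if "i \<ge> 1" for i
    using assms(5) that unfolding P.indep_vars_def measurable_cong_sets[OF refl sets_uniform_directions] by auto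
  have Udir: "set (map (\<lambda>i. U i \<omega>) [1..<Suc n]) \<subseteq> directions" if "\<omega> \<in> space P" for \<omega> n
    using measurable_space[OF Um that] by auto
  have Xm: "X A n \<in> borel_measurable P" if "A \<in> sets sphere_measure" for A n
    unfolding X_def T_def
    by (intro measurable_family_measure measurable_family_sym_diff cap measurable_family_polarizations[OF that Um z]) auto
  have X01: "X A n \<omega> \<in> {0..1}" for A n \<omega> by (simp add: X_def)
  have Xi: "integrable P (X A n)" if "A \<in> sets sphere_measure" for A n
    by (rule P.integrable_const_bound[where B=1, OF _ Xm[OF that]]) (use X01 in \<open>auto intro!: AE_I2\<close>)
  \<comment> \<open>It is applied below with the identity in the upper bound and with a shifted
    logarithm in the lower bound.\<close>
  have Pstep: "(\<integral>\<omega>. h (X A (Suc n) \<omega>) \<partial>P) =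
      (\<integral>\<omega>. (\<integral>u. h (measure sphere_measure (sym_diff (polarization_dir z u (T A n \<omega>)) (polar_cap z A))) \<partial>sphere_measure) \<partial>P)"
    "integrable P (\<lambda>\<omega>. \<integral>u. h (measure sphere_measure (sym_diff (polarization_dir z u (T A n \<omega>)) (polar_cap z A))) \<partial>sphere_measure)"
    if "A \<in> sets sphere_measure" "h \<in> borel_measurable borel" "\<And>t. t \<in> {0..1} \<Longrightarrow> \<bar>h t\<bar> \<le> c" for A and h :: "real \<Rightarrow> real" and c n
    unfolding X_def T_def
    by (rule expectation_polarization_step(1)[OF assms(4,5,6) z that(1) cap that(2)], erule that(3),
        rule expectation_polarization_step(2)[OF assms(4,5,6) z that(1) cap that(2)], erule that(3))
  have a0: "0 \<le> a A n" for A n unfolding a_def by (rule integral_nonneg_AE) (simp add: X_def)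
  have idm: "(\<lambda>t. t) \<in> borel_measurable (borel :: real measure)" by simp
  have id01: "\<bar>t\<bar> \<le> 1" if "t \<in> {0..1}" for t :: real using that by simp
  have part1: "a A n \<le> 2 ^ d / n" if A: "A \<in> sets sphere_measure" and n: "n \<ge> 1" for A n
  proof (rule quadratic_recursion_bound[OF _ a0 _ _ n])
    show "(1::real) \<le> 2 ^ d" by simp
    fix n
    have "a A n \<le> (\<integral>\<omega>. 1 \<partial>P)"
      unfolding a_def by (rule integral_mono[OF Xi[OF A]]) (use X01 in auto)
    then show "a A n \<le> 1" by (simp add: P.prob_space)
    have X2: "integrable P (\<lambda>\<omega>. (X A n \<omega>)\<^sup>2)"
      by (rule P.integrable_const_bound[where B=1]) (use Xm[OF A, of n] X01 in \<open>auto intro!: AE_I2 simp: power_le_one\<close>)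
    have "a A (Suc n) = (\<integral>\<omega>. (\<integral>u. measure sphere_measure (sym_diff (polarization_dir z u (T A n \<omega>)) (polar_cap z A)) \<partial>sphere_measure) \<partial>P)"
      unfolding a_def by (rule Pstep(1)[OF A idm id01])
    also have "\<dots> \<le> (\<integral>\<omega>. X A n \<omega> - (X A n \<omega>)\<^sup>2 / 2 ^ d \<partial>P)"
    proof (rule integral_mono)
      show "integrable P (\<lambda>\<omega>. \<integral>u. measure sphere_measure (sym_diff (polarization_dir z u (T A n \<omega>)) (polar_cap z A)) \<partial>sphere_measure)"
        by (rule Pstep(2)[OF A idm id01])
      show "integrable P (\<lambda>\<omega>. X A n \<omega> - (X A n \<omega>)\<^sup>2 / 2 ^ d)" using Xi[OF A] X2 by auto
      fix \<omega> assume \<omega>: "\<omega> \<in> space P"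
      obtain c where c: "polar_cap z A = {x \<in> sphere 0 1. c \<le> x \<bullet> z}"
        "measure sphere_measure (polar_cap z A) = measure sphere_measure A"
        using polar_cap_props[OF n2 z] by metis
      have TA: "T A n \<omega> \<in> sets sphere_measure" "measure sphere_measure (T A n \<omega>) = measure sphere_measure A"
        using polarizations_measure[OF Udir[OF \<omega>] z A] by (auto simp: T_def)
      show "(\<integral>u. measure sphere_measure (sym_diff (polarization_dir z u (T A n \<omega>)) (polar_cap z A)) \<partial>sphere_measure)
          \<le> X A n \<omega> - (X A n \<omega>)\<^sup>2 / 2 ^ d"
        unfolding X_def by (rule integral_sym_diff_polarization[OF d z TA(1) c(1)]) (simp add: c(2) TA(2))
    qed
    also have "\<dots> = a A n - (\<integral>\<omega>. (X A n \<omega>)\<^sup>2 \<partial>P) / 2 ^ d"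
      using Xi[OF A] X2 by (simp add: a_def)
    also have "\<dots> \<le> a A n - (a A n)\<^sup>2 / 2 ^ d"
    proof -
      \<comment> \<open>Jensen's inequality for the square, in the form that a variance is
        nonnegative.\<close>
      have "(a A n)\<^sup>2 \<le> (\<integral>\<omega>. (X A n \<omega>)\<^sup>2 \<partial>P)"
      proof -
        have "0 \<le> (\<integral>\<omega>. (X A n \<omega> - a A n)\<^sup>2 \<partial>P)" by (rule integral_nonneg_AE) simp
        then show ?thesis unfolding a_def using P.variance_eq[OF Xi[OF A, of n] X2] by simp
      qed
      then show ?thesis by (simp add: divide_right_mono)
    qed
    finally show "a A (Suc n) \<le> a A n - (a A n)\<^sup>2 / 2 ^ d" .
  qed
  \<comment> \<open>A normal orthogonal to the pole starts at \<theta> = \<pi> / 2, where 1 - cos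
    \<theta> = 1. The logarithm then starts at ln (1 + \<delta>) / 2, which is nonnegative, and
    leaves no constant in the exponent.\<close>
  obtain v where v: "norm v = 1" "z \<bullet> v = 0"
  proof -
    obtain x :: 'a where x: "x \<noteq> 0" "orthogonal z x" using orthogonal_to_vector_exists[of z] n2 by auto
    then show ?thesis by (intro that[of "sgn x"]) (auto simp: norm_sgn sgn_div_norm orthogonal_def)
  qed
  define H where "H = hemisphere v"
  have Hs: "H \<in> sets sphere_measure" by (simp add: H_def hemisphere_sets)
  have capH: "measure sphere_measure (sym_diff (hemisphere x) (polar_cap z H)) = measure sphere_measure (sym_diff (hemisphere x) (hemisphere z))" for x
    unfolding H_def by (rule measure_sym_diff_polar_cap_hemisphere[OF n2 v(1) z hemisphere_sets])
  have lower: "exp (- (\<Sum>k<n. a H k) / d) \<le> pi * a H n" for n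
  proof -
    \<comment> \<open>For fixed \<delta> the function \<open>\<phi>\<close> is bounded, so all
      expectations exist, even where the polarized hemisphere already coincides with the
      cap.\<close>
    have "exp (- (\<Sum>k<n. a H k) / d) \<le> pi * a H n + sqrt \<delta>" if \<delta>: "\<delta> > 0" for \<delta>
    proof -
      define \<phi> where "\<phi> t = ln (1 - cos (pi * t) + \<delta>) / 2" for t
      define B where "B = (\<bar>ln \<delta>\<bar> + \<bar>ln (2 + \<delta>)\<bar>) / 2"
      have \<phi>m[measurable]: "\<phi> \<in> borel_measurable borel"
        unfolding \<phi>_def by measurable
      have arg: "0 < 1 - cos (pi * t) + \<delta>" for t using cos_le_one[of "pi * t"] \<delta> by linarith
      have \<phi>B: "\<bar>\<phi> t\<bar> \<le> B" for t
      proof -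
        have "ln \<delta> \<le> ln (1 - cos (pi * t) + \<delta>)" "ln (1 - cos (pi * t) + \<delta>) \<le> ln (2 + \<delta>)"
          using cos_le_one[of "pi * t"] cos_ge_minus_one[of "pi * t"] \<delta> arg[of t] by (auto simp del: cos_le_one cos_ge_minus_one)
        then have "\<bar>ln (1 - cos (pi * t) + \<delta>)\<bar> \<le> \<bar>ln \<delta>\<bar> + \<bar>ln (2 + \<delta>)\<bar>" by linarith
        then show ?thesis by (simp add: \<phi>_def B_def)
      qed
      have \<phi>i: "integrable P (\<lambda>\<omega>. \<phi> (X H n \<omega>))" for n
        by (rule P.integrable_const_bound[where B=B]) (use \<phi>B Xm[OF Hs] in auto)
      have E: "- (\<Sum>k<n. a H k) / d \<le> (\<integral>\<omega>. \<phi> (X H n \<omega>) \<partial>P)"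
      proof (induction n)
        case 0
        have "X H 0 = (\<lambda>_. 1 / 2)"
          using capH[of v] measure_lune[OF n2 v(1) z] v(2)
          by (simp add: fun_eq_iff X_def T_def polarizations_def H_def inner_commute)
        moreover have "cos (pi * (1 / 2)) = 0" by simp
        ultimately show ?case using \<delta> by (simp add: \<phi>_def P.prob_space del: times_divide_eq_right)
      next
        case (Suc n)
        have "(\<integral>\<omega>. \<phi> (X H n \<omega>) - X H n \<omega> / d \<partial>P) \<le>
          (\<integral>\<omega>. (\<integral>u. \<phi> (measure sphere_measure (sym_diff (polarization_dir z u (T H n \<omega>)) (polar_cap z H))) \<partial>sphere_measure) \<partial>P)"
        proof (rule integral_mono)
          show "integrable P (\<lambda>\<omega>. \<integral>u. \<phi> (measure sphere_measure (sym_diff (polarization_dir z u (T H n \<omega>)) (polar_cap z H))) \<partial>sphere_measure)"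
            by (rule Pstep(2)[OF Hs \<phi>m \<phi>B])
          show "integrable P (\<lambda>\<omega>. \<phi> (X H n \<omega>) - X H n \<omega> / d)" using \<phi>i Xi[OF Hs] by auto
          fix \<omega> assume \<omega>: "\<omega> \<in> space P"
          obtain x where x: "norm x = 1" "T H n \<omega> = hemisphere x"
            using polarizations_hemisphere[OF Udir[OF \<omega>] z v(1)] unfolding T_def H_def by blast
          have "(\<integral>u. \<phi> (measure sphere_measure (sym_diff (polarization_dir z u (T H n \<omega>)) (polar_cap z H))) \<partial>sphere_measure)
             = (\<integral>u. \<phi> (measure sphere_measure (sym_diff (polarization_dir z u (hemisphere x)) (hemisphere z))) \<partial>sphere_measure)"
            by (rule Bochner_Integration.integral_cong) (auto simp: x(2) polarization_dir_hemisphere[OF _ z] capH)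
          then show "\<phi> (X H n \<omega>) - X H n \<omega> / d \<le>
            (\<integral>u. \<phi> (measure sphere_measure (sym_diff (polarization_dir z u (T H n \<omega>)) (polar_cap z H))) \<partial>sphere_measure)"
            using polarization_step_log[OF d x(1) z \<delta>] unfolding X_def x(2) capH \<phi>_def by simp
        qed
        also have "\<dots> = (\<integral>\<omega>. \<phi> (X H (Suc n) \<omega>) \<partial>P)"
          by (rule Pstep(1)[OF Hs \<phi>m \<phi>B, symmetric])
        finally have "(\<integral>\<omega>. \<phi> (X H n \<omega>) \<partial>P) - a H n / d \<le> (\<integral>\<omega>. \<phi> (X H (Suc n) \<omega>) \<partial>P)"
          using \<phi>i Xi[OF Hs] by (simp add: a_def)
        with Suc.IH show ?case by (simp add: add_divide_distrib diff_divide_distrib)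
      qed
      \<comment> \<open>\<open>m\<close> is the mean of
        \<open>pi * X H n \<omega> + sqrt \<delta>\<close>. Replacing the logarithm by its tangent
        at \<open>m\<close> yields Jensen's inequality, because the linear correction has mean
        zero.\<close>
      define m where "m = pi * a H n + sqrt \<delta>"
      have m: "m > 0" using a0[of H n] \<delta> by (simp add: m_def add_nonneg_pos)
      have pt: "\<phi> (X H n \<omega>) \<le> ln m + ((pi * X H n \<omega> + sqrt \<delta>) / m - 1)" for \<omega>
      proof -
        define L where "L = pi * X H n \<omega> + sqrt \<delta>"
        have L: "L > 0" using X01[of H n \<omega>] \<delta> by (simp add: L_def add_nonneg_pos)
        have "\<phi> (X H n \<omega>) = ln (sqrt (1 - cos (pi * X H n \<omega>) + \<delta>))"
          using arg[of "X H n \<omega>"] by (simp add: \<phi>_def ln_sqrt)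
        also have "\<dots> \<le> ln L"
          using sqrt_one_minus_cos_le[of "pi * X H n \<omega>" \<delta>] X01[of H n \<omega>] \<delta> arg[of "X H n \<omega>"] L
          by (simp add: L_def)
        also have "\<dots> = ln m + ln (L / m)" using L m by (simp add: ln_div)
        also have "ln (L / m) \<le> L / m - 1" using L m by (intro ln_le_minus_one) simp
        finally show ?thesis by (simp add: L_def)
      qed
      have "(\<integral>\<omega>. \<phi> (X H n \<omega>) \<partial>P) \<le> (\<integral>\<omega>. ln m + ((pi * X H n \<omega> + sqrt \<delta>) / m - 1) \<partial>P)"
        by (rule integral_mono[OF \<phi>i _ pt]) (use Xi[OF Hs] in auto)
      also have "\<dots> = ln m + ((pi * a H n + sqrt \<delta>) / m - 1)"
        using Xi[OF Hs, of n] by (simp add: a_def P.prob_space)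
      also have "\<dots> = ln m" using m by (simp add: m_def)
      finally have "- (\<Sum>k<n. a H k) / d \<le> ln m" using E by simp
      then show ?thesis using m unfolding m_def[symmetric] by (metis exp_le_cancel_iff exp_ln)
    qed
    \<comment> \<open>Now n is fixed and \<delta> tends to 0; the left side does not depend on
      \<delta>.\<close>
    then have ev: "eventually (\<lambda>\<delta>. exp (- (\<Sum>k<n. a H k) / d) \<le> pi * a H n + sqrt \<delta>) (at_right 0)"
      by (auto simp: eventually_at_filter)
    have "((\<lambda>\<delta>. pi * a H n + sqrt \<delta>) \<longlongrightarrow> pi * a H n + sqrt 0) (at_right 0)"
      by (intro tendsto_intros)
    from tendsto_lowerbound[OF this ev] show ?thesis by simp
  qed
  have contra: False if "0 \<le> c" "c < d" "eventually (\<lambda>n. a H n \<le> c / n) sequentially" for c :: real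
    by (rule log_recursion_contradiction[OF _ pi_gt_zero that(1,2) lower that(3)]) (use d in simp)
  \<comment> \<open>Any constant strictly between 0 and d would serve in place of 1/2: since p > 1,
    \<open>C * real n powr (1 - p)\<close> eventually drops below it.\<close>
  have part2: False if p: "p > 1" and C: "\<And>n. n \<ge> 1 \<Longrightarrow> a H n \<le> C * real n powr (- p)" for p C
  proof (rule contra[of "1/2"])
    have "(\<lambda>n. C * real n powr (1 - p)) \<longlonglongrightarrow> C * 0"
      using p by (intro tendsto_intros tendsto_neg_powr filterlim_real_sequentially) auto
    then have "eventually (\<lambda>n. C * real n powr (1 - p) < 1 / 2) sequentially"
      by (rule order_tendstoD) simp
    then show "eventually (\<lambda>n. a H n \<le> 1 / 2 / n) sequentially"
      using eventually_ge_at_top[of 1]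
    proof eventually_elim
      case (elim n)
      have "a H n \<le> C * real n powr (- p)" using C elim by simp
      also have "\<dots> = C * real n powr (1 - p) / n"
        using elim by (simp add: powr_diff powr_minus field_simps)
      also have "\<dots> \<le> 1 / 2 / n" using elim by (intro divide_right_mono) auto
      finally show ?case .
    qed
  qed (use d in auto)
  have part3: "C \<ge> d" if C: "\<And>n. n \<ge> 1 \<Longrightarrow> a H n \<le> C / n" for C :: real
  proof (rule ccontr)
    assume "\<not> C \<ge> d"
    \<comment> \<open>\<open>contra\<close> asks for a nonnegative constant, and nothing is assumed
      about the sign of \<open>C\<close>, hence the maximum with 0; it is still below d because d is
      positive.\<close>
    show False
    proof (rule contra[of "max 0 C"])
      show "eventually (\<lambda>n. a H n \<le> max 0 C / n) sequentially"
        using eventually_ge_at_top[of 1]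
      proof eventually_elim
        case (elim n)
        have "C / n \<le> max 0 C / n" by (intro divide_right_mono) auto
        with C[OF elim] show ?case by linarith
      qed
    qed (use \<open>\<not> C \<ge> d\<close> d in auto)
  qed
  show ?thesis
    unfolding ed
  proof (intro conjI allI impI ballI notI)
    fix A :: "'a set" and n :: nat assume "A \<in> sets sphere_measure" "n \<ge> 1"
    then show "a A n \<le> 2 ^ d * inverse (real n)" using part1 by (simp add: divide_inverse)
  next
    assume "\<exists>p C. p > 1 \<and> (\<forall>A\<in>sets sphere_measure. \<forall>n\<ge>1. a A n \<le> C * real n powr (- p))"
    then show False using part2 Hs by blast
  next
    fix C assume "\<forall>A\<in>sets sphere_measure. \<forall>n\<ge>1. a A n \<le> C * inverse (real n)"
    then show "real d \<le> C" using Hs by (intro part3) (simp add: divide_inverse)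
  qed
qed

end
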